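(* For $r\in\{0,1,2\}$, \begin{align*} (q)_\infty^3\mathcal C_{1,2r+1}^{(3,8)}(q)&=\Theta_{1,2r+1}^{(3,8)}(q)-q^{1-2r}\frac{j(q^{6-2r};q^{16})j(q^{28-4r};q^{32})}{J_{32}}\big(-\psi_3(-q)\big)\\ &\quad+q^{-r}\frac{j(q^{2+2r};q^{16})j(q^{20+4r};q^{32})}{J_{32}}\big(1-\chi_3(q)\big), \end{align*} where $\Theta_{1,1}^{(3,8)}(q)=\frac{J_3J_4^2}{J_2J_{12}}j(-q^6;q^{16})$, $\Theta_{1,3}^{(3,8)}(q)=3\frac{J_3J_{12}^3}{J_6^2}$, and $\Theta_{1,5}^{(3,8)}(q)=q^{-2}\frac{J_3J_4^2}{J_2J_{12}}j(-q^2;q^{16})$.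
   Context: $q=e^{2\pi i\tau}$, $\mathrm{Im}\,\tau>0$; $(x;q)_n=\prod_{i=0}^{n-1}(1-q^ix)$, $(x)_\infty=\prod_{i\ge0}(1-q^ix)$; $j(x;q)=(x)_\infty(q/x)_\infty(q)_\infty$; $J_a=\prod_{i\ge1}(1-q^{ai})$. Third-order mock theta functions: $\psi_3(q)=\sum_{n\ge1}\frac{q^{n^2}}{(q;q^2)_n}$, $\chi_3(q)=\sum_{n\ge0}\frac{q^{n^2}(-q;q)_n}{(-q^3;q^3)_n}$. For coprime $p'\ge2,p\ge1$, $0\le\ell\le p'-2$, level $N=p'/p-2$, the admissible character is $\chi_\ell^{(p,p')}(z;q)=z^{-\frac{\ell+1}{2}}q^{\frac{p(\ell+1)^2}{4p'}}\frac{j(-q^{p(\ell+1)+pp'}z^{-p'};q^{2pp'})-z^{\ell+1}j(-q^{-p(\ell+1)+pp'}z^{-p'};q^{2pp'})}{z^{-1/2}q^{1/8}j(z;q)}$; string functions $C_{m,\ell}^{(p,p')}(q)$ ($m\in2\mathbb Z+\ell$) are defined by $\chi_\ell^{(p,p')}(z;q)=\sum_{m\in2\mathbb Z+\ell}C_{m,\ell}^{(p,p')}(q)q^{m^2/(4N)}z^{-m/2}$ (expansion in $|q|<|z|<1$), and $\mathcal C_{m,\ell}^{(p,p')}(q)=q^{-s}C_{m,\ell}^{(p,p')}(q)$ with $s=-\frac18+\frac{p(\ell+1)^2}{4p'}-\frac{m^2}{4N}$. *)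

theory Defs
  imports "HOL-Analysis.Analysis"
begin

definition qpoch :: "complex \<Rightarrow> complex \<Rightarrow> nat \<Rightarrow> complex"
  where "qpoch x q n = (\<Prod>i<n. 1 - q ^ i * x)"

definition qpoch_inf :: "complex \<Rightarrow> complex \<Rightarrow> complex"
  where "qpoch_inf x q = (\<Prod>i. 1 - q ^ i * x)"

definition jtheta :: "complex \<Rightarrow> complex \<Rightarrow> complex"
  where "jtheta x q = qpoch_inf x q * qpoch_inf (q / x) q * qpoch_inf q q"

definition J :: "nat \<Rightarrow> complex \<Rightarrow> complex"
  where "J a q = (\<Prod>i. 1 - q ^ (a * Suc i))"

definition psi3 :: "complex \<Rightarrow> complex"
  where "psi3 q = (\<Sum>k. let n = Suc k in q ^ (n\<^sup>2) / qpoch q (q\<^sup>2) n)"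

definition chi3 :: "complex \<Rightarrow> complex"
  where "chi3 q = (\<Sum>n. q ^ (n\<^sup>2) * qpoch (- q) q n / qpoch (- (q ^ 3)) (q ^ 3) n)"

text \<open>
  Fractional powers of \<open>q\<close> and \<open>z\<close> are made single-valued by the uniformisation
  \<open>q = exp (2 \<pi> \<i> \<tau>)\<close>, \<open>z = exp (2 \<pi> \<i> u)\<close>: the power \<open>q\<^sup>a\<close> is \<open>epow \<tau> a\<close> and \<open>z\<^sup>a\<close> is
  \<open>epow u a\<close>. The annulus \<open>|q| < |z| < 1\<close> becomes the strip \<open>0 < Im u < Im \<tau>\<close>.
\<close>

definition epow :: "complex \<Rightarrow> real \<Rightarrow> complex"
  where "epow t a = exp (2 * of_real pi * \<i> * of_real a * t)"

definition adm_level :: "nat \<Rightarrow> nat \<Rightarrow> real"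
  where "adm_level p p' = real p' / real p - 2"

text \<open>
  The next four definitions are meant for coprime \<open>p \<ge> 1\<close>, \<open>p' \<ge> 2\<close> with \<open>p' \<noteq> 2 * p\<close>
  (nonzero level), and \<open>l \<le> p' - 2\<close>.
\<close>

definition adm_char :: "nat \<Rightarrow> nat \<Rightarrow> nat \<Rightarrow> complex \<Rightarrow> complex \<Rightarrow> complex"
  where "adm_char p p' l u \<tau> =
    epow u (- (real l + 1) / 2) * epow \<tau> (real p * (real l + 1)\<^sup>2 / (4 * real p')) *
    (jtheta (- (epow \<tau> (real p * (real l + 1) + real p * real p') * epow u (- real p')))
            (epow \<tau> (2 * real p * real p'))
     - epow u (real l + 1) *
       jtheta (- (epow \<tau> (- real p * (real l + 1) + real p * real p') * epow u (- real p')))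
              (epow \<tau> (2 * real p * real p')))
    / (epow u (- 1 / 2) * epow \<tau> (1 / 8) * jtheta (epow u 1) (epow \<tau> 1))"

text \<open>
  \<open>C\<close> is the family of coefficients in the expansion of the character, indexed by
  \<open>m \<in> 2\<int> + l\<close>. It is required to vanish off this index set, so that the Laurent expansion
  determines it as a function on all of \<open>int\<close>.
\<close>

definition is_string_family ::
    "nat \<Rightarrow> nat \<Rightarrow> nat \<Rightarrow> complex \<Rightarrow> (int \<Rightarrow> complex) \<Rightarrow> bool"
  where "is_string_family p p' l \<tau> C \<longleftrightarrow>
    (\<forall>m. odd (m - int l) \<longrightarrow> C m = 0) \<and>
    (\<forall>u. 0 < Im u \<and> Im u < Im \<tau> \<longrightarrow>
      ((\<lambda>m. C m * epow \<tau> ((real_of_int m)\<^sup>2 / (4 * adm_level p p')) * epow u (- real_of_int m / 2))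
         has_sum adm_char p p' l u \<tau>) {m. even (m - int l)})"

definition string_fun :: "nat \<Rightarrow> nat \<Rightarrow> int \<Rightarrow> nat \<Rightarrow> complex \<Rightarrow> complex"
  where "string_fun p p' m l \<tau> = (THE C. is_string_family p p' l \<tau> C) m"

definition norm_string_fun :: "nat \<Rightarrow> nat \<Rightarrow> int \<Rightarrow> nat \<Rightarrow> complex \<Rightarrow> complex"
  where "norm_string_fun p p' m l \<tau> =
    (let s = - 1 / 8 + real p * (real l + 1)\<^sup>2 / (4 * real p')
               - (real_of_int m)\<^sup>2 / (4 * adm_level p p')
     in epow \<tau> (- s) * string_fun p p' m l \<tau>)"

text \<open>
  \<open>\<Theta>\<^bsub>1,l\<^esub>\<close> for \<open>(p, p') = (3, 8)\<close>; only \<open>l = 1, 3, 5\<close> are meaningful.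
\<close>

definition Theta38 :: "nat \<Rightarrow> complex \<Rightarrow> complex"
  where "Theta38 l q =
    (if l = 1 then J 3 q * (J 4 q)\<^sup>2 / (J 2 q * J 12 q) * jtheta (- (q ^ 6)) (q ^ 16)
     else if l = 3 then 3 * (J 3 q * (J 12 q) ^ 3 / (J 6 q)\<^sup>2)
     else if l = 5 then
       q powi (- 2) * (J 3 q * (J 4 q)\<^sup>2 / (J 2 q * J 12 q)) * jtheta (- (q\<^sup>2)) (q ^ 16)
     else undefined)"

end

theory Submission
  imports Defs
begin

text \<open>
  Expanding \<open>1 / j(z;q)\<close> in \<open>\<bar>q\<bar> < \<bar>z\<bar> < 1\<close> by partial fractions and multiplying by the theta numerator
  of the character expresses \<open>(q)\<^sub>\<infinity>\<^sup>3 C\<^sub>1\<^sub>,\<^sub>2\<^sub>r\<^sub>+\<^sub>1\<close> as a Laurent coefficient \<open>h\<^sub>0\<close>. After symmetrising under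
  \<open>r \<mapsto> 2 - r\<close>, the sequence through \<open>h\<^sub>0\<close> satisfies
  \<open>h\<^sub>k = q\<^sup>3\<^sup>k\<^sup>-\<^sup>3 h\<^sub>k\<^sub>-\<^sub>1 + (q\<^sup>k\<^sup>-\<^sup>1 - q\<^sup>2\<^sup>k\<^sup>-\<^sup>2) \<rho>\<close>, so its generating function is \<open>h\<^sub>0 j(-z;q\<^sup>3)\<close> plus \<open>\<rho>\<close> times
  bilateral sums with poles. The limit \<open>z \<rightarrow> -q\<close> solves for \<open>h\<^sub>0\<close> in terms of \<open>\<rho>\<close> and Appell sums of base
  \<open>q\<^sup>3\<close> at \<open>-1\<close>. These are \<open>\<chi>\<^sub>3\<close> and \<open>f\<^sub>3\<close> up to theta quotients (Durfee squares and the rank generating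
  function), and \<open>f\<^sub>3(q) + 4 \<psi>\<^sub>3(-q)\<close> is a theta quotient as well. The factors \<open>\<rho>\<close> are products by the
  quintuple product identity, and the remaining eta quotients follow from Kronecker's bilateral sum
  and the product formula for two theta functions.
\<close>

section \<open>Sums over the integers\<close>

text \<open>The obstacle is that the recurrence of a single character need not close: multiplying
  the m-th numerator coefficient by q^(-3m) turns l into 6 - l, so only l = 3 is its own partner.
  For l = 1 and 5 one weighted sum closes; the missing second relation is the equality of the
  coefficients at m = 1 and m = -1. The point -q is chosen because the numerator is even in z, so
  its value there is again a multiple of \<rho>, because j(-z;q^3) becomes j(q;q^3) = (q)_inf, which
  is nonzero, and because the polar sums become Appell sums there. What remains is linear algebra in
  three quantities: an Appell sum W and the theta quotients K = J_1^3/j(-1;q) and K3 =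
  J_3^3/j(-1;q^3). The two mock theta functions give two relations, so (3 K3 + K)/(2 J_1) equals
  chi_3(q) + psi_3(-q). Exchanging one for the other brings the values into the shape of the
  statement, with 1 - chi_3 beside psi_3, and the theta quotient left over is Theta.\<close>

lemma infsum_tendsto_dominated:
  fixes f :: "'b \<Rightarrow> 'a \<Rightarrow> 'c::banach"
  assumes g: "g summable_on A" and dom: "\<forall>\<^sub>F n in F. \<forall>k\<in>A. norm (f n k) \<le> g k"
    and lim: "\<And>k. k \<in> A \<Longrightarrow> ((\<lambda>n. f n k) \<longlongrightarrow> h k) F" and F: "F \<noteq> bot"
  shows "((\<lambda>n. infsum (f n) A) \<longlongrightarrow> infsum h A) F"
proof (rule tendstoI)
  fix e :: real assume e: "e > 0"
  have hg: "norm (h k) \<le> g k" if "k \<in> A" for k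
  proof (rule tendsto_upperbound[OF tendsto_norm[OF lim[OF that]] _ F])
    show "\<forall>\<^sub>F n in F. norm (f n k) \<le> g k"
      using dom by eventually_elim (use that in auto)
  qed
  have g0: "g k \<ge> 0" if "k \<in> A" for k
    using hg[OF that] norm_ge_zero order_trans by blast
  \<comment> \<open>Tannery's argument: a finite set B carries all of the dominating sum but e/8, so
    the tails of both sums are small uniformly in n and only the finite part needs the termwise
    limit.\<close>
  obtain B where B: "finite B" "B \<subseteq> A" and Bd: "dist (sum g B) (infsum g A) \<le> e / 8"
    using infsum_finite_approximation[OF g, of "e/8"] e by auto
  have gAB: "g summable_on (A - B)"
    using g summable_on_subset_banach[of g A "A - B"] by blast
  have split_g: "infsum g A = sum g B + infsum g (A - B)"
    using infsum_Un_disjoint[of g B "A - B"] B gAB by (simp add: Un_absorb1)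
  have tail: "infsum g (A - B) \<le> e / 8"
    using Bd unfolding split_g dist_real_def by linarith
  have tail_bound: "norm (infsum u (A - B)) \<le> e / 8" and sum_split: "infsum u A = sum u B + infsum u (A - B)"
    if u: "\<And>k. k \<in> A \<Longrightarrow> norm (u k) \<le> g k" for u :: "'a \<Rightarrow> 'c"
  proof -
    have ab: "(\<lambda>k. norm (u k)) summable_on (A - B)"
      by (rule summable_on_comparison_test[OF gAB]) (use u in auto)
    have us: "u summable_on (A - B)" using ab abs_summable_summable by blast
    have "norm (infsum u (A - B)) \<le> infsum (\<lambda>k. norm (u k)) (A - B)"
      by (rule norm_infsum_bound[OF ab])
    also have "\<dots> \<le> infsum g (A - B)"
      by (rule infsum_mono[OF ab gAB]) (use u in auto)
    finally show "norm (infsum u (A - B)) \<le> e / 8" using tail by simp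
    show "infsum u A = sum u B + infsum u (A - B)"
      using infsum_Un_disjoint[of u B "A - B"] B us by (simp add: Un_absorb1)
  qed
  have "((\<lambda>n. \<Sum>k\<in>B. f n k) \<longlongrightarrow> (\<Sum>k\<in>B. h k)) F"
    by (intro tendsto_sum lim) (use B in auto)
  then have "\<forall>\<^sub>F n in F. dist (\<Sum>k\<in>B. f n k) (\<Sum>k\<in>B. h k) < e / 2"
    by (rule tendstoD) (use e in simp)
  then show "\<forall>\<^sub>F n in F. dist (infsum (f n) A) (infsum h A) < e"
    using dom
  proof eventually_elim
    case (elim n)
    have fb: "norm (f n k) \<le> g k" if "k \<in> A" for k using elim that by auto
    have "dist (infsum (f n) A) (infsum h A)
        = norm ((sum (f n) B - sum h B) + (infsum (f n) (A - B) - infsum h (A - B)))"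
      using sum_split[OF fb] sum_split[OF hg] by (simp add: dist_norm algebra_simps)
    also have "\<dots> \<le> norm (sum (f n) B - sum h B) + (norm (infsum (f n) (A - B)) + norm (infsum h (A - B)))"
      by (intro order_trans[OF norm_triangle_ineq] add_mono order_refl norm_triangle_ineq4)
    also have "\<dots> < e"
      using elim(1) tail_bound[OF fb] tail_bound[OF hg] e by (simp add: dist_norm)
    finally show ?case .
  qed
qed

lemma has_sum_product_complex:
  fixes f :: "'a \<Rightarrow> complex" and g :: "'b \<Rightarrow> complex"
  assumes "(f has_sum a) A" "(g has_sum b) B"
  shows "((\<lambda>(x,y). f x * g y) has_sum (a * b)) (A \<times> B)"
proof -
  have f: "(\<lambda>x. norm (f x)) summable_on A" and g: "(\<lambda>x. norm (g x)) summable_on B"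
    using assms summable_on_iff_abs_summable_on_complex has_sum_imp_summable by blast+
  have "(\<lambda>z. norm (case z of (x,y) \<Rightarrow> f x * g y)) summable_on (A \<times> B)"
    unfolding Infinite_Sum.abs_summable_on_Sigma_iff
    using f g by (auto simp: norm_mult infsum_cmult_right' norm_infsum_le abs_mult intro!: summable_on_cmult_right summable_on_cmult_left)
  then have s: "(\<lambda>(x,y). f x * g y) summable_on (A \<times> B)"
    by (rule abs_summable_summable)
  show ?thesis
  proof (rule has_sum_SigmaI[OF _ _ s])
    show "((\<lambda>y. case (x, y) of (x, y) \<Rightarrow> f x * g y) has_sum f x * b) B" for x
      using has_sum_cmult_right[OF assms(2)] by simp
    show "((\<lambda>x. f x * b) has_sum a * b) A"
      using has_sum_cmult_left[OF assms(1)] by simp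
  qed
qed

text \<open>The Cauchy product for Laurent series: when \<open>f\<close> and \<open>g\<close> carry
  the powers of z, the inner sum at s is the term of degree s of the product.\<close>

lemma has_sum_convolution:
  fixes f g :: "int \<Rightarrow> complex"
  assumes "(f has_sum a) UNIV" "(g has_sum b) UNIV"
  shows "((\<lambda>s. \<Sum>\<^sub>\<infinity>m. f m * g (s - m)) has_sum (a * b)) UNIV"
    and "(\<lambda>m. f m * g (s - m)) summable_on UNIV"
proof -
  have "((\<lambda>(s,m). f m * g (s - m)) has_sum (a * b)) (UNIV \<times> UNIV) \<longleftrightarrow>
      ((\<lambda>(x,y). f x * g y) has_sum (a * b)) (UNIV \<times> UNIV)"
    by (rule has_sum_reindex_bij_witness[of _ "\<lambda>(m,k). (m+k,m)" "\<lambda>(s,m). (m,s-m)"]) auto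
  then have *: "((\<lambda>(s,m). f m * g (s - m)) has_sum (a * b)) (UNIV \<times> UNIV)"
    using has_sum_product_complex[OF assms] by blast
  have sm: "(\<lambda>m. f m * g (s - m)) summable_on UNIV" for s
    using summable_on_SigmaD1[of "\<lambda>s m. f m * g (s - m)" UNIV "\<lambda>_. UNIV" s]
      has_sum_imp_summable[OF *] by simp
  show "(\<lambda>m. f m * g (s - m)) summable_on UNIV" by (rule sm)
  show "((\<lambda>s. \<Sum>\<^sub>\<infinity>m. f m * g (s - m)) has_sum (a * b)) UNIV"
    by (rule has_sum_SigmaD[OF *]) (use sm in \<open>auto intro: has_sum_infsum\<close>)
qed

lemma summable_on_int_halves:
  fixes f :: "int \<Rightarrow> real"
  assumes "(\<lambda>n. f (int n)) summable_on UNIV" "(\<lambda>n. f (- int n - 1)) summable_on UNIV"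
  shows "f summable_on UNIV"
proof -
  have "f summable_on range int"
    using assms(1) by (subst summable_on_reindex) (auto simp: o_def)
  moreover have "f summable_on range (\<lambda>n. - int n - 1)"
    using assms(2) by (subst summable_on_reindex) (auto simp: o_def inj_on_def)
  moreover have "UNIV = range int \<union> range (\<lambda>n. - int n - 1)"
  proof -
    have "x \<in> range int \<union> range (\<lambda>n. - int n - 1)" for x
    proof (cases "x \<ge> 0")
      case True
      then show ?thesis by (metis UnI1 nonneg_int_cases rangeI)
    next
      case False
      then have "x = - int (nat (- x - 1)) - 1" by simp
      then show ?thesis by blast
    qed
    then show ?thesis by blast
  qed
  ultimately show ?thesis using summable_on_union[of f "range int" "range (\<lambda>n. - int n - 1)"] by simp
qed

section \<open>Triangular numbers and convergence of bilateral theta series\<close>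

definition tri :: "int \<Rightarrow> int" where "tri n = n * (n - 1) div 2"

lemma two_tri: "2 * tri n = n * (n - 1)"
  unfolding tri_def by (rule dvd_mult_div_cancel) simp

lemma tri_eqI: "2 * a = n * (n - 1) \<Longrightarrow> tri n = a"
  using two_tri[of n] by simp

lemma tri_add: "tri (m + n) = tri m + tri n + m * n"
proof (rule tri_eqI)
  have "2 * (tri m + tri n + m * n) = m * (m - 1) + n * (n - 1) + 2 * (m * n)"
    by (simp only: distrib_left two_tri)
  also have "\<dots> = (m + n) * (m + n - 1)" by (simp add: algebra_simps)
  finally show "2 * (tri m + tri n + m * n) = (m + n) * (m + n - 1)" .
qed

lemma tri_minus: "tri (- n) = tri n + n"
proof (rule tri_eqI)
  have "2 * (tri n + n) = n * (n - 1) + 2 * n" by (simp only: distrib_left two_tri)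
  also have "\<dots> = - n * (- n - 1)" by (simp add: algebra_simps)
  finally show "2 * (tri n + n) = - n * (- n - 1)" .
qed

lemma tri_diff: "tri (m - n) = tri m + tri n + n - m * n"
  using tri_add[of m "-n"] by (simp add: tri_minus)

lemma tri_01 [simp]: "tri 0 = 0" "tri 1 = 0" "tri 2 = 1"
  by (simp_all add: tri_def)

lemma tri_Suc: "tri (n + 1) = tri n + n"
  by (simp add: tri_add)

text \<open>Consecutive terms have ratio a^n c with c fixed, where c = b upwards and c = a^2/b
  downwards. Since a < 1, the ratio test applies to both halves for every b > 0.\<close>

lemma summable_gauss_real:
  fixes a b :: real
  assumes a: "0 < a" "a < 1" and b: "b > 0"
  shows "(\<lambda>n. a powi (tri n) * b powi n) summable_on (UNIV :: int set)"
proof -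
  have *: "(\<lambda>n. f (int n)) summable_on UNIV"
    if pos: "\<And>n. f n > 0" and rat: "\<And>n. f (int (Suc n)) = a ^ n * c * f (int n)" and c: "c > 0"
    for f :: "int \<Rightarrow> real" and c
  proof -
    have "(\<lambda>n. a ^ n * c) \<longlonglongrightarrow> 0 * c"
      using a by (intro tendsto_mult LIMSEQ_realpow_zero tendsto_const) auto
    then have "\<forall>\<^sub>F n in sequentially. a ^ n * c < 1/2"
      by (intro order_tendstoD) auto
    then obtain N where N: "\<And>n. n \<ge> N \<Longrightarrow> a ^ n * c < 1/2"
      by (auto simp: eventually_sequentially)
    have "summable (\<lambda>n. f (int n))"
    proof (rule summable_ratio_test[of "1/2" N])
      fix n assume "n \<ge> N"
      then have "a ^ n * c * f (int n) \<le> 1/2 * f (int n)"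
        using N[of n] pos[of "int n"] by (intro mult_right_mono) auto
      then show "norm (f (int (Suc n))) \<le> 1/2 * norm (f (int n))"
        unfolding rat using pos[of "int n"] c a by (simp add: abs_mult)
    qed simp
    then show ?thesis
      using pos by (subst summable_on_UNIV_nonneg_real_iff) (auto intro: less_imp_le)
  qed
  have 1: "(\<lambda>n. a powi (tri (int n)) * b powi (int n)) summable_on UNIV"
  proof (rule *[of "\<lambda>n. a powi (tri n) * b powi n" b])
    show "a powi tri (int (Suc n)) * b powi int (Suc n) = a ^ n * b * (a powi tri (int n) * b powi int n)" for n
      using a b tri_Suc[of "int n"] by (simp add: power_int_add add.commute)
  qed (use a b in auto)
  have 2: "(\<lambda>n. a powi (tri (- int n - 1)) * b powi (- int n - 1)) summable_on UNIV"
  proof (rule *[of "\<lambda>n. a powi (tri (- n - 1)) * b powi (- n - 1)" "a\<^sup>2 / b"])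
    fix n
    have e: "- int (Suc n) - 1 = (- int n - 1) - 1" by simp
    have "tri (- int (Suc n) - 1) = tri (- int n - 1) + (int n + 2)"
      unfolding e by (simp add: tri_diff algebra_simps)
    moreover have "a powi (int n + 2) = a ^ n * a\<^sup>2"
      using a by (simp add: power_int_add)
    ultimately show "a powi tri (- int (Suc n) - 1) * b powi (- int (Suc n) - 1)
        = a ^ n * (a\<^sup>2 / b) * (a powi tri (- int n - 1) * b powi (- int n - 1))"
      using a b unfolding e by (simp add: power_int_add power_int_diff field_simps power2_eq_square)
  qed (use a b in auto)
  from summable_on_int_halves[OF 1 2] show ?thesis .
qed

text \<open>The bounded weight \<open>c\<close> absorbs signs, factors 1/(q)_m and denominators 1 -
  z q^n, so one criterion serves theta, Appell and Durfee series.\<close>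

lemma summable_gauss:
  fixes q x :: complex
  assumes "norm q < 1" "q \<noteq> 0" "x \<noteq> 0" "\<And>n. norm (c n) \<le> C"
  shows "(\<lambda>n. c n * (q powi (tri n) * x powi n)) summable_on (UNIV :: int set)"
proof -
  have "(\<lambda>n. C * (norm q powi (tri n) * norm x powi n)) summable_on (UNIV :: int set)"
    by (intro summable_on_cmult_right summable_gauss_real) (use assms in auto)
  then have "(\<lambda>n. norm (c n * (q powi (tri n) * x powi n))) summable_on (UNIV :: int set)"
    by (rule summable_on_comparison_test)
       (use assms(4) in \<open>auto simp: norm_mult norm_power_int intro!: mult_right_mono\<close>)
  then show ?thesis by (rule abs_summable_summable)
qed

lemma has_sum_diff:
  fixes f g :: "'a \<Rightarrow> complex"
  assumes "(f has_sum a) A" "(g has_sum b) A"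
  shows "((\<lambda>x. f x - g x) has_sum (a - b)) A"
  using has_sum_add[OF assms(1) has_sum_uminusI[OF assms(2)]] by simp

lemma norm_m1_powi [simp]: "norm ((-1 :: complex) powi n) = 1"
  by (simp add: norm_power_int)

lemma m1_powi_Suc [simp]: "(-1 :: complex) powi (n + 1) = - ((-1) powi n)"
  by (simp add: power_int_add)

lemma m1_powi_minus [simp]: "(-1 :: complex) powi (- n) = (-1) powi n"
  by (simp add: power_int_minus_left)

lemma m1_powi_sq: "(-1 :: complex) powi n * (-1) powi n = 1"
  by (simp flip: power_int_mult_distrib)

lemma divide_m1_powi [simp]: "x / (-1 :: complex) powi n = x * (-1) powi n"
  using m1_powi_sq[of n] by (metis divide_eq_eq mult.assoc mult.right_neutral mult_zero_right zero_neq_one)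

section \<open>Triple product and partial fractions\<close>

lemma abs_convergent_qpoch:
  fixes q x :: complex
  assumes "norm q < 1"
  shows "abs_convergent_prod (\<lambda>i. 1 - q ^ i * x)"
proof -
  have "summable (\<lambda>i. norm x * norm q ^ i)"
    using assms by (intro summable_mult summable_geometric) auto
  then show ?thesis
    by (simp add: abs_convergent_prod_conv_summable norm_mult norm_power mult.commute)
qed

lemma qpoch_LIMSEQ:
  assumes "norm q < 1"
  shows "(\<lambda>n. qpoch x q n) \<longlonglongrightarrow> qpoch_inf x q"
proof -
  have "(\<lambda>n. \<Prod>i\<le>n. 1 - q ^ i * x) \<longlonglongrightarrow> qpoch_inf x q"
    unfolding qpoch_inf_def
    by (intro convergent_prod_LIMSEQ abs_convergent_prod_imp_convergent_prod abs_convergent_qpoch assms)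
  then have "(\<lambda>n. qpoch x q (Suc n)) \<longlonglongrightarrow> qpoch_inf x q"
    unfolding qpoch_def lessThan_Suc_atMost .
  then show ?thesis by (simp only: filterlim_sequentially_Suc)
qed

lemma qpoch_inf_nonzero:
  assumes "norm q < 1" "\<And>i. q ^ i * x \<noteq> 1"
  shows "qpoch_inf x q \<noteq> 0"
  unfolding qpoch_inf_def
  using prodinf_nonzero[OF abs_convergent_prod_imp_convergent_prod[OF abs_convergent_qpoch[OF assms(1)]]] assms(2)
  by (metis eq_iff_diff_eq_0)

lemma qpoch_0 [simp]: "qpoch x q 0 = 1"
  by (simp add: qpoch_def)

lemma qpoch_Suc: "qpoch x q (Suc n) = qpoch x q n * (1 - q ^ n * x)"
  by (simp add: qpoch_def)

lemma qpoch_Suc_left: "qpoch x q (Suc n) = (1 - x) * qpoch (q * x) q n"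
  by (simp add: qpoch_def prod.lessThan_Suc_shift mult_ac del: prod.lessThan_Suc)

lemma qpoch_inf_rec:
  assumes "norm q < 1"
  shows "qpoch_inf x q = (1 - x) * qpoch_inf (q * x) q"
proof (rule LIMSEQ_unique)
  show "(\<lambda>n. qpoch x q (Suc n)) \<longlonglongrightarrow> qpoch_inf x q"
    using qpoch_LIMSEQ[OF assms] by (simp only: filterlim_sequentially_Suc)
  show "(\<lambda>n. qpoch x q (Suc n)) \<longlonglongrightarrow> (1 - x) * qpoch_inf (q * x) q"
    unfolding qpoch_Suc_left by (intro tendsto_intros qpoch_LIMSEQ assms)
qed

lemma qpoch_inf_split:
  assumes "norm q < 1"
  shows "qpoch_inf x q = qpoch x q n * qpoch_inf (q ^ n * x) q"
proof (induction n)
  case (Suc n)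
  then show ?case
    using qpoch_inf_rec[OF assms, of "q ^ n * x"] by (simp add: qpoch_Suc mult_ac)
qed simp

text \<open>The factors whose index is congruent to i modulo m form a product of base q^m.\<close>

lemma qpoch_inf_dissect:
  assumes "norm q < 1" "m > 0"
  shows "qpoch_inf x q = (\<Prod>i<m. qpoch_inf (q ^ i * x) (q ^ m))"
proof (rule LIMSEQ_unique)
  have sm: "strict_mono (\<lambda>n. n * m)" using assms(2) by (auto simp: strict_mono_def)
  show "(\<lambda>n. qpoch x q (n * m)) \<longlonglongrightarrow> qpoch_inf x q"
    using LIMSEQ_subseq_LIMSEQ[OF qpoch_LIMSEQ[OF assms(1)] sm] by (simp add: o_def)
  have qm: "norm (q ^ m) < 1"
    using assms by (simp add: norm_power power_less_one_iff)
  have "qpoch x q (n * m) = (\<Prod>i<m. qpoch (q ^ i * x) (q ^ m) n)" for n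
  proof -
    have "qpoch x q (n * m) = (\<Prod>k<n. \<Prod>j\<in>{k*m..<k*m+m}. 1 - q ^ j * x)"
      unfolding qpoch_def by (rule prod.nat_group[symmetric])
    also have "\<dots> = (\<Prod>k<n. \<Prod>i<m. 1 - q ^ (k * m + i) * x)"
    proof (rule prod.cong[OF refl])
      fix k
      show "(\<Prod>j\<in>{k*m..<k*m+m}. 1 - q ^ j * x) = (\<Prod>i<m. 1 - q ^ (k * m + i) * x)"
        by (rule prod.reindex_bij_witness[of _ "\<lambda>i. k * m + i" "\<lambda>j. j - k * m"]) auto
    qed
    also have "\<dots> = (\<Prod>i<m. \<Prod>k<n. 1 - q ^ (k * m + i) * x)" by (rule prod.swap)
    finally show ?thesis
      by (simp add: qpoch_def power_add power_mult[symmetric] mult_ac)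
  qed
  then show "(\<lambda>n. qpoch x q (n * m)) \<longlonglongrightarrow> (\<Prod>i<m. qpoch_inf (q ^ i * x) (q ^ m))"
    by (simp, intro tendsto_prod qpoch_LIMSEQ qm)
qed

lemma qpoch_inf_plus_minus:
  assumes "norm q < 1"
  shows "qpoch_inf x q * qpoch_inf (- x) q = qpoch_inf (x\<^sup>2) (q\<^sup>2)"
proof (rule LIMSEQ_unique)
  show "(\<lambda>n. qpoch x q n * qpoch (- x) q n) \<longlonglongrightarrow> qpoch_inf x q * qpoch_inf (- x) q"
    by (intro tendsto_mult qpoch_LIMSEQ assms)
  have "qpoch x q n * qpoch (- x) q n = qpoch (x\<^sup>2) (q\<^sup>2) n" for n
    unfolding qpoch_def prod.distrib[symmetric]
    by (rule prod.cong) (simp_all add: algebra_simps power2_eq_square power_mult_distrib)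
  then show "(\<lambda>n. qpoch x q n * qpoch (- x) q n) \<longlonglongrightarrow> qpoch_inf (x\<^sup>2) (q\<^sup>2)"
    using assms by (simp add: qpoch_LIMSEQ norm_power power_less_one_iff)
qed

lemma q_powi_ne_1:
  fixes q :: complex
  assumes "norm q < 1" "q \<noteq> 0" "n \<noteq> 0"
  shows "q powi n \<noteq> 1"
proof
  assume q1: "q powi n = 1"
  obtain m where m: "n = int m \<or> n = - int m" by (meson int_cases2)
  then have "q ^ m = 1" using q1 by (auto simp: power_int_minus)
  then have "norm q ^ m = 1" by (metis norm_one norm_power)
  moreover have "m > 0" using m assms(3) by auto
  ultimately show False using assms(1) power_less_one_iff[of "norm q" m] by simp
qed

lemma qpoch_self_nonzero:
  fixes q :: complex
  assumes "norm q < 1"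
  shows "qpoch q q n \<noteq> 0" "qpoch_inf q q \<noteq> 0"
proof -
  have *: "q ^ i * q \<noteq> 1" for i
  proof
    assume "q ^ i * q = 1"
    then have "norm q ^ Suc i = 1" by (metis norm_one norm_power power_Suc2)
    then show False using assms power_less_one_iff[of "norm q" "Suc i"] by (simp del: power_Suc)
  qed
  then show "qpoch q q n \<noteq> 0" "qpoch_inf q q \<noteq> 0"
    using qpoch_inf_nonzero[OF assms *] by (auto simp: qpoch_def)
qed

text \<open>Extending \<open>1/(q;q)\<^sub>m\<close> by zero to negative \<open>m\<close> keeps its recurrence valid for all integers.\<close>

definition inv_qpoch :: "complex \<Rightarrow> int \<Rightarrow> complex" where
  "inv_qpoch q m = (if m < 0 then 0 else inverse (qpoch q q (nat m)))"

lemma inv_qpoch_rec: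
  assumes "norm q < 1" "q \<noteq> 0"
  shows "inv_qpoch q (m - 1) = (1 - q powi m) * inv_qpoch q m"
proof (cases "m > 0")
  case True
  then obtain n where m: "m = int (Suc n)" by (metis gr0_implies_Suc pos_int_cases)
  have "1 - q ^ Suc n \<noteq> 0"
    using q_powi_ne_1[OF assms, of "int (Suc n)"] unfolding power_int_of_nat by simp
  then show ?thesis using qpoch_self_nonzero(1)[OF assms(1), of n] unfolding m power_int_of_nat inv_qpoch_def
    by (simp add: qpoch_Suc nat_add_distrib field_simps del: power_Suc add: power_Suc[symmetric])
qed (auto simp: inv_qpoch_def)

lemma inv_qpoch_bounded:
  assumes "norm q < 1"
  obtains C where "C > 0" "\<And>m. norm (inv_qpoch q m) \<le> C"
proof -
  have "(\<lambda>n. inverse (qpoch q q n)) \<longlonglongrightarrow> inverse (qpoch_inf q q)"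
    by (intro tendsto_inverse qpoch_LIMSEQ assms qpoch_self_nonzero)
  then have "Bseq (\<lambda>n. inverse (qpoch q q n))"
    by (rule Bseq_conv_Bfun[THEN iffD1, OF convergent_imp_Bseq, OF convergentI] | rule convergent_imp_Bseq[OF convergentI])
  then obtain C where "C > 0" "\<And>n. norm (inverse (qpoch q q n)) \<le> C"
    by (auto elim: BseqE)
  then show ?thesis by (intro that[of C]) (auto simp: inv_qpoch_def)
qed

lemma inv_qpoch_tendsto:
  assumes "norm q < 1"
  shows "(\<lambda>n. inv_qpoch q (int n + k)) \<longlonglongrightarrow> inverse (qpoch_inf q q)"
proof -
  have "filterlim (\<lambda>n. nat (int n + k)) sequentially sequentially"
    unfolding filterlim_at_top
  proof
    fix Z
    show "\<forall>\<^sub>F n in sequentially. Z \<le> nat (int n + k)"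
      using eventually_ge_at_top[of "nat (int Z + \<bar>k\<bar>)"] by eventually_elim auto
  qed
  then have "(\<lambda>n. inverse (qpoch q q (nat (int n + k)))) \<longlonglongrightarrow> inverse (qpoch_inf q q)"
    by (intro tendsto_inverse filterlim_compose[OF qpoch_LIMSEQ] assms qpoch_self_nonzero)
  moreover have "\<forall>\<^sub>F n in sequentially. inv_qpoch q (int n + k) = inverse (qpoch q q (nat (int n + k)))"
    using eventually_ge_at_top[of "nat \<bar>k\<bar>"] by eventually_elim (auto simp: inv_qpoch_def)
  ultimately show ?thesis by (simp add: tendsto_cong)
qed

text \<open>Passing from n to n + 1 multiplies the right side by (1 - q^n z)(1 - q^(n+1)/z) and
  divides it by (1 - q^(2n+1))(1 - q^(2n+2)); \<open>key\<close> is the same recurrence read off at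
  z^k. The sum is finite, because \<open>inv_qpoch\<close> vanishes at negative arguments, but it is
  taken over all integers so that shifts of k produce no boundary terms.\<close>

lemma finite_triple_product:
  assumes q: "norm q < 1" "q \<noteq> 0" and z: "z \<noteq> 0"
  shows "((\<lambda>k. (-1) powi k * q powi tri k * inv_qpoch q (int n - k) * inv_qpoch q (int n + k) * z powi k)
           has_sum (qpoch z q n * qpoch (q / z) q n / qpoch q q (2 * n))) UNIV"
proof (induction n)
  case 0
  have "((\<lambda>k. (-1) powi k * q powi tri k * inv_qpoch q (int 0 - k) * inv_qpoch q (int 0 + k) * z powi k) has_sum 1) UNIV"
    by (rule has_sum_finite_neutralI[of "{0}"]) (auto simp: inv_qpoch_def)
  then show ?case by simp
next
  case (Suc n)
  define A where "A n k = (-1) powi k * q powi tri k * inv_qpoch q (int n - k) * inv_qpoch q (int n + k)" for n and k :: int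
  define s where "s = qpoch z q n * qpoch (q / z) q n / qpoch q q (2 * n)"
  have IH: "((\<lambda>k. A n k * z powi k) has_sum s) UNIV" using Suc unfolding A_def s_def .
  have up: "((\<lambda>k. A n (k - 1) * z powi k) has_sum s * z) UNIV"
  proof -
    have "((\<lambda>k. (A n k * z powi k) * z) has_sum s * z) UNIV"
      by (rule has_sum_cmult_left[OF IH])
    then show ?thesis
      by (rule has_sum_reindex_bij_witness[of _ "\<lambda>k. k - 1" "\<lambda>k. k + 1", THEN iffD1, rotated -1])
         (use z in \<open>auto simp: power_int_add\<close>)
  qed
  have down: "((\<lambda>k. A n (k + 1) * z powi k) has_sum s / z) UNIV"
  proof -
    have "((\<lambda>k. (A n k * z powi k) * (1 / z)) has_sum s * (1 / z)) UNIV"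
      by (rule has_sum_cmult_left[OF IH])
    then show ?thesis
      by (rule has_sum_reindex_bij_witness[of _ "\<lambda>k. k + 1" "\<lambda>k. k - 1", THEN iffD1, rotated -1])
         (use z in \<open>auto simp: power_int_diff\<close>)
  qed
  have key: "(1 - q ^ (2*n+1)) * (1 - q ^ (2*n+2)) * A (Suc n) k
      = (1 + q ^ (2*n+1)) * A n k - q ^ n * A n (k - 1) - q ^ (n+1) * A n (k + 1)" for k
  proof -
    \<comment> \<open>All other reciprocals are polynomial multiples of X or Y, which reduces
      \<open>key\<close> to a polynomial identity in u = q^(n-k) and v = q^(n+k).\<close>
    define X where "X = inv_qpoch q (int n + 1 - k)"
    define Y where "Y = inv_qpoch q (int n + 1 + k)"
    define u where "u = q powi (int n - k)"
    define v where "v = q powi (int n + k)"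
    have e: "int n + 1 - k - 1 = int n - k" "int n + 1 + k - 1 = int n + k" by simp_all
    have p: "q powi (int n + 1 - k) = q * u" "q powi (int n + 1 + k) = q * v"
      using q by (simp_all add: u_def v_def power_int_add power_int_diff)
    have r1: "inv_qpoch q (int n - k) = (1 - q * u) * X" "inv_qpoch q (int n + k) = (1 - q * v) * Y"
      using inv_qpoch_rec[OF q, of "int n + 1 - k"] inv_qpoch_rec[OF q, of "int n + 1 + k"]
      unfolding e p X_def Y_def .
    have r2: "inv_qpoch q (int n - k - 1) = (1 - u) * (1 - q * u) * X" "inv_qpoch q (int n + k - 1) = (1 - v) * (1 - q * v) * Y"
      using inv_qpoch_rec[OF q, of "int n - k"] inv_qpoch_rec[OF q, of "int n + k"]
      unfolding r1 u_def[symmetric] v_def[symmetric] by (simp_all only: mult.assoc)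
    note r = r1 r2
    have uv: "q ^ (2 * n) = u * v" "q ^ n * q powi (- k) = u" "q ^ n * q powi k = v"
      using q by (simp_all add: u_def v_def power_int_add power_int_diff power_int_minus field_simps power_mult power2_eq_square
          flip: power_mult_distrib)
    have t: "q powi tri (k - 1) = q powi tri k * q powi (- k) * q" "q powi tri (k + 1) = q powi tri k * q powi k"
      using q by (simp_all add: tri_diff tri_add power_int_add power_int_diff power_int_minus field_simps)
    have t': "q powi tri (1 + k) = q powi tri k * q powi k" "(-1::complex) powi (1 + k) = - ((-1) powi k)"
      using t(2) by (simp_all add: add.commute[of 1 k])
    have m: "(-1::complex) powi (k - 1) = - ((-1) powi k)" by (simp add: power_int_diff)
    define c where "c = (-1) powi k * q powi tri k * X * Y"
    have a1: "A (Suc n) k = c"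
      by (simp add: A_def c_def X_def Y_def add_ac algebra_simps)
    have a2: "A n k = c * (1 - q * u) * (1 - q * v)"
      by (simp add: A_def c_def r)
    have a3: "q ^ n * A n (k - 1) = - c * q * u * (1 - v) * (1 - q * v)"
    proof -
      have "q ^ n * A n (k - 1) = - ((-1) powi k * q powi tri k * q * (q ^ n * q powi (- k)) * inv_qpoch q (int n + 1 - k) * inv_qpoch q (int n + k - 1))"
        by (simp add: A_def t m algebra_simps)
      then show ?thesis unfolding r uv by (simp add: c_def X_def)
    qed
    have a4: "q ^ (n + 1) * A n (k + 1) = - c * q * v * (1 - u) * (1 - q * u)"
    proof -
      have "q ^ (n + 1) * A n (k + 1) = - ((-1) powi k * q powi tri k * q * (q ^ n * q powi k) * inv_qpoch q (int n - k - 1) * inv_qpoch q (int n + 1 + k))"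
        by (simp add: A_def t' algebra_simps)
      then show ?thesis unfolding r uv by (simp add: c_def Y_def)
    qed
    have b: "q ^ (2*n+1) = q * (u * v)" "q ^ (2*n+2) = q * q * (u * v)"
      unfolding power_add uv(1) by (simp_all add: power2_eq_square)
    show ?thesis unfolding a1 a2 a3 a4 b by (simp add: algebra_simps)
  qed
  define d where "d = (1 - q ^ (2*n+1)) * (1 - q ^ (2*n+2))"
  have q2: "qpoch q q (2 * Suc n) = qpoch q q (2 * n) * d"
    by (simp add: qpoch_Suc d_def mult_ac)
  have d0: "d \<noteq> 0" using q2 qpoch_self_nonzero[OF q(1)] by (metis mult_zero_right)
  have "((\<lambda>k. (1 + q ^ (2*n+1)) * (A n k * z powi k) - q ^ n * (A n (k - 1) * z powi k) - q ^ (n+1) * (A n (k + 1) * z powi k))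
      has_sum ((1 + q ^ (2*n+1)) * s - q ^ n * (s * z) - q ^ (n+1) * (s / z))) UNIV"
    by (intro has_sum_diff has_sum_cmult_right IH up down)
  moreover have "(1 + q ^ (2*n+1)) * (A n k * z powi k) - q ^ n * (A n (k - 1) * z powi k) - q ^ (n+1) * (A n (k + 1) * z powi k)
      = d * (A (Suc n) k * z powi k)" for k
    using key[of k] unfolding d_def by (metis (no_types, lifting) left_diff_distrib mult.assoc)
  moreover have "(1 + q ^ (2*n+1)) * s - q ^ n * (s * z) - q ^ (n+1) * (s / z) = s * (1 - q ^ n * z) * (1 - q ^ n * (q / z))"
    using z power_add[of q n n] by (simp add: field_simps mult_2_right)
  ultimately have "((\<lambda>k. d * (A (Suc n) k * z powi k)) has_sum (s * (1 - q ^ n * z) * (1 - q ^ n * (q / z)))) UNIV"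
    by simp
  then have "((\<lambda>k. inverse d * (d * (A (Suc n) k * z powi k))) has_sum (inverse d * (s * (1 - q ^ n * z) * (1 - q ^ n * (q / z))))) UNIV"
    by (rule has_sum_cmult_right)
  moreover have "inverse d * (s * (1 - q ^ n * z) * (1 - q ^ n * (q / z))) = qpoch z q (Suc n) * qpoch (q / z) q (Suc n) / qpoch q q (2 * Suc n)"
    unfolding q2 s_def by (simp add: qpoch_Suc divide_inverse mult_ac)
  ultimately show ?case using d0 unfolding A_def by (simp add: mult.assoc[symmetric])
qed

lemma norm_triple_term_le:
  fixes q z a b :: complex
  assumes "norm a \<le> C" "norm b \<le> C"
  shows "norm ((-1) powi k * q powi tri k * a * b * z powi k) \<le> C * C * (norm q powi tri k * norm z powi k)"
proof -
  have "C \<ge> 0" using assms(1) norm_ge_zero order_trans by blast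
  then have "norm a * norm b * (norm q powi tri k * norm z powi k) \<le> C * C * (norm q powi tri k * norm z powi k)"
    using assms by (intro mult_right_mono mult_mono mult_nonneg_nonneg zero_le_power_int) auto
  then show ?thesis by (simp add: norm_mult norm_power_int mult_ac)
qed

text \<open>The limit n -> infinity of the finite form: both reciprocals in a term tend to
  1/(q)_inf, the right side tends to j(z;q)/(q)_inf^2, and the uniform bound on the reciprocals
  supplies the domination.\<close>

theorem jacobi_triple_product:
  assumes q: "norm q < 1" "q \<noteq> 0" and z: "z \<noteq> 0"
  shows "((\<lambda>k. (-1) powi k * q powi tri k * z powi k) has_sum jtheta z q) UNIV"
proof -
  obtain C where C: "C > 0" "\<And>m. norm (inv_qpoch q m) \<le> C" using inv_qpoch_bounded[OF q(1)] by blast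
  define c where "c = inverse (qpoch_inf q q)"
  have c0: "c \<noteq> 0" using qpoch_self_nonzero[OF q(1)] by (simp add: c_def)
  define t where "t k = (-1) powi k * q powi tri k * z powi k" for k
  have tsum: "t summable_on UNIV"
    using summable_gauss[OF q z, of "\<lambda>k. (-1) powi k" 1] by (simp add: t_def[abs_def] mult.assoc)
  have rl: "(\<lambda>n. inv_qpoch q (int n + k)) \<longlonglongrightarrow> c" "(\<lambda>n. inv_qpoch q (int n - k)) \<longlonglongrightarrow> c" for k
    using inv_qpoch_tendsto[OF q(1), of k] inv_qpoch_tendsto[OF q(1), of "-k"] by (simp_all add: c_def)
  have "(\<lambda>n. \<Sum>\<^sub>\<infinity>k. (-1) powi k * q powi tri k * inv_qpoch q (int n - k) * inv_qpoch q (int n + k) * z powi k)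
      \<longlonglongrightarrow> (\<Sum>\<^sub>\<infinity>k. (-1) powi k * q powi tri k * c * c * z powi k)"
  proof (rule infsum_tendsto_dominated[where g = "\<lambda>k. C * C * (norm q powi tri k * norm z powi k)"])
    show "(\<lambda>k. C * C * (norm q powi tri k * norm z powi k)) summable_on UNIV"
      by (intro summable_on_cmult_right summable_gauss_real) (use q z in auto)
  qed (intro always_eventually allI ballI norm_triple_term_le C tendsto_intros rl | simp)+
  moreover have "(\<Sum>\<^sub>\<infinity>k. (-1) powi k * q powi tri k * c * c * z powi k) = infsum t UNIV * (c * c)"
    by (subst infsum_cmult_left'[symmetric]) (simp add: t_def mult_ac)
  moreover have "(\<Sum>\<^sub>\<infinity>k. (-1) powi k * q powi tri k * inv_qpoch q (int n - k) * inv_qpoch q (int n + k) * z powi k)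
      = qpoch z q n * qpoch (q / z) q n / qpoch q q (2 * n)" for n
    by (rule infsumI[OF finite_triple_product[OF q z]])
  ultimately have 1: "(\<lambda>n. qpoch z q n * qpoch (q / z) q n / qpoch q q (2 * n)) \<longlonglongrightarrow> infsum t UNIV * (c * c)"
    by simp
  have sm: "strict_mono (\<lambda>n::nat. 2 * n)" by (simp add: strict_mono_def)
  have "(\<lambda>n. qpoch q q (2 * n)) \<longlonglongrightarrow> qpoch_inf q q"
    using LIMSEQ_subseq_LIMSEQ[OF qpoch_LIMSEQ[OF q(1)] sm] by (simp add: o_def)
  then have "(\<lambda>n. qpoch z q n * qpoch (q / z) q n / qpoch q q (2 * n))
      \<longlonglongrightarrow> qpoch_inf z q * qpoch_inf (q / z) q / qpoch_inf q q"
    by (intro tendsto_intros qpoch_LIMSEQ qpoch_self_nonzero q)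
  from LIMSEQ_unique[OF 1 this] have "infsum t UNIV * (c * c) = qpoch_inf z q * qpoch_inf (q / z) q * c"
    by (simp add: c_def divide_inverse)
  then have "infsum t UNIV = jtheta z q"
    using c0 by (simp add: jtheta_def c_def field_simps)
  then show ?thesis using has_sum_infsum[OF tsum] by (simp add: t_def[abs_def])
qed

text \<open>The simple poles are z = q^(-k) with |k| at most n. In the induction step the product
  gains the factor D, and D times a new term is the old term plus a remainder free of the
  denominator 1 - z q^k. The remainders sum to 0, because the finite triple product vanishes at z =
  q and at z = 1.\<close>

lemma finite_partial_fractions:
  assumes q: "norm q < 1" "q \<noteq> 0" and z: "z \<noteq> 0" "\<And>k::int. z * q powi k \<noteq> 1"
  shows "((\<lambda>k. (-1) powi k * q powi tri k * inv_qpoch q (int n - k) * inv_qpoch q (int n + k) * q powi k / (1 - z * q powi k))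
           has_sum (1 / (qpoch z q (Suc n) * qpoch (q / z) q n))) UNIV"
proof (induction n)
  case 0
  have "((\<lambda>k. (-1) powi k * q powi tri k * inv_qpoch q (int 0 - k) * inv_qpoch q (int 0 + k) * q powi k / (1 - z * q powi k)) has_sum (1 / (1 - z))) UNIV"
    by (rule has_sum_finite_neutralI[of "{0}"]) (auto simp: inv_qpoch_def)
  then show ?case by (simp add: qpoch_Suc)
next
  case (Suc n)
  define c where "c n k = (-1) powi k * q powi tri k * inv_qpoch q (int n - k) * inv_qpoch q (int n + k) * q powi k" for n and k :: int
  define f where "f = 1 / (qpoch z q (Suc n) * qpoch (q / z) q n)"
  have IH: "((\<lambda>k. c n k / (1 - z * q powi k)) has_sum f) UNIV" using Suc unfolding c_def f_def .
  have 1: "(c (Suc n) has_sum 0) UNIV"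
    using finite_triple_product[OF q q(2), of "Suc n"] q
    by (simp add: c_def[abs_def] qpoch_Suc_left del: of_nat_Suc)
  have 2: "((\<lambda>k. c (Suc n) k * q powi (- k)) has_sum 0) UNIV"
    using finite_triple_product[OF q, of 1 "Suc n"] q
    by (simp add: c_def qpoch_Suc_left power_int_minus mult.assoc del: of_nat_Suc)
  define D where "D = (1 - q ^ (Suc n) * z) * (1 - q ^ n * (q / z))"
  have D0: "D \<noteq> 0"
  proof -
    have "q ^ Suc n * z \<noteq> 1" using z(2)[of "int (Suc n)"] unfolding power_int_of_nat by (simp add: mult.commute)
    moreover have "q ^ n * (q / z) \<noteq> 1"
    proof
      assume "q ^ n * (q / z) = 1"
      then have "z = q ^ Suc n" using z(1) by (simp add: field_simps)
      then have "z * q powi (- int (Suc n)) = 1" unfolding power_int_minus power_int_of_nat using q by (simp add: field_simps del: power_Suc)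
      then show False using z(2) by blast
    qed
    ultimately show ?thesis by (simp add: D_def)
  qed
  have key: "D * (c (Suc n) k / (1 - z * q powi k))
      = c n k / (1 - z * q powi k) + q ^ Suc n * (c (Suc n) k * q powi (- k) - c (Suc n) k / z)" for k
  proof -
    define w where "w = q powi k"
    define p where "p = q ^ Suc n"
    have w0: "w \<noteq> 0" and zw: "1 - z * w \<noteq> 0" using q z(2)[of k] by (auto simp: w_def)
    have e: "int (Suc n) - k - 1 = int n - k" "int (Suc n) + k - 1 = int n + k" by simp_all
    have pw: "q powi (int (Suc n) - k) = p / w" "q powi (int (Suc n) + k) = p * w"
      using q by (simp_all only: power_int_add power_int_diff power_int_of_nat p_def w_def simp_thms)
    have "inv_qpoch q (int n - k) = (1 - p / w) * inv_qpoch q (int (Suc n) - k)" "inv_qpoch q (int n + k) = (1 - p * w) * inv_qpoch q (int (Suc n) + k)"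
      using inv_qpoch_rec[OF q, of "int (Suc n) - k"] inv_qpoch_rec[OF q, of "int (Suc n) + k"] unfolding e pw .
    then have cn: "c n k = (1 - p / w) * (1 - p * w) * c (Suc n) k" by (simp add: c_def)
    have D: "D = (1 - p * z) * (1 - p / z)" by (simp add: D_def p_def)
    have "D / (1 - z * w) = (1 - p / w) * (1 - p * w) / (1 - z * w) + p * (1 / w - 1 / z)"
      unfolding D using w0 zw z(1) by (simp add: divide_simps) (simp add: algebra_simps)
    then have "c (Suc n) k * (D / (1 - z * w)) = c (Suc n) k * ((1 - p / w) * (1 - p * w) / (1 - z * w) + p * (1 / w - 1 / z))"
      by simp
    then show ?thesis unfolding cn w_def[symmetric] p_def[symmetric] power_int_minus
      by (simp add: algebra_simps divide_inverse)
  qed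
  have "((\<lambda>k. D * (c (Suc n) k / (1 - z * q powi k))) has_sum (f + q ^ Suc n * (0 - 0 / z))) UNIV"
    unfolding key by (intro has_sum_add has_sum_cmult_right has_sum_diff has_sum_divide_const IH 1 2)
  then have "((\<lambda>k. inverse D * (D * (c (Suc n) k / (1 - z * q powi k)))) has_sum (inverse D * (f + q ^ Suc n * (0 - 0 / z)))) UNIV"
    by (rule has_sum_cmult_right)
  moreover have "inverse D * (f + q ^ Suc n * (0 - 0 / z)) = 1 / (qpoch z q (Suc (Suc n)) * qpoch (q / z) q (Suc n))"
    by (simp add: f_def D_def qpoch_Suc divide_inverse mult_ac)
  moreover have "inverse D * (D * x) = x" for x using D0 by simp
  ultimately show ?case unfolding c_def by (simp only:)
qed

text \<open>The values tend to 1 as k -> infinity and to 0 as k -> -infinity. An index at which the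
  denominator vanishes contributes the value 0 of a division by zero.\<close>

lemma pole_bounded:
  fixes q z :: complex
  assumes q: "norm q < 1" "q \<noteq> 0" and z: "z \<noteq> 0"
  obtains C where "\<And>k::int. norm (1 / (1 - z * q powi k)) \<le> C"
proof -
  have q0: "(\<lambda>n. q ^ n) \<longlonglongrightarrow> 0" using q(1) by (rule LIMSEQ_power_zero)
  have "(\<lambda>n. 1 / (1 - z * q ^ n)) \<longlonglongrightarrow> 1 / (1 - z * 0)"
    by (intro tendsto_intros q0) auto
  then have "Bseq (\<lambda>n. 1 / (1 - z * q ^ n))" by (intro convergent_imp_Bseq convergentI)
  then obtain A where A: "\<And>n. norm (1 / (1 - z * q ^ n)) \<le> A" unfolding Bseq_def by blast
  have "(\<lambda>n. q ^ n / (q ^ n - z)) \<longlonglongrightarrow> 0 / (0 - z)"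
    by (intro tendsto_intros q0) (use z in auto)
  then have "Bseq (\<lambda>n. q ^ n / (q ^ n - z))" by (intro convergent_imp_Bseq convergentI)
  then obtain B where B: "\<And>n. norm (q ^ n / (q ^ n - z)) \<le> B" unfolding Bseq_def by blast
  have "norm (1 / (1 - z * q powi k)) \<le> max A B" for k
  proof (cases k rule: int_cases2)
    case (nonneg n)
    then show ?thesis using A[of n] by (simp add: power_int_of_nat)
  next
    case (nonpos n)
    have "1 / (1 - z * q powi k) = q ^ n / (q ^ n - z)"
      using q by (simp add: nonpos power_int_minus field_simps)
    then show ?thesis using B[of n] by simp
  qed
  then show ?thesis by (rule that)
qed

lemma jtheta_nonzero:
  assumes q: "norm q < 1" "q \<noteq> 0" and z: "z \<noteq> 0" "\<And>k::int. z * q powi k \<noteq> 1"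
  shows "jtheta z q \<noteq> 0"
proof -
  have "q ^ i * z \<noteq> 1" for i using z(2)[of "int i"] by (simp add: mult.commute)
  moreover have "q ^ i * (q / z) \<noteq> 1" for i
  proof
    assume "q ^ i * (q / z) = 1"
    then have "z = q ^ Suc i" using z(1) by (simp add: field_simps)
    then have "z * q powi (- int (Suc i)) = 1" unfolding power_int_minus power_int_of_nat using q by (simp add: field_simps del: power_Suc)
    then show False using z(2) by blast
  qed
  ultimately show ?thesis
    unfolding jtheta_def using qpoch_inf_nonzero[OF q(1)] qpoch_self_nonzero[OF q(1)] by simp
qed

text \<open>The limit n -> infinity of the finite expansion. From it come Kronecker's sum, the
  Laurent coefficients of the characters and the evaluation of one of the Appell moments.\<close>

theorem theta_partial_fractions:
  assumes q: "norm q < 1" "q \<noteq> 0" and z: "z \<noteq> 0" "\<And>k::int. z * q powi k \<noteq> 1"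
  shows "((\<lambda>k. (-1) powi k * q powi tri k * q powi k / (1 - z * q powi k)) has_sum (qpoch_inf q q ^ 3 / jtheta z q)) UNIV"
proof -
  obtain C where C: "C > 0" "\<And>m. norm (inv_qpoch q m) \<le> C" using inv_qpoch_bounded[OF q(1)] by blast
  obtain E where E: "\<And>k::int. norm (1 / (1 - z * q powi k)) \<le> E" using pole_bounded[OF q z(1)] by blast
  have E0: "E \<ge> 0" using E[of 0] norm_ge_zero order_trans by blast
  define c where "c = inverse (qpoch_inf q q)"
  have c0: "c \<noteq> 0" using qpoch_self_nonzero[OF q(1)] by (simp add: c_def)
  define t where "t k = (-1) powi k * q powi tri k * q powi k / (1 - z * q powi k)" for k
  have tsum: "t summable_on UNIV"
  proof -
    have "(\<lambda>k. ((-1) powi k * (1 / (1 - z * q powi k))) * (q powi tri k * q powi k)) summable_on UNIV"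
      by (rule summable_gauss[OF q q(2), where C = E]) (use E in \<open>simp only: norm_mult norm_m1_powi mult_1\<close>)
    then show ?thesis by (simp add: t_def[abs_def] mult_ac)
  qed
  have rl: "(\<lambda>n. inv_qpoch q (int n + k)) \<longlonglongrightarrow> c" "(\<lambda>n. inv_qpoch q (int n - k)) \<longlonglongrightarrow> c" for k
    using inv_qpoch_tendsto[OF q(1), of k] inv_qpoch_tendsto[OF q(1), of "-k"] by (simp_all add: c_def)
  have "(\<lambda>n. \<Sum>\<^sub>\<infinity>k. (-1) powi k * q powi tri k * inv_qpoch q (int n - k) * inv_qpoch q (int n + k) * q powi k / (1 - z * q powi k))
      \<longlonglongrightarrow> (\<Sum>\<^sub>\<infinity>k. (-1) powi k * q powi tri k * c * c * q powi k / (1 - z * q powi k))"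
  proof (rule infsum_tendsto_dominated[where g = "\<lambda>k. C * C * (norm q powi tri k * norm q powi k) * E"])
    show "(\<lambda>k. C * C * (norm q powi tri k * norm q powi k) * E) summable_on UNIV"
      by (intro summable_on_cmult_right summable_on_cmult_left summable_gauss_real) (use q z in auto)
    show "\<forall>\<^sub>F n in sequentially. \<forall>k\<in>UNIV. norm ((-1) powi k * q powi tri k * inv_qpoch q (int n - k) * inv_qpoch q (int n + k) * q powi k / (1 - z * q powi k))
        \<le> C * C * (norm q powi tri k * norm q powi k) * E"
    proof (intro always_eventually allI ballI)
      fix n and k :: int
      have "norm ((-1) powi k * q powi tri k * inv_qpoch q (int n - k) * inv_qpoch q (int n + k) * q powi k) * norm (1 / (1 - z * q powi k))
          \<le> C * C * (norm q powi tri k * norm q powi k) * E"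
        by (intro mult_mono norm_triple_term_le C E mult_nonneg_nonneg zero_le_power_int) (use C in auto)
      then show "norm ((-1) powi k * q powi tri k * inv_qpoch q (int n - k) * inv_qpoch q (int n + k) * q powi k / (1 - z * q powi k))
        \<le> C * C * (norm q powi tri k * norm q powi k) * E"
        by (simp only: norm_mult norm_divide norm_one times_divide_eq_right mult_1_right)
    qed
    show "(\<lambda>n. (-1) powi k * q powi tri k * inv_qpoch q (int n - k) * inv_qpoch q (int n + k) * q powi k / (1 - z * q powi k))
        \<longlonglongrightarrow> (-1) powi k * q powi tri k * c * c * q powi k / (1 - z * q powi k)" for k
      by (intro tendsto_intros rl) (use z(2)[of k] in auto)
  qed simp
  moreover have "(\<Sum>\<^sub>\<infinity>k. (-1) powi k * q powi tri k * c * c * q powi k / (1 - z * q powi k)) = infsum t UNIV * (c * c)"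
    by (subst infsum_cmult_left'[symmetric]) (simp add: t_def mult_ac)
  moreover have "(\<Sum>\<^sub>\<infinity>k. (-1) powi k * q powi tri k * inv_qpoch q (int n - k) * inv_qpoch q (int n + k) * q powi k / (1 - z * q powi k))
      = 1 / (qpoch z q (Suc n) * qpoch (q / z) q n)" for n
    by (rule infsumI[OF finite_partial_fractions[OF q z]])
  ultimately have 1: "(\<lambda>n. 1 / (qpoch z q (Suc n) * qpoch (q / z) q n)) \<longlonglongrightarrow> infsum t UNIV * (c * c)"
    by simp
  have j0: "qpoch_inf z q * qpoch_inf (q / z) q \<noteq> 0"
    using jtheta_nonzero[OF q z] by (simp add: jtheta_def)
  have "(\<lambda>n. qpoch z q (Suc n)) \<longlonglongrightarrow> qpoch_inf z q"
    using qpoch_LIMSEQ[OF q(1)] by (simp only: filterlim_sequentially_Suc)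
  then have "(\<lambda>n. 1 / (qpoch z q (Suc n) * qpoch (q / z) q n)) \<longlonglongrightarrow> 1 / (qpoch_inf z q * qpoch_inf (q / z) q)"
    by (intro tendsto_intros qpoch_LIMSEQ q) (use j0 in auto)
  from LIMSEQ_unique[OF 1 this] have "infsum t UNIV * (c * c) = 1 / (qpoch_inf z q * qpoch_inf (q / z) q)" .
  then have "infsum t UNIV = qpoch_inf q q ^ 3 / jtheta z q"
    using c0 j0 by (simp add: jtheta_def c_def field_simps power3_eq_cube)
  then show ?thesis using has_sum_infsum[OF tsum] by (simp add: t_def[abs_def])
qed

lemma jtheta_shift:
  assumes q: "norm q < 1" "q \<noteq> 0" and z: "z \<noteq> 0"
  shows "jtheta (z * q powi m) q = (-1) powi m * q powi (- tri m) * z powi (- m) * jtheta z q"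
proof (rule has_sum_unique)
  show "((\<lambda>k. (-1) powi k * q powi tri k * (z * q powi m) powi k) has_sum jtheta (z * q powi m) q) UNIV"
    by (rule jacobi_triple_product) (use q z in auto)
  have "((\<lambda>k. (-1) powi m * q powi (- tri m) * z powi (- m) * ((-1) powi k * q powi tri k * z powi k))
      has_sum ((-1) powi m * q powi (- tri m) * z powi (- m) * jtheta z q)) UNIV"
    by (intro has_sum_cmult_right jacobi_triple_product q z)
  then show "((\<lambda>k. (-1) powi k * q powi tri k * (z * q powi m) powi k) has_sum
      ((-1) powi m * q powi (- tri m) * z powi (- m) * jtheta z q)) UNIV"
  proof (rule has_sum_reindex_bij_witness[of _ "\<lambda>k. k + m" "\<lambda>k. k - m", THEN iffD1, rotated -1])
    fix k :: int
    have s1: "(-1::complex) powi m * (-1) powi k = (-1) powi (k - m)"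
      by (metis m1_powi_minus minus_diff_eq power_int_add_numeral power_int_add mult.commute neg_equal_0_iff_equal one_neq_zero diff_conv_add_uminus)
    have s2: "q powi (- tri m) * q powi tri k = q powi tri (k - m) * q powi (m * (k - m))"
    proof -
      have "- tri m + tri k = tri (k - m) + m * (k - m)"
        using two_tri[of m] by (simp add: tri_diff algebra_simps)
      then show ?thesis using q by (simp add: power_int_add[symmetric])
    qed
    have s3: "z powi (- m) * z powi k = z powi (k - m)"
      using z by (simp add: power_int_add[symmetric])
    have "(-1) powi m * q powi - tri m * z powi - m * ((-1) powi k * q powi tri k * z powi k)
        = ((-1) powi m * (-1) powi k) * (q powi (- tri m) * q powi tri k) * (z powi (- m) * z powi k)"
      by (simp only: mult_ac)
    also have "\<dots> = (-1) powi (k - m) * q powi tri (k - m) * (z * q powi m) powi (k - m)"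
      unfolding s1 s2 s3 by (simp add: power_int_mult_distrib power_int_mult mult_ac)
    finally show "(-1) powi (k - m) * q powi tri (k - m) * (z * q powi m) powi (k - m) =
        (-1) powi m * q powi - tri m * z powi - m * ((-1) powi k * q powi tri k * z powi k)" by simp
  qed auto
qed

lemma jtheta_reflect:
  assumes "q \<noteq> 0" "z \<noteq> 0"
  shows "jtheta (q / z) q = jtheta z q"
  using assms by (simp add: jtheta_def mult_ac)

lemma jtheta_inverse:
  assumes q: "norm q < 1" "q \<noteq> 0" and z: "z \<noteq> 0"
  shows "jtheta (1 / z) q = - jtheta z q / z"
  using jtheta_shift[OF q z, of 1] jtheta_reflect[of q "z * q"] assms
  by (simp add: power_int_minus field_simps)

lemma inverse_m1_powi [simp]: "inverse ((-1 :: complex) powi n) = (-1) powi n"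
  by (metis divide_m1_powi inverse_eq_divide mult_1)

section \<open>Kronecker's sum and Appell sums\<close>

lemma summable_on_two_sided:
  fixes f :: "int \<Rightarrow> complex"
  assumes a: "0 < a" "a < 1" and b: "b > 1"
    and A: "\<And>n. n \<ge> 0 \<Longrightarrow> norm (f n) \<le> A * a powi n"
    and B: "\<And>n. n < 0 \<Longrightarrow> norm (f n) \<le> B * b powi n"
  shows "f summable_on UNIV"
proof -
  have g: "(\<lambda>n. c * r ^ n) summable_on UNIV" if "0 < r" "r < 1" for c r :: real
  proof -
    have "(\<lambda>n. r ^ n) summable_on UNIV"
      using that by (subst summable_on_UNIV_nonneg_real_iff) (auto intro!: summable_geometric)
    then show ?thesis by (rule summable_on_cmult_right)
  qed
  have "(\<lambda>n. norm (f n)) summable_on UNIV"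
  proof (rule summable_on_int_halves)
    show "(\<lambda>n. norm (f (int n))) summable_on UNIV"
      by (rule summable_on_comparison_test[OF g[OF a, of A]]) (use A[of "int _"] in \<open>auto simp: power_int_of_nat\<close>)
    have "norm (f (- int n - 1)) \<le> (B / b) * (1 / b) ^ n" for n
      using B[of "- int n - 1"] b by (simp add: power_int_diff power_int_minus power_int_of_nat field_simps)
    then show "(\<lambda>n. norm (f (- int n - 1))) summable_on UNIV"
      by (intro summable_on_comparison_test[OF g[of "1/b" "B / b"]]) (use b in auto)
  qed
  then show ?thesis by (rule abs_summable_summable)
qed

lemma annulus_no_pole:
  fixes q x :: complex
  assumes "norm q < 1" "q \<noteq> 0" "norm q < norm x" "norm x < 1"
  shows "x * q powi k \<noteq> 1"
proof
  assume "x * q powi k = 1"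
  then have n: "norm x * norm q powi k = 1" by (metis norm_mult norm_one norm_power_int)
  consider "k \<ge> 0" | "k \<le> -1" by linarith
  then show False
  proof cases
    case 1
    then have "norm q powi k \<le> 1" using assms by (intro power_int_le_one) auto
    from mult_left_mono[OF this, of "norm x"] show ?thesis using n assms by simp
  next
    case 2
    then have "norm q powi k \<ge> norm q powi (-1)" using assms by (intro power_int_decreasing) auto
    then have "norm x * norm q powi k \<ge> norm x * norm q powi (-1)" by (intro mult_left_mono) auto
    moreover have "norm x * norm q powi (-1) > 1"
      using divide_strict_right_mono[OF assms(3), of "norm q"] assms(2)
      by (simp add: power_int_minus divide_inverse)
    ultimately show ?thesis using n by simp
  qed
qed

lemma kronecker_summable:
  fixes q x y :: complex
  assumes q: "norm q < 1" "q \<noteq> 0" and x: "norm q < norm x" "norm x < 1" and y: "y \<noteq> 0"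
  shows "(\<lambda>n. x powi n / (1 - y * q powi n)) summable_on UNIV"
proof -
  obtain C where C: "\<And>k::int. norm (1 / (1 - y * q powi k)) \<le> C" using pole_bounded[OF q y] by blast
  have "1 / y \<noteq> 0" using y by simp
  from pole_bounded[OF q this] obtain D where D: "\<And>k::int. norm (1 / (1 - 1 / y * q powi k)) \<le> D" by blast
  have x0: "x \<noteq> 0" using x q by auto
  show ?thesis
  proof (rule summable_on_two_sided)
    show "0 < norm x" "norm x < 1" using x x0 by auto
    show "norm x / norm q > 1" using x q by simp
    show "norm (x powi n / (1 - y * q powi n)) \<le> C * norm x powi n" for n
      using mult_left_mono[OF C[of n], of "norm x powi n"] by (simp add: norm_divide norm_power_int mult.commute)
    fix n :: int
    have q0: "q powi n \<noteq> 0" using q by simp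
    \<comment> \<open>For n < 0 the denominator behaves like y q^n, so the term is comparable with
      (x/q)^n; this is where |q| < |x| enters.\<close>
    have "1 - 1 / y * q powi (- n) = - (1 - y * q powi n) * (1 / (y * q powi n))"
      using y q0 by (simp add: power_int_minus field_simps)
    then have "1 / (1 - y * q powi n) = - (1 / (y * q powi n)) * (1 / (1 - 1 / y * q powi (- n)))"
      using y q0 by (cases "1 - y * q powi n = 0") (simp_all add: field_simps)
    moreover have "x powi n / (1 - y * q powi n) = x powi n * (1 / (1 - y * q powi n))" by simp
    ultimately have "x powi n / (1 - y * q powi n) = x powi n * (- (1 / (y * q powi n)) * (1 / (1 - 1 / y * q powi (- n))))"
      by (simp only:)
    then have "norm (x powi n / (1 - y * q powi n)) = norm (x powi n) * (norm (1 / (y * q powi n)) * norm (1 / (1 - 1 / y * q powi (- n))))"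
      by (simp only: norm_mult norm_minus_cancel)
    moreover have "norm (x powi n) * (norm (1 / (y * q powi n)) * t) = (norm x / norm q) powi n / norm y * t" for t
      by (simp add: norm_mult norm_divide norm_power_int power_int_divide_distrib)
    ultimately have "norm (x powi n / (1 - y * q powi n)) = (norm x / norm q) powi n / norm y * norm (1 / (1 - 1 / y * q powi (- n)))"
      by (simp only:)
    also have "\<dots> \<le> (norm x / norm q) powi n / norm y * D"
      by (intro mult_left_mono D) auto
    finally show "norm (x powi n / (1 - y * q powi n)) \<le> (D / norm y) * (norm x / norm q) powi n"
      by (simp add: mult_ac)
  qed
qed

text \<open>The sum is multiplied by the theta series of j(x;q). At fixed total degree s the inner
  sum is the partial fraction expansion of 1/j at y q^s, and quasi-periodicity turns it into the
  s-th term of the theta series of j(xy;q) times a constant. Division by j(x;q) is possible because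
  that function has no zero in the annulus.\<close>

theorem kronecker_theta:
  fixes q x y :: complex
  assumes q: "norm q < 1" "q \<noteq> 0" and x: "norm q < norm x" "norm x < 1"
    and y: "y \<noteq> 0" "\<And>k::int. y * q powi k \<noteq> 1"
  shows "((\<lambda>n. x powi n / (1 - y * q powi n)) has_sum
      (qpoch_inf q q ^ 3 * jtheta (x * y) q / (jtheta x q * jtheta y q))) UNIV"
proof -
  have x0: "x \<noteq> 0" using x q by auto
  define t where "t k = (-1) powi k * q powi tri k * x powi k" for k
  define u where "u n = x powi n / (1 - y * q powi n)" for n
  have t: "(t has_sum jtheta x q) UNIV"
    unfolding t_def[abs_def] by (rule jacobi_triple_product[OF q x0])
  have u: "(u has_sum infsum u UNIV) UNIV"
    unfolding u_def[abs_def] by (rule has_sum_infsum, rule kronecker_summable[OF q x y(1)])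
  define c where "c = qpoch_inf q q ^ 3 / jtheta y q"
  have "((\<lambda>s. \<Sum>\<^sub>\<infinity>m. t m * u (s - m)) has_sum (jtheta x q * infsum u UNIV)) UNIV"
    by (rule has_sum_convolution[OF t u])
  moreover have "(\<Sum>\<^sub>\<infinity>m. t m * u (s - m)) = (-1) powi s * q powi tri s * (x * y) powi s * c" for s
  proof -
    have z: "y * q powi s \<noteq> 0" "\<And>k::int. (y * q powi s) * q powi k \<noteq> 1"
      using y q by (auto simp: mult.assoc simp flip: power_int_add)
    have J: "jtheta (y * q powi s) q = (-1) powi s * q powi (- tri s) * y powi (- s) * jtheta y q"
      by (rule jtheta_shift[OF q y(1)])
    have "qpoch_inf q q ^ 3 / jtheta (y * q powi s) q = (-1) powi s * q powi tri s * y powi s * c"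
      unfolding J c_def using q y(1) by (simp add: power_int_minus divide_inverse mult_ac)
    then have "((\<lambda>k. x powi s * ((-1) powi k * q powi tri k * q powi k / (1 - y * q powi s * q powi k))) has_sum
        (x powi s * ((-1) powi s * q powi tri s * y powi s * c))) UNIV"
      using theta_partial_fractions[OF q z] by (intro has_sum_cmult_right) auto
    then have "((\<lambda>m. t m * u (s - m)) has_sum (x powi s * ((-1) powi s * q powi tri s * y powi s * c))) UNIV"
    proof (rule has_sum_reindex_bij_witness[of _ uminus uminus, THEN iffD1, rotated -1])
      fix k :: int
      have "x powi (- k) * x powi (s - - k) = x powi s" "q powi tri (- k) = q powi tri k * q powi k" "q powi (s - - k) = q powi s * q powi k"
        using x0 q by (simp_all add: power_int_add[symmetric] tri_minus)
      then show "t (- k) * u (s - - k) = x powi s * ((- 1) powi k * q powi tri k * q powi k / (1 - y * q powi s * q powi k))"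
        unfolding t_def u_def by (simp add: mult_ac)
    qed auto
    from infsumI[OF this] show ?thesis by (simp add: power_int_mult_distrib mult_ac)
  qed
  ultimately have "((\<lambda>s. (-1) powi s * q powi tri s * (x * y) powi s * c) has_sum (jtheta x q * infsum u UNIV)) UNIV"
    by simp
  moreover have "((\<lambda>s. (-1) powi s * q powi tri s * (x * y) powi s * c) has_sum (jtheta (x * y) q * c)) UNIV"
    by (intro has_sum_cmult_left jacobi_triple_product q) (use x0 y in auto)
  ultimately have "jtheta x q * infsum u UNIV = jtheta (x * y) q * c"
    by (rule has_sum_unique)
  moreover have "jtheta x q \<noteq> 0"
    by (intro jtheta_nonzero q x0 annulus_no_pole x)
  ultimately have "infsum u UNIV = jtheta (x * y) q * c / jtheta x q"
    by (simp add: nonzero_eq_divide_eq mult.commute)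
  then have "infsum u UNIV = qpoch_inf q q ^ 3 * jtheta (x * y) q / (jtheta x q * jtheta y q)"
    by (simp add: c_def mult_ac)
  then show ?thesis using u unfolding u_def[abs_def] by simp
qed

text \<open>An Appell-Lerch sum without its usual theta normalisation: x sits in the numerator and z
  locates the poles. The factor q next to x makes x = 1 the partial fraction series of
  1/j(z;q).\<close>

definition appell :: "complex \<Rightarrow> complex \<Rightarrow> complex \<Rightarrow> complex" where
  "appell q x z = (\<Sum>\<^sub>\<infinity>k. (-1) powi k * q powi tri k * (q * x) powi k / (1 - z * q powi k))"

lemma appell_has_sum:
  assumes q: "norm q < 1" "q \<noteq> 0" and "x \<noteq> 0" "z \<noteq> 0"
  shows "((\<lambda>k. (-1) powi k * q powi tri k * (q * x) powi k / (1 - z * q powi k)) has_sum appell q x z) UNIV"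
  unfolding appell_def
proof (rule has_sum_infsum)
  obtain E where E: "\<And>k::int. norm (1 / (1 - z * q powi k)) \<le> E" using pole_bounded[OF q assms(4)] by blast
  have "(\<lambda>k. ((-1) powi k * (1 / (1 - z * q powi k))) * (q powi tri k * (q * x) powi k)) summable_on UNIV"
    by (rule summable_gauss[OF q, where C = E]) (use E assms in \<open>simp_all only: norm_mult norm_m1_powi mult_1 mult_eq_0_iff simp_thms\<close>)
  then show "(\<lambda>k. (-1) powi k * q powi tri k * (q * x) powi k / (1 - z * q powi k)) summable_on UNIV"
    by (simp add: mult_ac)
qed

text \<open>Two double series are subtracted term by term: Kronecker's sum at b z times the
  expansion of 1/j(z;q), and Kronecker's sum at b times the Appell sum at z. Summing the difference
  first over k yields the Appell sum at (x b, b z), while the first product is already the theta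
  quotient on the right.\<close>

theorem appell_change:
  assumes q: "norm q < 1" "q \<noteq> 0" and x: "norm q < norm x" "norm x < 1"
    and b: "b \<noteq> 0" "\<And>k::int. b * q powi k \<noteq> 1"
    and z: "z \<noteq> 0" "\<And>k::int. z * q powi k \<noteq> 1" and bz: "\<And>k::int. b * z * q powi k \<noteq> 1"
  shows "jtheta (x * b) q * appell q x z - b * jtheta x q * appell q (x * b) (b * z)
      = qpoch_inf q q ^ 3 * jtheta b q * jtheta (x * b * z) q / (jtheta z q * jtheta (b * z) q)"
proof -
  have x0: "x \<noteq> 0" using x q by auto
  define P where "P = qpoch_inf q q ^ 3"
  have P0: "P \<noteq> 0" using qpoch_self_nonzero[OF q(1)] by (simp add: P_def)
  define c where "c k = (-1) powi k * q powi tri k * q powi k" for k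
  define K1 where "K1 = P * jtheta (x * (b * z)) q / (jtheta x q * jtheta (b * z) q)"
  define K2 where "K2 = P * jtheta (x * b) q / (jtheta x q * jtheta b q)"
  have bz0: "b * z \<noteq> 0" using b z by simp
  have h1: "((\<lambda>n. x powi n / (1 - b * z * q powi n)) has_sum K1) UNIV"
    unfolding K1_def P_def by (rule kronecker_theta[OF q x bz0 bz])
  have h2: "((\<lambda>n. x powi n / (1 - b * q powi n)) has_sum K2) UNIV"
    unfolding K2_def P_def by (rule kronecker_theta[OF q x b])
  have h3: "((\<lambda>k. c k / (1 - z * q powi k)) has_sum P / jtheta z q) UNIV"
    unfolding c_def P_def by (rule theta_partial_fractions[OF q z])
  have h4: "((\<lambda>k. c k * x powi k / (1 - z * q powi k)) has_sum appell q x z) UNIV"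
    using appell_has_sum[OF q x0 z(1)] by (simp add: c_def power_int_mult_distrib mult.assoc)
  have H1: "((\<lambda>(n, k). x powi n / (1 - b * z * q powi n) * (c k / (1 - z * q powi k))) has_sum K1 * (P / jtheta z q)) (UNIV \<times> UNIV)"
    by (rule has_sum_product_complex[OF h1 h3])
  have H2: "((\<lambda>(n, k). c k * x powi n / ((1 - z * q powi k) * (1 - b * q powi (n - k)))) has_sum K2 * appell q x z) (UNIV \<times> UNIV)"
    by (rule has_sum_reindex_bij_witness[of _ "\<lambda>(n,k). (n - k, k)" "\<lambda>(l,k). (l + k, k)", THEN iffD1,
        OF _ _ _ _ _ _ has_sum_product_complex[OF h2 h4]])
       (use x0 in \<open>auto simp: power_int_add mult_ac\<close>)
  \<comment> \<open>With u = z q^k and w = b q^(n-k) this is 1/((1-uw)(1-u)) - 1/((1-u)(1-w)) =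
    1/((1-uw)(1-1/w)). As u w does not depend on k, the sum over k is a partial fraction expansion
    at q^(-n)/b.\<close>
  have pf: "x powi n / (1 - b * z * q powi n) * (c k / (1 - z * q powi k)) - c k * x powi n / ((1 - z * q powi k) * (1 - b * q powi (n - k)))
     = x powi n / (1 - b * z * q powi n) * (c k / (1 - (1 / b * q powi (- n)) * q powi k))" for n k
  proof -
    define u where "u = z * q powi k"
    define w where "w = b * q powi (n - k)"
    have uw: "b * z * q powi n = u * w" using q by (simp add: u_def w_def power_int_diff)
    have iw: "1 / b * q powi (- n) * q powi k = 1 / w" using q b by (simp add: w_def power_int_diff power_int_minus field_simps)
    have "1 - u * w \<noteq> 0" using bz[of n] unfolding uw by simp
    moreover have "1 - u \<noteq> 0" "1 - w \<noteq> 0" "w \<noteq> 0"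
      using z(2)[of k] b(2)[of "n - k"] b(1) q by (simp_all add: u_def w_def)
    ultimately have nz: "1 - u \<noteq> 0" "1 - w \<noteq> 0" "1 - u * w \<noteq> 0" "w \<noteq> 0" "1 - 1 / w \<noteq> 0"
      by (simp_all add: field_simps)
    have "1 / (1 - u * w) * (1 / (1 - u)) - 1 / ((1 - u) * (1 - w)) = 1 / (1 - u * w) * (1 / (1 - 1 / w))"
      using nz by (simp add: divide_simps) (simp add: algebra_simps)
    then have "x powi n * c k * (1 / (1 - u * w) * (1 / (1 - u)) - 1 / ((1 - u) * (1 - w))) = x powi n * c k * (1 / (1 - u * w) * (1 / (1 - 1 / w)))"
      by simp
    then show ?thesis unfolding iw uw u_def[symmetric] w_def[symmetric] by (simp add: right_diff_distrib mult_ac)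
  qed
  have H3: "((\<lambda>(n, k). x powi n / (1 - b * z * q powi n) * (c k / (1 - (1 / b * q powi (- n)) * q powi k)))
      has_sum (K1 * (P / jtheta z q) - K2 * appell q x z)) (UNIV \<times> UNIV)"
    by (rule has_sum_cong[THEN iffD1, OF _ has_sum_diff[OF H1 H2]]) (clarsimp simp only: split_paired_all prod.case pf)
  have ib: "1 / b * q powi k \<noteq> 1" for k
  proof
    assume "1 / b * q powi k = 1"
    then have "b * q powi (- k) = 1" using b(1) q by (simp add: power_int_minus field_simps)
    then show False using b(2) by blast
  qed
  have jb: "jtheta (1 / b * q powi (- n)) q = (-1) powi n * q powi (- tri (- n)) * b powi (- n) * jtheta (1 / b) q" for n
    using jtheta_shift[OF q, of "1/b" "- n"] b(1)
    by (simp add: power_int_minus power_int_inverse divide_inverse mult_ac)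
  have "((\<lambda>n. x powi n / (1 - b * z * q powi n) * (P / jtheta (1 / b * q powi (- n)) q)) has_sum
      (K1 * (P / jtheta z q) - K2 * appell q x z)) UNIV"
  proof (rule has_sum_SigmaD[OF H3])
    fix n :: int
    have "((\<lambda>k. c k / (1 - (1 / b * q powi (- n)) * q powi k)) has_sum P / jtheta (1 / b * q powi (- n)) q) UNIV"
      unfolding c_def P_def
    proof (rule theta_partial_fractions[OF q])
      show "1 / b * q powi - n * q powi k \<noteq> 1" for k
        using ib[of "k - n"] q by (simp add: power_int_diff power_int_minus field_simps)
    qed (use b q in auto)
    then show "((\<lambda>k. case (n, k) of (n, k) \<Rightarrow> x powi n / (1 - b * z * q powi n) * (c k / (1 - (1 / b * q powi (- n)) * q powi k)))
        has_sum x powi n / (1 - b * z * q powi n) * (P / jtheta (1 / b * q powi (- n)) q)) UNIV"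
      unfolding prod.case by (rule has_sum_cmult_right)
  qed
  moreover have "x powi n / (1 - b * z * q powi n) * (P / jtheta (1 / b * q powi (- n)) q)
      = P / jtheta (1 / b) q * ((-1) powi n * q powi tri n * (q * (x * b)) powi n / (1 - b * z * q powi n))" for n
  proof -
    have "P / jtheta (1 / b * q powi (- n)) q = P / jtheta (1 / b) q * ((-1) powi n * (q powi tri n * q powi n) * b powi n)"
      unfolding jb unfolding power_int_minus tri_minus using q by (simp add: power_int_add divide_inverse mult_ac)
    then show ?thesis by (simp add: power_int_mult_distrib mult_ac)
  qed
  ultimately have "((\<lambda>n. P / jtheta (1 / b) q * ((-1) powi n * q powi tri n * (q * (x * b)) powi n / (1 - b * z * q powi n)))
     has_sum (K1 * (P / jtheta z q) - K2 * appell q x z)) UNIV" by simp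
  moreover have "((\<lambda>n. P / jtheta (1 / b) q * ((-1) powi n * q powi tri n * (q * (x * b)) powi n / (1 - b * z * q powi n)))
     has_sum (P / jtheta (1 / b) q * appell q (x * b) (b * z))) UNIV"
    by (intro has_sum_cmult_right appell_has_sum q) (use x0 b z in auto)
  ultimately have eq: "K1 * (P / jtheta z q) - K2 * appell q x z = P / jtheta (1 / b) q * appell q (x * b) (b * z)"
    by (rule has_sum_unique)
  have jx: "jtheta x q \<noteq> 0" by (intro jtheta_nonzero q x0 annulus_no_pole x)
  have jb0: "jtheta b q \<noteq> 0" by (intro jtheta_nonzero q b)
  have ib_eq: "jtheta (1 / b) q = - jtheta b q / b" by (rule jtheta_inverse[OF q b(1)])
  \<comment> \<open>The common factor that clears the theta functions in \<open>K1\<close>, in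
    \<open>K2\<close> and in j(1/b;q) = -j(b;q)/b.\<close>
  define c0 where "c0 = jtheta x q * jtheta b q / P"
  have e1: "c0 * (K1 * (P / jtheta z q)) = P * jtheta b q * jtheta (x * b * z) q / (jtheta z q * jtheta (b * z) q)"
    unfolding c0_def K1_def using P0 jx by (simp add: mult_ac)
  have e2: "c0 * (K2 * appell q x z) = jtheta (x * b) q * appell q x z"
    unfolding c0_def K2_def using P0 jx jb0 by (simp add: mult_ac)
  have e3: "c0 * (P / jtheta (1 / b) q * appell q (x * b) (b * z)) = - (b * jtheta x q * appell q (x * b) (b * z))"
    unfolding c0_def ib_eq using P0 jb0 b(1) by (simp add: mult_ac)
  have e4: "c0 * (K1 * (P / jtheta z q)) - c0 * (K2 * appell q x z) = c0 * (P / jtheta (1 / b) q * appell q (x * b) (b * z))"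
    unfolding eq[symmetric] by (simp only: right_diff_distrib)
  show ?thesis using e4 unfolding e1 e2 e3 P_def[symmetric] by (simp add: algebra_simps)
qed

lemma power3_powi: "(q ^ 3) powi k = q powi (3 * k)" for q :: complex
  by (metis of_nat_numeral power_int_mult power_int_of_nat)

lemma power2_powi: "(q\<^sup>2) powi k = q powi (2 * k)" for q :: complex
  by (metis of_nat_numeral power_int_mult power_int_of_nat)

lemma two_tri_powi:
  assumes "q \<noteq> 0"
  shows "(q\<^sup>2 :: complex) powi tri m * q powi m = q powi (m * m)"
  using assms two_tri[of m] by (simp add: power2_powi power_int_add[symmetric] algebra_simps)

section \<open>Durfee squares and ranks\<close>

text \<open>The generating function of partitions whose Durfee rectangle has sides m and m +
  K.\<close>

definition durfee_term :: "complex \<Rightarrow> int \<Rightarrow> int \<Rightarrow> complex" where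
  "durfee_term q K m = q powi (m * m + m * K) * inv_qpoch q m * inv_qpoch q (m + K)"

lemma durfee_summable:
  assumes q: "norm q < 1" "q \<noteq> 0"
  shows "durfee_term q K summable_on UNIV"
proof -
  obtain C where C: "C > 0" "\<And>m. norm (inv_qpoch q m) \<le> C" using inv_qpoch_bounded[OF q(1)] by blast
  have q2: "norm (q\<^sup>2) < 1" "q\<^sup>2 \<noteq> 0" using q by (auto simp: norm_power power_less_one_iff)
  have "(\<lambda>m. (inv_qpoch q m * inv_qpoch q (m + K)) * ((q\<^sup>2) powi tri m * (q powi (1 + K)) powi m)) summable_on UNIV"
    by (rule summable_gauss[OF q2, where C = "C * C"]) (use q C in \<open>auto simp: norm_mult intro!: mult_mono\<close>)
  moreover have "(q\<^sup>2) powi tri m * (q powi (1 + K)) powi m = q powi (m * m + m * K)" for m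
  proof -
    have "(q powi (1 + K)) powi m = q powi m * q powi (m * K)"
      using q by (simp add: power_int_mult[symmetric] power_int_add[symmetric] algebra_simps)
    then show ?thesis using q two_tri_powi[OF q(2), of m] by (simp add: power_int_add mult.assoc[symmetric])
  qed
  ultimately show ?thesis by (simp add: durfee_term_def[abs_def] mult_ac)
qed

text \<open>Reducing all reciprocals to 1/(q)_m and 1/(q)_(m+K+1) leaves a polynomial identity in
  q^m and q^(K+1). After summation over all integers m the shift in the last term disappears, so the
  sums satisfy a recurrence in K alone.\<close>

lemma durfee_term_rec:
  assumes q: "norm q < 1" "q \<noteq> 0"
  shows "durfee_term q K m = (1 - q powi (K + 1)) * durfee_term q (K + 1) m + q powi (K + 1) * durfee_term q (K + 2) (m - 1)"
proof -
  define X where "X = inv_qpoch q m"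
  define Y where "Y = inv_qpoch q (m + K + 1)"
  define u where "u = q powi m"
  define v where "v = q powi (K + 1)"
  define p where "p = q powi (m * m + m * K)"
  have r: "inv_qpoch q (m + K) = (1 - u * v) * Y" "inv_qpoch q (m - 1) = (1 - u) * X"
    using inv_qpoch_rec[OF q, of "m + K + 1"] inv_qpoch_rec[OF q, of m] q
    by (simp_all add: X_def Y_def u_def v_def power_int_add mult_ac)
  have e: "m + (K + 1) = m + K + 1" "m - 1 + (K + 2) = m + K + 1" by simp_all
  have p1: "q powi (m * m + m * (K + 1)) = p * u"
    using q by (simp add: p_def u_def power_int_add[symmetric] algebra_simps)
  have "v * q powi ((m - 1) * (m - 1) + (m - 1) * (K + 2)) = p"
    using q by (simp add: p_def v_def power_int_add[symmetric] algebra_simps)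
  then have "v * durfee_term q (K + 2) (m - 1) = p * ((1 - u) * X) * Y"
    unfolding durfee_term_def e r Y_def[symmetric] by (simp add: mult_ac)
  then show ?thesis
    unfolding durfee_term_def e r p1 v_def[symmetric] p_def[symmetric] X_def[symmetric] Y_def[symmetric]
    by (simp add: algebra_simps)
qed

lemma durfee_rec:
  assumes q: "norm q < 1" "q \<noteq> 0"
  shows "infsum (durfee_term q K) UNIV - infsum (durfee_term q (K + 1)) UNIV
    = - (q powi (K + 1)) * (infsum (durfee_term q (K + 1)) UNIV - infsum (durfee_term q (K + 2)) UNIV)"
proof -
  have h: "(durfee_term q K has_sum infsum (durfee_term q K) UNIV) UNIV" for K
    by (rule has_sum_infsum[OF durfee_summable[OF q]])
  have "((\<lambda>m. durfee_term q (K + 2) (m - 1)) has_sum infsum (durfee_term q (K + 2)) UNIV) UNIV"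
    by (rule has_sum_reindex_bij_witness[of _ "\<lambda>m. m - 1" "\<lambda>m. m + 1", THEN iffD1, OF _ _ _ _ _ _ h]) auto
  then have "(durfee_term q K has_sum ((1 - q powi (K + 1)) * infsum (durfee_term q (K + 1)) UNIV + q powi (K + 1) * infsum (durfee_term q (K + 2)) UNIV)) UNIV"
    unfolding durfee_term_rec[OF q, of K, abs_def] by (intro has_sum_add has_sum_cmult_right h)
  from infsumI[OF this] show ?thesis by (simp add: algebra_simps)
qed

lemma durfee_tendsto:
  assumes q: "norm q < 1" "q \<noteq> 0"
  shows "(\<lambda>K. infsum (durfee_term q (int K)) UNIV) \<longlonglongrightarrow> inverse (qpoch_inf q q)"
proof -
  obtain C where C: "C > 0" "\<And>m. norm (inv_qpoch q m) \<le> C" using inv_qpoch_bounded[OF q(1)] by blast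
  define h where "h m = (if m = 0 then inverse (qpoch_inf q q) else 0)" for m :: int
  have "(\<lambda>K. infsum (durfee_term q (int K)) UNIV) \<longlonglongrightarrow> infsum h UNIV"
  proof (rule infsum_tendsto_dominated[where g = "\<lambda>m. C * C * ((norm q)\<^sup>2 powi tri m * norm q powi m)"])
    show "(\<lambda>m. C * C * ((norm q)\<^sup>2 powi tri m * norm q powi m)) summable_on UNIV"
      by (intro summable_on_cmult_right summable_gauss_real) (use q in \<open>auto simp: power_less_one_iff\<close>)
    show "\<forall>\<^sub>F K in sequentially. \<forall>m\<in>UNIV. norm (durfee_term q (int K) m) \<le> C * C * ((norm q)\<^sup>2 powi tri m * norm q powi m)"
    proof (intro always_eventually allI ballI)
      fix K :: nat and m :: int
      show "norm (durfee_term q (int K) m) \<le> C * C * ((norm q)\<^sup>2 powi tri m * norm q powi m)"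
      proof (cases "m < 0")
        case True
        then show ?thesis using C q by (simp add: durfee_term_def inv_qpoch_def)
      next
        case False
        have e: "norm (q powi (m * m)) = (norm q)\<^sup>2 powi tri m * norm q powi m"
          unfolding two_tri_powi[OF q(2), symmetric] by (simp add: norm_mult norm_power_int norm_power)
        have "norm (q powi (m * int K)) \<le> 1"
          using q False by (simp add: norm_power_int power_int_le_one)
        then have "norm (inv_qpoch q m) * norm (inv_qpoch q (m + int K)) * (norm (q powi (m * m)) * norm (q powi (m * int K)))
            \<le> C * C * (norm (q powi (m * m)) * 1)"
          using C by (intro mult_mono mult_nonneg_nonneg norm_ge_zero order_refl) auto
        moreover have "norm (durfee_term q (int K) m) = norm (inv_qpoch q m) * norm (inv_qpoch q (m + int K)) * (norm (q powi (m * m)) * norm (q powi (m * int K)))"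
          using q by (simp add: durfee_term_def power_int_add norm_mult mult_ac)
        ultimately show ?thesis unfolding e by simp
      qed
    qed
    fix m :: int
    have r: "(\<lambda>K. inv_qpoch q (m + int K)) \<longlonglongrightarrow> inverse (qpoch_inf q q)"
      using inv_qpoch_tendsto[OF q(1), of m] by (simp add: add.commute)
    consider "m < 0" | "m = 0" | "m > 0" by linarith
    then show "(\<lambda>K. durfee_term q (int K) m) \<longlonglongrightarrow> h m"
    proof cases
      case 1
      then show ?thesis by (simp add: durfee_term_def inv_qpoch_def h_def)
    next
      case 2
      then show ?thesis using r by (simp add: durfee_term_def inv_qpoch_def h_def)
    next
      case 3
      obtain n where n: "m = int n" "n > 0" using 3 by (metis zero_less_imp_eq_int)
      have "norm q ^ n < 1" using q n by (subst power_less_one_iff) auto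
      then have "norm (q powi m) < 1" unfolding n by (simp add: power_int_of_nat norm_power)
      then have l: "(\<lambda>K. (q powi m) ^ K) \<longlonglongrightarrow> 0" by (rule LIMSEQ_power_zero)
      have "(\<lambda>K. q powi (m * m) * (q powi m) ^ K * inv_qpoch q m * inv_qpoch q (m + int K))
          \<longlonglongrightarrow> q powi (m * m) * 0 * inv_qpoch q m * inverse (qpoch_inf q q)"
        by (intro tendsto_mult tendsto_const r l)
      moreover have "q powi (m * int K) = (q powi m) ^ K" for K
        by (simp add: power_int_mult power_int_of_nat)
      ultimately show ?thesis using 3 q by (simp add: durfee_term_def h_def power_int_add)
    qed
  qed simp
  moreover have "infsum h UNIV = inverse (qpoch_inf q q)"
    by (rule infsumI, rule has_sum_finite_neutralI[of "{0}"]) (auto simp: h_def)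
  ultimately show ?thesis by simp
qed

text \<open>By the recurrence, the difference of consecutive sums has absolute value |q|^(n+1) times
  that of the next difference. These absolute values therefore increase, yet they tend to 0, so all
  differences vanish and the sums equal their limit.\<close>

theorem durfee_identity:
  assumes q: "norm q < 1" "q \<noteq> 0"
  shows "infsum (durfee_term q (int K)) UNIV = inverse (qpoch_inf q q)"
proof -
  define D where "D n = infsum (durfee_term q (int n)) UNIV" for n
  define d where "d n = norm (D n - D (Suc n))" for n
  have lim: "D \<longlonglongrightarrow> inverse (qpoch_inf q q)" unfolding D_def[abs_def] by (rule durfee_tendsto[OF q])
  have "(\<lambda>n. D n - D (Suc n)) \<longlonglongrightarrow> inverse (qpoch_inf q q) - inverse (qpoch_inf q q)"
    by (intro tendsto_diff lim LIMSEQ_Suc)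
  then have d0: "d \<longlonglongrightarrow> 0" unfolding d_def[abs_def] using tendsto_norm by fastforce
  have "d n \<le> d (Suc n)" for n
  proof -
    have "D n - D (Suc n) = - (q ^ (Suc n)) * (D (Suc n) - D (Suc (Suc n)))"
      using durfee_rec[OF q, of "int n"] power_int_of_nat[of q "Suc n"] by (simp add: D_def add_ac del: power_Suc)
    then have "d n = norm q ^ Suc n * d (Suc n)" by (simp add: d_def norm_mult norm_power)
    also have "\<dots> \<le> 1 * d (Suc n)"
      using q by (intro mult_right_mono power_le_one) (auto simp: d_def)
    finally show ?thesis by simp
  qed
  then have "incseq d" by (rule incseq_SucI)
  then have "d n \<le> 0" for n using d0 incseq_le by blast
  then have st: "D (Suc n) = D n" for n by (simp add: d_def)
  have const: "D n = D 0" for n by (induction n) (simp_all add: st)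
  have "D = (\<lambda>_. D K)" using const[of K] const by fastforce
  then have "(\<lambda>_. D K) \<longlonglongrightarrow> inverse (qpoch_inf q q)" using lim by simp
  then have "D K = inverse (qpoch_inf q q)" by (simp add: LIMSEQ_const_iff)
  then show ?thesis by (simp add: D_def)
qed

text \<open>The Durfee identity with K = 2k and m = n - k, multiplied by q^(k^2); negative k follows
  from the symmetry k -> -k. This is the limiting case of Bailey's lemma that the rank series
  needs.\<close>

lemma durfee_symmetric:
  assumes q: "norm q < 1" "q \<noteq> 0"
  shows "((\<lambda>n::nat. q ^ (n\<^sup>2) * inv_qpoch q (int n - k) * inv_qpoch q (int n + k)) has_sum q powi (k * k) / qpoch_inf q q) UNIV"
proof -
  have nn: "((\<lambda>n::nat. q ^ (n\<^sup>2) * inv_qpoch q (int n - k) * inv_qpoch q (int n + k)) has_sum q powi (k * k) / qpoch_inf q q) UNIV"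
    if k: "k \<ge> 0" for k
  proof -
    obtain j where j: "2 * k = int j" using k by (metis nonneg_int_cases zero_le_mult_iff zero_le_numeral)
    have "(durfee_term q (2 * k) has_sum inverse (qpoch_inf q q)) UNIV"
      using has_sum_infsum[OF durfee_summable[OF q, of "int j"]] unfolding j durfee_identity[OF q] .
    then have "((\<lambda>m. q powi (k * k) * durfee_term q (2 * k) m) has_sum q powi (k * k) * inverse (qpoch_inf q q)) UNIV"
      by (rule has_sum_cmult_right)
    then have "((\<lambda>n. q powi (n * n) * inv_qpoch q (n - k) * inv_qpoch q (n + k)) has_sum q powi (k * k) * inverse (qpoch_inf q q)) UNIV"
    proof (rule has_sum_reindex_bij_witness[of _ "\<lambda>n. n - k" "\<lambda>m. m + k", THEN iffD1, rotated -1])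
      fix m :: int
      have "q powi ((m + k) * (m + k)) = q powi (k * k) * q powi (m * m + m * (2 * k))"
        using q by (simp add: power_int_add[symmetric] algebra_simps)
      then show "q powi ((m + k) * (m + k)) * inv_qpoch q (m + k - k) * inv_qpoch q (m + k + k) = q powi (k * k) * durfee_term q (2 * k) m"
        by (simp add: durfee_term_def add.assoc)
    qed auto
    then have "((\<lambda>n. q powi (n * n) * inv_qpoch q (n - k) * inv_qpoch q (n + k)) has_sum q powi (k * k) * inverse (qpoch_inf q q)) (range int)"
    proof (rule has_sum_cong_neutral[THEN iffD1, rotated -1])
      fix n assume "n \<in> UNIV - range int"
      then have "n < 0" by (metis DiffD2 nonneg_int_cases not_le rangeI)
      then show "q powi (n * n) * inv_qpoch q (n - k) * inv_qpoch q (n + k) = 0" using k by (simp add: inv_qpoch_def)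
    qed auto
    then show ?thesis
      by (subst (asm) has_sum_reindex) (auto simp: o_def divide_inverse power2_eq_square power_int_of_nat simp flip: of_nat_mult)
  qed
  show ?thesis
  proof (cases "k \<ge> 0")
    case False
    then show ?thesis using nn[of "- k"] by (simp add: mult_ac)
  qed (rule nn)
qed

text \<open>Each summand is replaced by its finite partial fraction expansion and the summations are
  exchanged; the sum over n is then \<open>durfee_symmetric\<close>. The base becomes q^3 because
  k^2 + \<open>tri k\<close> + k = 3 \<open>tri k\<close> + 2k.\<close>

theorem rank_series:
  assumes q: "norm q < 1" "q \<noteq> 0" and x: "x \<noteq> 0" "\<And>k::int. x * q powi k \<noteq> 1"
  shows "((\<lambda>k. (-1) powi k * (q ^ 3) powi tri k * (q\<^sup>2) powi k / (1 - x * q powi k)) has_sum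
      (qpoch_inf q q / (1 - x) * (\<Sum>\<^sub>\<infinity>n::nat. q ^ (n\<^sup>2) / (qpoch (q * x) q n * qpoch (q / x) q n)))) UNIV"
    and "(\<lambda>n::nat. q ^ (n\<^sup>2) / (qpoch (q * x) q n * qpoch (q / x) q n)) summable_on UNIV"
proof -
  obtain C where C: "C > 0" "\<And>m. norm (inv_qpoch q m) \<le> C" using inv_qpoch_bounded[OF q(1)] by blast
  obtain E where E: "\<And>k::int. norm (1 / (1 - x * q powi k)) \<le> E" using pole_bounded[OF q x(1)] by blast
  have x1: "1 - x \<noteq> 0" using x(2)[of 0] by simp
  define c where "c n k = (-1) powi k * q powi tri k * inv_qpoch q (int n - k) * inv_qpoch q (int n + k) * q powi k / (1 - x * q powi k)" for n and k :: int
  define F where "F = (\<lambda>(n::nat, k). q ^ (n\<^sup>2) * c n k)"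
  have Fs: "F summable_on UNIV \<times> UNIV"
  proof -
    have "(\<lambda>n. norm q ^ n) summable_on (UNIV :: nat set)"
      using q by (subst summable_on_UNIV_nonneg_real_iff) (auto intro!: summable_geometric)
    moreover have "norm q ^ (n\<^sup>2) \<le> norm q ^ n" for n
      using q by (intro power_decreasing) (auto simp: power2_eq_square)
    ultimately have a: "(\<lambda>n. complex_of_real (norm q ^ (n\<^sup>2))) summable_on (UNIV :: nat set)"
      by (intro summable_on_of_real[where ?'a = complex, OF summable_on_comparison_test]) auto
    have b: "(\<lambda>k. complex_of_real (C * C * (norm q powi tri k * norm q powi k) * E)) summable_on (UNIV :: int set)"
      by (intro summable_on_of_real summable_on_cmult_right summable_on_cmult_left summable_gauss_real) (use q in auto)
    have "(\<lambda>(n,k). complex_of_real (norm q ^ (n\<^sup>2)) * complex_of_real (C * C * (norm q powi tri k * norm q powi k) * E)) summable_on UNIV \<times> UNIV"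
      using has_sum_product_complex[OF has_sum_infsum[OF a] has_sum_infsum[OF b]] has_sum_imp_summable by blast
    then have s: "(\<lambda>(n::nat,k). norm (complex_of_real (norm q ^ (n\<^sup>2)) * complex_of_real (C * C * (norm q powi tri k * norm q powi k) * E))) summable_on UNIV \<times> UNIV"
      unfolding summable_on_iff_abs_summable_on_complex by (simp add: case_prod_unfold)
    have E0: "E \<ge> 0" using E[of 0] norm_ge_zero order_trans by blast
    have "(\<lambda>z. norm (F z)) summable_on UNIV \<times> UNIV"
    proof (rule summable_on_comparison_test[OF s])
      fix z :: "nat \<times> int"
      obtain n k where z: "z = (n, k)" by force
      have "norm ((-1) powi k * q powi tri k * inv_qpoch q (int n - k) * inv_qpoch q (int n + k) * q powi k) * norm (1 / (1 - x * q powi k))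
          \<le> C * C * (norm q powi tri k * norm q powi k) * E"
        by (intro mult_mono norm_triple_term_le C E mult_nonneg_nonneg zero_le_power_int) (use C in auto)
      then have "norm (c n k) \<le> C * C * (norm q powi tri k * norm q powi k) * E"
        unfolding c_def by (simp only: norm_mult norm_divide norm_one times_divide_eq_right mult_1_right)
      then have "norm (q ^ (n\<^sup>2) * c n k) \<le> norm q ^ (n\<^sup>2) * (C * C * (norm q powi tri k * norm q powi k) * E)"
        unfolding norm_mult norm_power by (intro mult_left_mono) auto
      also have "\<dots> = norm (complex_of_real (norm q ^ (n\<^sup>2)) * complex_of_real (C * C * (norm q powi tri k * norm q powi k) * E))"
        using C E0 by (simp add: norm_mult norm_power abs_mult del: of_real_mult of_real_power)
      finally show "norm (F z) \<le> (case z of (n, k) \<Rightarrow> norm (complex_of_real (norm q ^ (n\<^sup>2)) * complex_of_real (C * C * (norm q powi tri k * norm q powi k) * E)))"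
        by (simp add: z F_def)
    qed auto
    then show ?thesis by (rule abs_summable_summable)
  qed
  define S where "S = infsum F (UNIV \<times> UNIV)"
  have FS: "(F has_sum S) (UNIV \<times> UNIV)" unfolding S_def by (rule has_sum_infsum[OF Fs])
  have "((\<lambda>n. q ^ (n\<^sup>2) * (1 / (qpoch x q (Suc n) * qpoch (q / x) q n))) has_sum S) UNIV"
  proof (rule has_sum_SigmaD[OF FS])
    show "((\<lambda>k. F (n, k)) has_sum q ^ (n\<^sup>2) * (1 / (qpoch x q (Suc n) * qpoch (q / x) q n))) UNIV" for n
      unfolding F_def prod.case c_def by (intro has_sum_cmult_right finite_partial_fractions q x)
  qed
  then have "((\<lambda>n. (1 - x) * (q ^ (n\<^sup>2) * (1 / (qpoch x q (Suc n) * qpoch (q / x) q n)))) has_sum (1 - x) * S) UNIV"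
    by (rule has_sum_cmult_right)
  then have R: "((\<lambda>n::nat. q ^ (n\<^sup>2) / (qpoch (q * x) q n * qpoch (q / x) q n)) has_sum (1 - x) * S) UNIV"
    using x1 by (simp add: qpoch_Suc_left)
  show "(\<lambda>n::nat. q ^ (n\<^sup>2) / (qpoch (q * x) q n * qpoch (q / x) q n)) summable_on UNIV"
    using R has_sum_imp_summable by blast
  have sw: "((\<lambda>(k, n). F (n, k)) has_sum S) (UNIV \<times> UNIV)"
    using FS by (subst (asm) has_sum_swap) simp
  have "((\<lambda>k. q powi (k * k) / qpoch_inf q q * ((-1) powi k * q powi tri k * q powi k / (1 - x * q powi k))) has_sum S) UNIV"
  proof (rule has_sum_SigmaD[OF sw])
    fix k :: int
    have "((\<lambda>n. q ^ (n\<^sup>2) * inv_qpoch q (int n - k) * inv_qpoch q (int n + k) * ((-1) powi k * q powi tri k * q powi k / (1 - x * q powi k))) has_sum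
        q powi (k * k) / qpoch_inf q q * ((-1) powi k * q powi tri k * q powi k / (1 - x * q powi k))) UNIV"
      by (intro has_sum_cmult_left durfee_symmetric q)
    then show "((\<lambda>n. case (k, n) of (k, n) \<Rightarrow> F (n, k)) has_sum q powi (k * k) / qpoch_inf q q * ((-1) powi k * q powi tri k * q powi k / (1 - x * q powi k))) UNIV"
      by (simp add: F_def c_def mult_ac)
  qed
  then have "((\<lambda>k. qpoch_inf q q * (q powi (k * k) / qpoch_inf q q * ((-1) powi k * q powi tri k * q powi k / (1 - x * q powi k)))) has_sum qpoch_inf q q * S) UNIV"
    by (rule has_sum_cmult_right)
  moreover have "qpoch_inf q q * (q powi (k * k) / qpoch_inf q q * ((-1) powi k * q powi tri k * q powi k / (1 - x * q powi k)))
      = (-1) powi k * (q ^ 3) powi tri k * (q\<^sup>2) powi k / (1 - x * q powi k)" for k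
  proof -
    have "q powi (k * k) * (q powi tri k * q powi k) = (q ^ 3) powi tri k * (q\<^sup>2) powi k"
    proof -
      have "k * k + (tri k + k) = 3 * tri k + 2 * k" using two_tri[of k] by (simp add: algebra_simps)
      then show ?thesis using q(2) unfolding power3_powi power2_powi by (simp only: power_int_add[symmetric] simp_thms)
    qed
    then have "(-1) powi k * (q ^ 3) powi tri k * (q\<^sup>2) powi k / (1 - x * q powi k)
        = (-1) powi k * (q powi (k * k) * (q powi tri k * q powi k)) / (1 - x * q powi k)"
      by (simp only: mult.assoc)
    then show ?thesis using qpoch_self_nonzero(2)[OF q(1)] by (auto simp: mult_ac)
  qed
  moreover have "qpoch_inf q q * S = qpoch_inf q q / (1 - x) * (\<Sum>\<^sub>\<infinity>n::nat. q ^ (n\<^sup>2) / (qpoch (q * x) q n * qpoch (q / x) q n))"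
    using x1 infsumI[OF R] by simp
  ultimately show "((\<lambda>k. (-1) powi k * (q ^ 3) powi tri k * (q\<^sup>2) powi k / (1 - x * q powi k)) has_sum
      (qpoch_inf q q / (1 - x) * (\<Sum>\<^sub>\<infinity>n::nat. q ^ (n\<^sup>2) / (qpoch (q * x) q n * qpoch (q / x) q n)))) UNIV"
    by simp
qed

lemma unit_q_powi_ne_1:
  fixes q x :: complex
  assumes "norm q < 1" "q \<noteq> 0" "norm x = 1" "x \<noteq> 1"
  shows "x * q powi n \<noteq> 1"
proof
  assume xq: "x * q powi n = 1"
  then have n1: "norm q powi n = 1" using assms by (metis mult_1 norm_mult norm_one norm_power_int)
  have "n \<noteq> 0" using xq assms(4) by auto
  obtain m where m: "n = int m \<or> n = - int m" by (meson int_cases2)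
  then have "norm q ^ m = 1" using n1 by (auto simp: power_int_minus power_int_of_nat)
  moreover have "m > 0" using m \<open>n \<noteq> 0\<close> by auto
  ultimately show False using assms(1) power_less_one_iff[of "norm q" m] by simp
qed

lemma qpoch_minus_nonzero:
  fixes q :: complex
  assumes "norm q < 1"
  shows "qpoch (- (q ^ k)) q n \<noteq> 0" "qpoch_inf (- (q ^ k)) q \<noteq> 0"
proof -
  have *: "q ^ i * (- (q ^ k)) \<noteq> 1" for i
  proof (cases "q = 0")
    case True
    then show ?thesis by (auto simp: power_0_left)
  next
    case False
    then show ?thesis using unit_q_powi_ne_1[OF assms False, of "-1" "int (i + k)"]
      unfolding power_int_of_nat by (simp add: power_add)
  qed
  show "qpoch_inf (- (q ^ k)) q \<noteq> 0" by (rule qpoch_inf_nonzero[OF assms *])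
  have "1 - q ^ i * (- (q ^ k)) \<noteq> 0" for i using *[of i] by (metis eq_iff_diff_eq_0)
  then show "qpoch (- (q ^ k)) q n \<noteq> 0" by (simp only: qpoch_def prod_zero_iff finite_lessThan) blast
qed

text \<open>In this combination the numerators acquire the factor 1 - z q^k, which cancels the pole
  and leaves a theta series.\<close>

lemma appell_shift:
  assumes q: "norm q < 1" "q \<noteq> 0" and x: "x \<noteq> 0" and z: "z \<noteq> 0" "\<And>k::int. z * q powi k \<noteq> 1"
  shows "appell q x z - z * appell q (q * x) z = jtheta (q * x) q"
proof (rule has_sum_unique)
  show "((\<lambda>k. (-1) powi k * q powi tri k * (q * x) powi k) has_sum jtheta (q * x) q) UNIV"
    by (rule jacobi_triple_product) (use q x in auto)
  have "((\<lambda>k. (-1) powi k * q powi tri k * (q * x) powi k / (1 - z * q powi k)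
      - z * ((-1) powi k * q powi tri k * (q * (q * x)) powi k / (1 - z * q powi k))) has_sum
      (appell q x z - z * appell q (q * x) z)) UNIV"
    by (intro has_sum_diff has_sum_cmult_right appell_has_sum q) (use q x z in auto)
  moreover have "(-1) powi k * q powi tri k * (q * x) powi k / (1 - z * q powi k)
      - z * ((-1) powi k * q powi tri k * (q * (q * x)) powi k / (1 - z * q powi k)) = (-1) powi k * q powi tri k * (q * x) powi k" for k
  proof -
    define t where "t = (-1) powi k * q powi tri k * (q * x) powi k"
    have "(q * (q * x)) powi k = (q * x) powi k * q powi k" by (simp add: power_int_mult_distrib mult_ac)
    then have "(-1) powi k * q powi tri k * (q * x) powi k / (1 - z * q powi k)
      - z * ((-1) powi k * q powi tri k * (q * (q * x)) powi k / (1 - z * q powi k)) = t * (1 - z * q powi k) / (1 - z * q powi k)"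
      by (simp add: t_def diff_divide_distrib right_diff_distrib mult_ac)
    then show ?thesis using z(2)[of k] by (simp add: t_def)
  qed
  ultimately show "((\<lambda>k. (-1) powi k * q powi tri k * (q * x) powi k) has_sum (appell q x z - z * appell q (q * x) z)) UNIV"
    by simp
qed

text \<open>The three base q^3 products in j(q;q^3) run through the residue classes modulo 3 of the
  factors of (q)_inf.\<close>

lemma jtheta_q_q3:
  assumes "norm q < 1" "q \<noteq> 0"
  shows "jtheta q (q ^ 3) = qpoch_inf q q" "jtheta (q\<^sup>2) (q ^ 3) = qpoch_inf q q"
proof -
  show 1: "jtheta q (q ^ 3) = qpoch_inf q q"
    using qpoch_inf_dissect[OF assms(1), of 3 q] assms(2)
    by (simp add: jtheta_def numeral_3_eq_3 mult_ac)
  show "jtheta (q\<^sup>2) (q ^ 3) = qpoch_inf q q"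
    using jtheta_reflect[of "q ^ 3" q] assms(2) 1 by (simp add: power3_eq_cube power2_eq_square)
qed

text \<open>The third-order mock theta function f(q), the rank series at x = -1. It is the bridge
  from \<open>psi3\<close> to Appell sums.\<close>

definition f3 :: "complex \<Rightarrow> complex" where
  "f3 q = (\<Sum>\<^sub>\<infinity>n::nat. q ^ (n\<^sup>2) / (qpoch (- q) q n)\<^sup>2)"

context
  fixes q Q :: complex
  assumes q: "norm q < 1" "q \<noteq> 0" and Q: "Q = q ^ 3"
begin

lemma Q_bounds: "norm Q < 1" "Q \<noteq> 0"
  using q by (auto simp: Q norm_power power_less_one_iff)

text \<open>The numerator parameters 1/q and 1/q^2 lie outside the annulus of
  \<open>appell_change\<close>, so both sums are first shifted by the factor Q, to q^2 and q. The
  change with b = 1/q then applies, and the factors j(-q;Q) and j(-1/q;Q) cancel up to a power of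
  q.\<close>

lemma appell_relation:
  "appell Q (1 / q) (-1) - appell Q (1 / q\<^sup>2) (- 1 / q) = qpoch_inf Q Q ^ 3 / jtheta (-1) Q"
proof -
  define J where "J = qpoch_inf q q"
  have J0: "J \<noteq> 0" unfolding J_def by (rule qpoch_self_nonzero[OF q(1)])
  have nm: "- (Q powi k) \<noteq> 1" "(- 1 / q) * Q powi k \<noteq> 1" "(1 / q) * Q powi k \<noteq> 1" "- q * Q powi k \<noteq> 1" for k
  proof -
    have e: "Q powi k = q powi (3 * k)" "(1 / q) * Q powi k = q powi (3 * k - 1)" "q * Q powi k = q powi (3 * k + 1)"
      using q by (simp_all add: Q power3_powi power_int_add power_int_diff)
    show "- (Q powi k) \<noteq> 1" using unit_q_powi_ne_1[OF q, of "-1" "3 * k"] e by simp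
    show "(- 1 / q) * Q powi k \<noteq> 1" using unit_q_powi_ne_1[OF q, of "-1" "3 * k - 1"] e(2) by simp
    show "- q * Q powi k \<noteq> 1" using unit_q_powi_ne_1[OF q, of "-1" "3 * k + 1"] e(3) by simp
    have "3 * k - 1 \<noteq> 0" by presburger
    then show "(1 / q) * Q powi k \<noteq> 1" using q_powi_ne_1[OF q, of "3 * k - 1"] e(2) by simp
  qed
  have jq: "jtheta q Q = J" "jtheta (q\<^sup>2) Q = J"
    using jtheta_q_q3[OF q] by (simp_all add: Q J_def)
  have a: "appell Q (1 / q) (-1) + appell Q (q\<^sup>2) (-1) = J"
    using appell_shift[OF Q_bounds, of "1/q" "-1"] q nm(1) jq by (simp add: Q power3_eq_cube power2_eq_square)
  have b: "appell Q (1 / q\<^sup>2) (- 1 / q) + 1 / q * appell Q q (- 1 / q) = J"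
    using appell_shift[OF Q_bounds, of "1/q\<^sup>2" "- 1 / q"] q nm(2) jq by (simp add: Q power3_eq_cube power2_eq_square)
  have x: "norm Q < norm (q\<^sup>2)" "norm (q\<^sup>2) < 1"
    using q power_strict_decreasing[of 2 3 "norm q"] by (auto simp: Q norm_power power_less_one_iff)
  have c: "J * appell Q (q\<^sup>2) (-1) - 1 / q * J * appell Q q (- 1 / q)
      = qpoch_inf Q Q ^ 3 * jtheta (1 / q) Q * jtheta (- q) Q / (jtheta (-1) Q * jtheta (- 1 / q) Q)"
    using appell_change[OF Q_bounds x, of "1/q" "-1"] q nm jq by (simp add: power2_eq_square)
  have d: "jtheta (1 / q) Q = - J / q" using jtheta_inverse[OF Q_bounds q(2)] jq by simp
  have e: "jtheta (- 1 / q) Q = jtheta (- q) Q / q" using jtheta_inverse[OF Q_bounds, of "- q"] q by simp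
  have f: "jtheta (- q) Q \<noteq> 0" by (rule jtheta_nonzero[OF Q_bounds]) (use q nm in auto)
  have "J * (appell Q (q\<^sup>2) (-1) - 1 / q * appell Q q (- 1 / q)) = J * (- (qpoch_inf Q Q ^ 3 / jtheta (-1) Q))"
    using c unfolding d e using f q by (simp add: field_simps)
  then have h: "appell Q (q\<^sup>2) (-1) - 1 / q * appell Q q (- 1 / q) = - (qpoch_inf Q Q ^ 3 / jtheta (-1) Q)"
    using J0 by (metis mult_cancel_left)
  have "appell Q (1 / q) (-1) - appell Q (1 / q\<^sup>2) (- 1 / q)
      = (appell Q (1 / q) (-1) + appell Q (q\<^sup>2) (-1)) - (appell Q (1 / q\<^sup>2) (- 1 / q) + 1 / q * appell Q q (- 1 / q))
        - (appell Q (q\<^sup>2) (-1) - 1 / q * appell Q q (- 1 / q))"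
    by (simp only: add_diff_add diff_diff_eq2 add_diff_cancel_right) simp
  then show ?thesis unfolding a b h by simp
qed

text \<open>With u = q^k and x^3 = -1 one has 1/(1 - x u) = (1 + x u + x^2 u^2)/(1 + u^3), so these
  three moments determine the rank series at all cube roots of -1. The second is a partial fraction
  expansion of 1/j(-1;Q); the third is the first under k -> -k.\<close>

lemma appell_moments:
  defines "E \<equiv> \<lambda>k. (-1) powi k * Q powi tri k * (q\<^sup>2) powi k"
  shows "((\<lambda>k. E k / (1 + Q powi k)) has_sum appell Q (1 / q) (-1)) UNIV"
    and "((\<lambda>k. E k * q powi k / (1 + Q powi k)) has_sum (qpoch_inf Q Q ^ 3 / jtheta (-1) Q)) UNIV"
    and "((\<lambda>k. E k * (q powi k)\<^sup>2 / (1 + Q powi k)) has_sum appell Q (1 / q) (-1)) UNIV"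
proof -
  have nm: "- (Q powi k) \<noteq> 1" for k
    using unit_q_powi_ne_1[OF Q_bounds, of "-1" k] by simp
  have Q2: "Q * (1 / q) = q\<^sup>2" using q by (simp add: Q power3_eq_cube power2_eq_square)
  show 1: "((\<lambda>k. E k / (1 + Q powi k)) has_sum appell Q (1 / q) (-1)) UNIV"
    using appell_has_sum[OF Q_bounds, of "1/q" "-1"] q unfolding Q2 by (simp add: E_def)
  show "((\<lambda>k. E k * q powi k / (1 + Q powi k)) has_sum (qpoch_inf Q Q ^ 3 / jtheta (-1) Q)) UNIV"
  proof -
    have "(q\<^sup>2) powi k * q powi k = Q powi k" for k
      by (simp add: Q power3_eq_cube power2_eq_square power_int_mult_distrib)
    then show ?thesis using theta_partial_fractions[OF Q_bounds, of "-1"] nm by (simp add: E_def mult.assoc)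
  qed
  show "((\<lambda>k. E k * (q powi k)\<^sup>2 / (1 + Q powi k)) has_sum appell Q (1 / q) (-1)) UNIV"
  proof (rule has_sum_reindex_bij_witness[of _ uminus uminus, THEN iffD1, OF _ _ _ _ _ _ 1])
    fix k :: int
    define u where "u = q powi k"
    have u0: "u \<noteq> 0" using q by (simp add: u_def)
    have e: "Q powi k = u ^ 3" "(q\<^sup>2) powi k = u\<^sup>2"
      by (simp_all add: Q u_def power3_eq_cube power2_eq_square power_int_mult_distrib)
    have nz: "1 + u ^ 3 \<noteq> 0" using nm[of k] unfolding e(1) by (auto simp: add_eq_0_iff)
    have "u ^ 3 * inverse (u\<^sup>2) * (inverse u)\<^sup>2 / (1 + inverse (u ^ 3)) = u\<^sup>2 / (1 + u ^ 3)"
    proof -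
      have "1 + inverse (u ^ 3) = (1 + u ^ 3) / u ^ 3" using u0 by (simp add: field_simps)
      moreover have "u ^ 3 * inverse (u\<^sup>2) * (inverse u)\<^sup>2 = inverse u"
        using u0 by (simp add: field_simps power2_eq_square power3_eq_cube)
      moreover have "inverse u / (t / u ^ 3) = u\<^sup>2 / t" for t
        using u0 by (simp add: divide_inverse power2_eq_square power3_eq_cube)
      ultimately show ?thesis by simp
    qed
    then have "(-1) powi k * Q powi tri k * (u ^ 3 * inverse (u\<^sup>2) * (inverse u)\<^sup>2 / (1 + inverse (u ^ 3)))
        = (-1) powi k * Q powi tri k * (u\<^sup>2 / (1 + u ^ 3))" by simp
    then show "E (- k) * (q powi (- k))\<^sup>2 / (1 + Q powi (- k)) = E k / (1 + Q powi k)"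
      unfolding E_def power_int_minus tri_minus u_def[symmetric]
      using Q_bounds by (simp add: power_int_add power_int_minus e mult_ac)
  qed auto
qed

lemma chi3_appell:
  "qpoch_inf q q * chi3 q = appell Q (1 / q) (-1) + qpoch_inf Q Q ^ 3 / jtheta (-1) Q"
proof -
  \<comment> \<open>A primitive sixth root of unity: (1 + y)(1 - w y)(1 - y/w) = 1 + y^3, so the
    summands of \<open>chi3\<close> are those of the rank series at w.\<close>
  define w where "w = Complex (1/2) (sqrt 3 / 2)"
  have w2: "w * w = w - 1" by (simp add: w_def complex_eq_iff)
  have w0: "w \<noteq> 0" "w \<noteq> 1" by (simp_all add: w_def complex_eq_iff)
  have wn: "norm w = 1" by (simp add: w_def cmod_def power2_eq_square)
  have iw: "1 / w = 1 - w" using w0 w2 by (simp add: field_simps)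
  have w3: "w * (w * w) = -1"
  proof -
    have "w * (w * w) = w * (w - 1)" by (simp only: w2)
    also have "\<dots> = w * w - w" by (simp add: algebra_simps)
    finally show ?thesis by (simp add: w2)
  qed
  define W where "W = appell Q (1 / q) (-1)"
  define K where "K = qpoch_inf Q Q ^ 3 / jtheta (-1) Q"
  define E where "E k = (-1) powi k * Q powi tri k * (q\<^sup>2) powi k" for k
  have nw: "w * q powi k \<noteq> 1" for k by (rule unit_q_powi_ne_1[OF q wn w0(2)])
  have R: "((\<lambda>k. E k / (1 - w * q powi k)) has_sum
      (qpoch_inf q q / (1 - w) * (\<Sum>\<^sub>\<infinity>n::nat. q ^ (n\<^sup>2) / (qpoch (q * w) q n * qpoch (q / w) q n)))) UNIV"
    unfolding E_def Q by (rule rank_series(1)[OF q w0(1) nw])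
  have "((\<lambda>k. E k / (1 + Q powi k) + w * (E k * q powi k / (1 + Q powi k)) + w * w * (E k * (q powi k)\<^sup>2 / (1 + Q powi k)))
      has_sum (W + w * K + w * w * W)) UNIV"
    unfolding W_def K_def E_def by (intro has_sum_add has_sum_cmult_right appell_moments)
  moreover have "E k / (1 + Q powi k) + w * (E k * q powi k / (1 + Q powi k)) + w * w * (E k * (q powi k)\<^sup>2 / (1 + Q powi k)) = E k / (1 - w * q powi k)" for k
  proof -
    define u where "u = q powi k"
    have e: "Q powi k = u ^ 3" by (simp add: Q u_def power3_eq_cube power_int_mult_distrib)
    have nz: "1 + u ^ 3 \<noteq> 0" "1 - w * u \<noteq> 0"
      using unit_q_powi_ne_1[OF Q_bounds, of "-1" k] nw[of k] e by (auto simp: u_def add_eq_0_iff)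
    have "(1 + w * u + w * w * u\<^sup>2) * (1 - w * u) = 1 - (w * (w * w)) * u ^ 3"
      by (simp add: algebra_simps power2_eq_square power3_eq_cube)
    then have "(1 + w * u + w * w * u\<^sup>2) * (1 - w * u) = 1 + u ^ 3" unfolding w3 by simp
    then have "(1 + w * u + w * w * u\<^sup>2) / (1 + u ^ 3) = 1 / (1 - w * u)"
      using nz by (simp add: frac_eq_eq)
    then have "E k * ((1 + w * u + w * w * u\<^sup>2) / (1 + u ^ 3)) = E k * (1 / (1 - w * u))" by simp
    then show ?thesis unfolding e u_def[symmetric] by (simp add: add_divide_distrib distrib_left mult_ac)
  qed
  ultimately have "((\<lambda>k. E k / (1 - w * q powi k)) has_sum (W + w * K + w * w * W)) UNIV" by simp
  from has_sum_unique[OF R this]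
  have eq: "qpoch_inf q q / (1 - w) * (\<Sum>\<^sub>\<infinity>n::nat. q ^ (n\<^sup>2) / (qpoch (q * w) q n * qpoch (q / w) q n)) = W + w * K + w * w * W" .
  have tm: "q ^ (n\<^sup>2) * qpoch (- q) q n / qpoch (- (q ^ 3)) (q ^ 3) n = q ^ (n\<^sup>2) / (qpoch (q * w) q n * qpoch (q / w) q n)" for n
  proof -
    have "qpoch (- q) q n * (qpoch (q * w) q n * qpoch (q / w) q n) = qpoch (- (q ^ 3)) (q ^ 3) n"
      unfolding qpoch_def prod.distrib[symmetric]
    proof (rule prod.cong[OF refl])
      fix i
      define y where "y = q ^ i * q"
      have "(1 - q ^ i * - q) * ((1 - q ^ i * (q * w)) * (1 - q ^ i * (q / w))) = (1 + y) * ((1 - y * w) * (1 - y * (1 / w)))"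
        by (simp add: y_def mult_ac)
      also have "\<dots> = (1 + y) * (1 - y + y * y * (w - w * w))" unfolding iw by (simp add: algebra_simps)
      also have "\<dots> = 1 + y ^ 3" unfolding w2 by (simp add: algebra_simps power3_eq_cube)
      also have "\<dots> = 1 - (q ^ 3) ^ i * - (q ^ 3)"
        by (simp add: y_def power_mult_distrib power_mult[symmetric] mult.commute)
      finally show "(1 - q ^ i * - q) * ((1 - q ^ i * (q * w)) * (1 - q ^ i * (q / w))) = 1 - (q ^ 3) ^ i * - (q ^ 3)" .
    qed
    moreover have "qpoch (- q) q n \<noteq> 0" using qpoch_minus_nonzero(1)[OF q(1), of 1] by simp
    ultimately show ?thesis by (metis (no_types, lifting) mult.commute mult_divide_mult_cancel_left)
  qed
  have s: "(\<lambda>n::nat. q ^ (n\<^sup>2) / (qpoch (q * w) q n * qpoch (q / w) q n)) summable_on UNIV"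
    by (rule rank_series(2)[OF q w0(1) nw])
  have "chi3 q = (\<Sum>\<^sub>\<infinity>n::nat. q ^ (n\<^sup>2) / (qpoch (q * w) q n * qpoch (q / w) q n))"
    unfolding chi3_def tm using sums_unique[OF has_sum_imp_sums[OF has_sum_infsum[OF s]]] by simp
  then have "qpoch_inf q q / (1 - w) * chi3 q = W + w * K + w * w * W" using eq by simp
  then have "qpoch_inf q q * chi3 q = (1 - w) * (W + w * K + w * w * W)"
    using w0 by (simp add: field_simps)
  also have "\<dots> = ((1 - w) * (1 + w * w)) * W + (w - w * w) * K" by (simp add: algebra_simps)
  also have "\<dots> = W + K"
  proof -
    have "(1 - w) * (1 + w * w) = 1" "w - w * w = 1" using w2 by (simp_all add: algebra_simps)
    then show ?thesis by simp
  qed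
  finally show ?thesis by (simp add: W_def K_def)
qed

text \<open>The rank series at x = -1, through 1/(1 + u) = (1 - u + u^2)/(1 + u^3). The prefactor
  1/(1 - x) is 1/2 here, which doubles the coefficients.\<close>

lemma f3_appell:
  "qpoch_inf q q * f3 q = 4 * appell Q (1 / q) (-1) - 2 * (qpoch_inf Q Q ^ 3 / jtheta (-1) Q)"
proof -
  define W where "W = appell Q (1 / q) (-1)"
  define K where "K = qpoch_inf Q Q ^ 3 / jtheta (-1) Q"
  define E where "E k = (-1) powi k * Q powi tri k * (q\<^sup>2) powi k" for k
  have nw: "(-1) * q powi k \<noteq> 1" for k by (rule unit_q_powi_ne_1[OF q]) auto
  have R: "((\<lambda>k. E k / (1 - (-1) * q powi k)) has_sum
      (qpoch_inf q q / (1 - (-1)) * (\<Sum>\<^sub>\<infinity>n::nat. q ^ (n\<^sup>2) / (qpoch (q * -1) q n * qpoch (q / -1) q n)))) UNIV"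
    unfolding E_def Q by (rule rank_series(1)[OF q _ nw]) simp
  have "((\<lambda>k. E k / (1 + Q powi k) - E k * q powi k / (1 + Q powi k) + E k * (q powi k)\<^sup>2 / (1 + Q powi k))
      has_sum (W - K + W)) UNIV"
    unfolding W_def K_def E_def by (intro has_sum_add has_sum_diff appell_moments)
  moreover have "E k / (1 + Q powi k) - E k * q powi k / (1 + Q powi k) + E k * (q powi k)\<^sup>2 / (1 + Q powi k) = E k / (1 - (-1) * q powi k)" for k
  proof -
    define u where "u = q powi k"
    have e: "Q powi k = u ^ 3" by (simp add: Q u_def power3_eq_cube power_int_mult_distrib)
    have nz: "1 + u ^ 3 \<noteq> 0" "1 + u \<noteq> 0"
      using unit_q_powi_ne_1[OF Q_bounds, of "-1" k] nw[of k] e by (auto simp: u_def add_eq_0_iff)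
    have "(1 - u + u\<^sup>2) * (1 + u) = 1 + u ^ 3"
      by (simp add: algebra_simps power2_eq_square power3_eq_cube)
    then have "(1 - u + u\<^sup>2) / (1 + u ^ 3) = 1 / (1 + u)"
      using nz by (simp add: frac_eq_eq)
    then have "E k * ((1 - u + u\<^sup>2) / (1 + u ^ 3)) = E k * (1 / (1 + u))" by simp
    then show ?thesis unfolding e u_def[symmetric] by (simp add: add_divide_distrib diff_divide_distrib distrib_left right_diff_distrib mult_ac)
  qed
  ultimately have "((\<lambda>k. E k / (1 - (-1) * q powi k)) has_sum (W - K + W)) UNIV" by simp
  from has_sum_unique[OF R this] have "qpoch_inf q q / 2 * f3 q = W - K + W"
    by (simp add: f3_def power2_eq_square)
  then show ?thesis by (simp add: W_def K_def field_simps)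
qed

end

section \<open>The relation between the mock theta functions \<open>f\<^sub>3\<close> and \<open>\<psi>\<^sub>3\<close>\<close>

lemma qpoch_inf_tendsto_1:
  assumes "norm q < 1" "qpoch_inf x q \<noteq> 0"
  shows "(\<lambda>n. qpoch_inf (q ^ n * x) q) \<longlonglongrightarrow> 1"
proof -
  have "(\<lambda>n. qpoch_inf x q / qpoch x q n) \<longlonglongrightarrow> qpoch_inf x q / qpoch_inf x q"
    by (intro tendsto_intros qpoch_LIMSEQ assms)
  moreover have "qpoch_inf x q / qpoch x q n = qpoch_inf (q ^ n * x) q" for n
    using qpoch_inf_split[OF assms(1), of x n] assms(2) by auto
  ultimately show ?thesis using assms(2) by simp
qed

lemma inverse_qpoch_bounded:
  assumes "norm q < 1" "qpoch_inf x q \<noteq> 0"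
  obtains C where "C > 0" "\<And>n. norm (inverse (qpoch x q n)) \<le> C"
proof -
  have "(\<lambda>n. inverse (qpoch x q n)) \<longlonglongrightarrow> inverse (qpoch_inf x q)"
    by (intro tendsto_inverse qpoch_LIMSEQ assms)
  then have "Bseq (\<lambda>n. inverse (qpoch x q n))"
    by (intro convergent_imp_Bseq convergentI)
  then show ?thesis using that by (auto elim: BseqE)
qed

context
  fixes q :: complex
  assumes q: "norm q < 1" "q \<noteq> 0"
begin

text \<open>A deformation of f_3: at j = 0 the sum is f_3/2, because (-1;q)_(n+1) = 2 (-q;q)_n,
  while for j -> infinity only n = 0 survives and the sum tends to 1.\<close>

definition fine_term :: "nat \<Rightarrow> nat \<Rightarrow> complex" where
  "fine_term j n = q ^ (j * n + n\<^sup>2) / (qpoch (- q) q n * qpoch (- (q ^ j)) q (Suc n))"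

lemma qpoch_neg_pow: "qpoch (- 1) q (j + n) = qpoch (- 1) q j * qpoch (- (q ^ j)) q n"
  by (induction n) (simp_all add: qpoch_Suc power_add mult_ac)

lemma fine_term_bound:
  obtains B where "B > 0" "\<And>j n. norm (fine_term j n) \<le> B * norm q ^ (j * n + n)"
proof -
  have m1: "qpoch_inf (- 1) q \<noteq> 0" "qpoch_inf (- q) q \<noteq> 0"
    using qpoch_minus_nonzero(2)[OF q(1), of 0] qpoch_minus_nonzero(2)[OF q(1), of 1] by simp_all
  obtain A where A: "A > 0" "\<And>n. norm (inverse (qpoch (-1) q n)) \<le> A"
    using inverse_qpoch_bounded[OF q(1) m1(1)] by blast
  obtain C where C: "C > 0" "\<And>n. norm (inverse (qpoch (-q) q n)) \<le> C"
    using inverse_qpoch_bounded[OF q(1) m1(2)] by blast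
  have "Bseq (\<lambda>n. qpoch (-1) q n)"
    using qpoch_LIMSEQ[OF q(1)] by (intro convergent_imp_Bseq convergentI)
  then obtain D where D: "D > 0" "\<And>n. norm (qpoch (-1) q n) \<le> D" by (auto elim: BseqE)
  show ?thesis
  proof (rule that[of "C * (D * A)"])
    show "C * (D * A) > 0" using A C D by simp
    fix j n
    have "qpoch (-1) q j \<noteq> 0" using qpoch_minus_nonzero(1)[OF q(1), of 0] by simp
    then have e: "inverse (qpoch (- (q ^ j)) q (Suc n)) = qpoch (-1) q j * inverse (qpoch (-1) q (j + Suc n))"
      unfolding qpoch_neg_pow by simp
    have "norm (fine_term j n) = norm q ^ (j * n + n\<^sup>2) * (norm (inverse (qpoch (-q) q n)) * (norm (qpoch (-1) q j) * norm (inverse (qpoch (-1) q (j + Suc n)))))"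
      unfolding fine_term_def divide_inverse inverse_mult_distrib e norm_mult norm_power by simp
    also have "\<dots> \<le> norm q ^ (j * n + n) * (C * (D * A))"
      by (intro mult_mono A C D mult_nonneg_nonneg norm_ge_zero power_decreasing)
         (use q A C D in \<open>auto simp: power2_eq_square intro: less_imp_le\<close>)
    finally show "norm (fine_term j n) \<le> C * (D * A) * norm q ^ (j * n + n)" by (simp add: mult.commute)
  qed
qed

lemma geometric_summable_on: "(\<lambda>n. c * norm q ^ n) summable_on (UNIV :: nat set)"
proof -
  have "(\<lambda>n. norm q ^ n) summable_on (UNIV :: nat set)"
    using q by (subst summable_on_UNIV_nonneg_real_iff) (auto intro!: summable_geometric)
  then show ?thesis by (rule summable_on_cmult_right)
qed

lemma fine_summable: "fine_term j summable_on UNIV"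
proof -
  obtain B where B: "B > 0" "\<And>j n. norm (fine_term j n) \<le> B * norm q ^ (j * n + n)"
    using fine_term_bound by blast
  have "norm (fine_term j n) \<le> B * norm q ^ n" for n
  proof -
    have "norm q ^ (j * n + n) \<le> norm q ^ n" using q by (intro power_decreasing) auto
    then show ?thesis using B(2)[of j n] B(1) by (meson mult_left_mono less_imp_le order_trans)
  qed
  then have "(\<lambda>n. norm (fine_term j n)) summable_on UNIV"
    by (intro summable_on_comparison_test[OF geometric_summable_on[of B]]) auto
  then show ?thesis by (rule abs_summable_summable)
qed

lemma fine_sums: "fine_term j sums infsum (fine_term j) UNIV"
  by (rule has_sum_imp_sums[OF has_sum_infsum[OF fine_summable]])

lemma fine_rec: "(1 + q ^ j) * infsum (fine_term j) UNIV + infsum (fine_term (Suc j)) UNIV = 2"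
proof -
  \<comment> \<open>A telescoping certificate: the combined summand is U n - U (n + 1), U tends to
    0, and U 0 = 2 is the right side.\<close>
  define U where "U n = (1 + q ^ j) * (1 + q ^ n) * fine_term j n" for n
  have nz: "1 + q ^ n \<noteq> 0" for n
    using unit_q_powi_ne_1[OF q, of "-1" "int n"] by (auto simp: power_int_of_nat add_eq_0_iff)
  have key: "(1 + q ^ j) * fine_term j n + fine_term (Suc j) n = U n - U (Suc n)" for n
  proof -
    define A where "A = qpoch (- q) q n"
    define B where "B = qpoch (- (q ^ j)) q (Suc n)"
    define v where "v = q ^ n"
    define p where "p = q ^ j"
    have A0: "A \<noteq> 0" using qpoch_minus_nonzero(1)[OF q(1), of 1] by (simp add: A_def)
    have B0: "B \<noteq> 0" using qpoch_minus_nonzero(1)[OF q(1)] unfolding B_def .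
    have b2: "qpoch (- (q ^ j)) q (Suc (Suc n)) = B * (1 + q * v * p)"
      unfolding qpoch_Suc[of _ _ "Suc n"] B_def[symmetric] v_def p_def by simp
    have b3: "B * (1 + q * v * p) = (1 + p) * qpoch (- (q ^ Suc j)) q (Suc n)"
    proof -
      have "qpoch (- (q ^ j)) q (Suc (Suc n)) = (1 + p) * qpoch (- (q ^ Suc j)) q (Suc n)"
        by (simp only: qpoch_Suc_left[of _ _ "Suc n"]) (simp add: p_def)
      then show ?thesis unfolding b2 .
    qed
    have n1: "1 + p \<noteq> 0" "1 + q * v * p \<noteq> 0" "1 + v \<noteq> 0" "1 + q * v \<noteq> 0"
      using nz[of j] nz[of "Suc n + j"] nz[of n] nz[of "Suc n"] by (simp_all add: p_def v_def power_add mult.assoc)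
    have b4: "qpoch (- (q ^ Suc j)) q (Suc n) = B * (1 + q * v * p) / (1 + p)"
      using b3 n1 by (simp add: field_simps)
    define c where "c = q ^ (j * n + n\<^sup>2)"
    have a2: "qpoch (- q) q (Suc n) = A * (1 + q * v)" by (simp add: qpoch_Suc A_def v_def mult.commute)
    have t1: "fine_term j n = c / (A * B)" by (simp add: fine_term_def c_def A_def B_def)
    have e1: "q ^ (Suc j * n + n\<^sup>2) = c * v" by (simp add: c_def v_def power_add)
    have t2: "fine_term (Suc j) n = c * v * (1 + p) / (A * (B * (1 + q * v * p)))"
      unfolding fine_term_def e1 b4 A_def[symmetric] by simp
    have e2: "q ^ (j * Suc n + (Suc n)\<^sup>2) = c * p * (q * v * v)"
      by (simp add: c_def p_def v_def power_add power2_eq_square mult_ac)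
    have t3: "fine_term j (Suc n) = c * p * (q * v * v) / ((A * (1 + q * v)) * (B * (1 + q * v * p)))"
      unfolding fine_term_def e2 b2 a2 by simp
    have U1: "U (Suc n) = (1 + p) * (c * p * (q * v * v) / (A * (B * (1 + q * v * p))))"
    proof -
      have "U (Suc n) = (1 + p) * (1 + q * v) * fine_term j (Suc n)" by (simp add: U_def p_def v_def)
      then show ?thesis unfolding t3 using n1 by simp
    qed
    have U0: "U n = (1 + p) * (1 + v) * (c / (A * B))" by (simp add: U_def t1 p_def v_def)
    define D where "D = A * (B * (1 + q * v * p))"
    have D0: "D \<noteq> 0" using A0 B0 n1 by (simp add: D_def)
    have f: "c / (A * B) = c * (1 + q * v * p) / D" using A0 B0 n1 by (simp add: D_def)
    have "(1 + p) * (c / (A * B)) + c * v * (1 + p) / D = (1 + p) * (1 + v) * (c / (A * B)) - (1 + p) * (c * p * (q * v * v) / D)"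
      unfolding f using D0 by (simp add: field_simps)
    then show ?thesis unfolding U1 U0 t1 t2 D_def[symmetric] p_def[symmetric] .
  qed
  have "fine_term j \<longlonglongrightarrow> 0" using fine_sums sums_summable summable_LIMSEQ_zero by blast
  moreover have "(\<lambda>n. q ^ n) \<longlonglongrightarrow> 0" using q(1) by (rule LIMSEQ_power_zero)
  ultimately have "U \<longlonglongrightarrow> (1 + q ^ j) * (1 + 0) * 0"
    unfolding U_def by (intro tendsto_mult tendsto_add tendsto_const)
  then have "(\<lambda>n. U n - U (Suc n)) sums (U 0 - 0)" by (intro telescope_sums') simp
  moreover have "U 0 = 2" using nz[of j] by (simp add: U_def fine_term_def qpoch_Suc field_simps)
  ultimately have "(\<lambda>n. (1 + q ^ j) * fine_term j n + fine_term (Suc j) n) sums 2" by (simp add: key)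
  moreover have "(\<lambda>n. (1 + q ^ j) * fine_term j n + fine_term (Suc j) n) sums ((1 + q ^ j) * infsum (fine_term j) UNIV + infsum (fine_term (Suc j)) UNIV)"
    by (intro sums_add sums_mult fine_sums)
  ultimately show ?thesis using sums_unique2 by blast
qed

lemma fine_tendsto: "(\<lambda>j. infsum (fine_term j) UNIV) \<longlonglongrightarrow> 1"
proof -
  obtain B where B: "B > 0" "\<And>j n. norm (fine_term j n) \<le> B * norm q ^ (j * n + n)"
    using fine_term_bound by blast
  define h :: "nat \<Rightarrow> complex" where "h n = (if n = 0 then 1 else 0)" for n
  have "(\<lambda>j. infsum (fine_term j) UNIV) \<longlonglongrightarrow> infsum h UNIV"
  proof (rule infsum_tendsto_dominated[OF geometric_summable_on[of B]])
    show "\<forall>\<^sub>F j in sequentially. \<forall>n\<in>UNIV. norm (fine_term j n) \<le> B * norm q ^ n"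
    proof (intro always_eventually allI ballI)
      fix j n
      have "norm q ^ (j * n + n) \<le> norm q ^ n" using q by (intro power_decreasing) auto
      then show "norm (fine_term j n) \<le> B * norm q ^ n" using B(2)[of j n] B(1) by (meson mult_left_mono less_imp_le order_trans)
    qed
    have qj: "(\<lambda>j. q ^ j) \<longlonglongrightarrow> 0" using q(1) by (rule LIMSEQ_power_zero)
    show "(\<lambda>j. fine_term j n) \<longlonglongrightarrow> h n" for n
    proof (cases "n = 0")
      case True
      have "(\<lambda>j. 1 / (1 + q ^ j)) \<longlonglongrightarrow> 1 / (1 + 0)" by (intro tendsto_intros qj) simp
      then show ?thesis using True by (simp add: fine_term_def h_def qpoch_Suc)
    next
      case False
      have nq: "(\<lambda>j. norm q ^ j) \<longlonglongrightarrow> 0" using q(1) by (intro LIMSEQ_power_zero) simp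
      have "norm (fine_term j n) \<le> B * norm q ^ j" for j
      proof -
        have "norm q ^ (j * n + n) \<le> norm q ^ j" using q False by (intro power_decreasing) (auto simp: trans_le_add1)
        then show ?thesis using B(2)[of j n] B(1) by (meson mult_left_mono less_imp_le order_trans)
      qed
      moreover have "(\<lambda>j. B * norm q ^ j) \<longlonglongrightarrow> B * 0" by (intro tendsto_mult tendsto_const nq)
      ultimately have "(\<lambda>j. fine_term j n) \<longlonglongrightarrow> 0"
        by (intro Lim_null_comparison[of "\<lambda>j. fine_term j n" "\<lambda>j. B * norm q ^ j"]) auto
      then show ?thesis using False by (simp add: h_def)
    qed
  qed simp
  moreover have "infsum h UNIV = 1"
    by (rule infsumI, rule has_sum_finite_neutralI[of "{0}"]) (auto simp: h_def)
  ultimately show ?thesis by simp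
qed

lemma f3_fine: "f3 q = 2 - infsum (fine_term 1) UNIV"
proof -
  have "fine_term 0 = (\<lambda>n. q ^ (n\<^sup>2) / (qpoch (- q) q n)\<^sup>2 * (1 / 2))"
    unfolding fine_term_def[abs_def] qpoch_Suc_left by (simp add: power2_eq_square mult_ac)
  then have "infsum (fine_term 0) UNIV = f3 q * (1 / 2)"
    unfolding f3_def by (simp only: infsum_cmult_left')
  then have "2 * infsum (fine_term 0) UNIV = f3 q" by (simp add: mult.commute)
  then show ?thesis using fine_rec[of 0] by (simp add: algebra_simps)
qed

text \<open>For n = 0 the two products merge, and the sum collects q^(2k) (-q^(2k+1);q)_inf. The
  parameter n shifts only the odd exponents; varying it leads to psi_3, while the value at n = 0 is
  what the iterated recurrence for f_3 produces.\<close>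

definition even_sum :: "nat \<Rightarrow> complex" where
  "even_sum n = (\<Sum>\<^sub>\<infinity>k. (q\<^sup>2) ^ k * qpoch_inf (- (q ^ (2 * (n + k) + 1))) (q\<^sup>2) * qpoch_inf (- (q ^ (2 * k + 2))) (q\<^sup>2))"

lemma q2: "norm (q\<^sup>2) < 1" "q\<^sup>2 \<noteq> 0"
  using q by (auto simp: norm_power power_less_one_iff)

lemma neg_nonzero: "qpoch_inf (- (q ^ k)) (q\<^sup>2) \<noteq> 0"
proof (rule qpoch_inf_nonzero[OF q2(1)])
  show "(q\<^sup>2) ^ i * - (q ^ k) \<noteq> 1" for i
    using unit_q_powi_ne_1[OF q, of "-1" "int (2 * i + k)"]
    unfolding power_int_of_nat by (simp add: power_add power_mult)
qed

lemma neg_bounded: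
  obtains B where "B > 0" "\<And>m. norm (qpoch_inf (- (q ^ (2 * m + c))) (q\<^sup>2)) \<le> B"
proof -
  have "(\<lambda>m. qpoch_inf ((q\<^sup>2) ^ m * - (q ^ c)) (q\<^sup>2)) \<longlonglongrightarrow> 1"
    by (rule qpoch_inf_tendsto_1[OF q2(1) neg_nonzero])
  then have "Bseq (\<lambda>m. qpoch_inf ((q\<^sup>2) ^ m * - (q ^ c)) (q\<^sup>2))" by (intro convergent_imp_Bseq convergentI)
  moreover have "(q\<^sup>2) ^ m * - (q ^ c) = - (q ^ (2 * m + c))" for m by (simp add: power_add power_mult)
  ultimately have "Bseq (\<lambda>m. qpoch_inf (- (q ^ (2 * m + c))) (q\<^sup>2))" by simp
  then show ?thesis using that by (auto elim: BseqE)
qed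

lemma even_term_bound:
  obtains B where "B > 0"
    "\<And>n k. norm ((q\<^sup>2) ^ k * qpoch_inf (- (q ^ (2 * (n + k) + 1))) (q\<^sup>2) * qpoch_inf (- (q ^ (2 * k + 2))) (q\<^sup>2)) \<le> B * norm q ^ k"
proof -
  obtain A where A: "A > 0" "\<And>m. norm (qpoch_inf (- (q ^ (2 * m + 1))) (q\<^sup>2)) \<le> A" using neg_bounded by blast
  obtain C where C: "C > 0" "\<And>m. norm (qpoch_inf (- (q ^ (2 * m + 2))) (q\<^sup>2)) \<le> C" using neg_bounded by blast
  show ?thesis
  proof (rule that[of "A * C"])
    show "A * C > 0" using A C by simp
    fix n k
    have "norm ((q\<^sup>2) ^ k) \<le> norm q ^ k"
      unfolding norm_power power_mult[symmetric] using q by (intro power_decreasing) auto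
    then have "norm ((q\<^sup>2) ^ k) * (norm (qpoch_inf (- (q ^ (2 * (n + k) + 1))) (q\<^sup>2)) * norm (qpoch_inf (- (q ^ (2 * k + 2))) (q\<^sup>2))) \<le> norm q ^ k * (A * C)"
      using A(1) C(1) by (intro mult_mono mult_nonneg_nonneg A(2)[of "n + k"] C(2)[of k]) auto
    then show "norm ((q\<^sup>2) ^ k * qpoch_inf (- (q ^ (2 * (n + k) + 1))) (q\<^sup>2) * qpoch_inf (- (q ^ (2 * k + 2))) (q\<^sup>2)) \<le> A * C * norm q ^ k"
      by (simp add: norm_mult mult_ac)
  qed
qed

lemma even_has_sum:
  "((\<lambda>k. (q\<^sup>2) ^ k * qpoch_inf (- (q ^ (2 * (n + k) + 1))) (q\<^sup>2) * qpoch_inf (- (q ^ (2 * k + 2))) (q\<^sup>2)) has_sum even_sum n) UNIV"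
  unfolding even_sum_def
proof (rule has_sum_infsum)
  obtain B where B: "B > 0"
    "\<And>n k. norm ((q\<^sup>2) ^ k * qpoch_inf (- (q ^ (2 * (n + k) + 1))) (q\<^sup>2) * qpoch_inf (- (q ^ (2 * k + 2))) (q\<^sup>2)) \<le> B * norm q ^ k"
    using even_term_bound by blast
  have "(\<lambda>k. norm ((q\<^sup>2) ^ k * qpoch_inf (- (q ^ (2 * (n + k) + 1))) (q\<^sup>2) * qpoch_inf (- (q ^ (2 * k + 2))) (q\<^sup>2))) summable_on UNIV"
    by (intro summable_on_comparison_test[OF geometric_summable_on[of B]] B) auto
  then show "(\<lambda>k. (q\<^sup>2) ^ k * qpoch_inf (- (q ^ (2 * (n + k) + 1))) (q\<^sup>2) * qpoch_inf (- (q ^ (2 * k + 2))) (q\<^sup>2)) summable_on UNIV"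
    by (rule abs_summable_summable)
qed

lemma neg_step: "qpoch_inf (- (q ^ k)) (q\<^sup>2) = (1 + q ^ k) * qpoch_inf (- (q ^ (k + 2))) (q\<^sup>2)"
  using qpoch_inf_rec[OF q2(1), of "- (q ^ k)"] by (simp add: power_add power2_eq_square mult_ac)

text \<open>Telescoping in k with u_k = (-q^(2n+2k+1);q^2)_inf (1 + q^(2k)) (-q^(2k+2);q^2)_inf: the
  difference u_k - u_(k+1) is the k-th term at n plus q^(2n+1) times the k-th term at n + 1. The
  constants 2 and 1 come from u_0 and from the limit of u.\<close>

lemma even_rec:
  "even_sum n = 2 * qpoch_inf (- (q ^ (2 * n + 1))) (q\<^sup>2) * qpoch_inf (- (q\<^sup>2)) (q\<^sup>2) - 1 - q ^ (2 * n + 1) * even_sum (Suc n)"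
proof -
  define g where "g k = qpoch_inf (- (q ^ (2 * (n + k) + 1))) (q\<^sup>2)" for k
  define h where "h k = qpoch_inf (- (q ^ (2 * k + 2))) (q\<^sup>2)" for k
  define u where "u k = g k * ((1 + q ^ (2 * k)) * h k)" for k
  have e: "(q\<^sup>2) ^ k * - (q ^ (2 * n + 1)) = - (q ^ (2 * (n + k) + 1))" "(q\<^sup>2) ^ k * - (q\<^sup>2) = - (q ^ (2 * k + 2))" for k
    unfolding mult_minus_right power_mult[symmetric] power_add[symmetric] by (simp_all add: algebra_simps)
  have lim: "g \<longlonglongrightarrow> 1" "h \<longlonglongrightarrow> 1"
    using qpoch_inf_tendsto_1[OF q2(1) neg_nonzero, of "2 * n + 1"] qpoch_inf_tendsto_1[OF q2(1) neg_nonzero, of 2]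
    unfolding e g_def[abs_def] h_def[abs_def] .
  have "(\<lambda>k. (q\<^sup>2) ^ k) \<longlonglongrightarrow> 0" using q2(1) by (rule LIMSEQ_power_zero)
  then have ql: "(\<lambda>k. q ^ (2 * k)) \<longlonglongrightarrow> 0" by (simp add: power_mult)
  have "u \<longlonglongrightarrow> 1 * ((1 + 0) * 1)" unfolding u_def[abs_def] by (intro tendsto_mult tendsto_add tendsto_const lim ql)
  then have "(\<lambda>k. u k - u (Suc k)) sums (u 0 - 1)" by (intro telescope_sums') simp
  moreover have "u k - u (Suc k) = (q\<^sup>2) ^ k * g k * h k + q ^ (2 * n + 1) * ((q\<^sup>2) ^ k * g (Suc k) * h k)" for k
  proof -
    have g: "g k = (1 + q ^ (2 * n + 1) * q ^ (2 * k)) * g (Suc k)"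
      using neg_step[of "2 * (n + k) + 1"] by (simp add: g_def power_add algebra_simps)
    have h: "(1 + q ^ (2 * Suc k)) * h (Suc k) = h k"
      using neg_step[of "2 * k + 2"] by (simp add: h_def power_add)
    have "u (Suc k) = g (Suc k) * h k" by (simp only: u_def h)
    then have "u k - u (Suc k) = g k * ((1 + q ^ (2 * k)) * h k) - g (Suc k) * h k" by (simp add: u_def)
    then show ?thesis unfolding g by (simp add: power_mult[symmetric] algebra_simps)
  qed
  moreover have "(\<lambda>k. (q\<^sup>2) ^ k * g k * h k + q ^ (2 * n + 1) * ((q\<^sup>2) ^ k * g (Suc k) * h k)) sums (even_sum n + q ^ (2 * n + 1) * even_sum (Suc n))"
    using has_sum_imp_sums[OF even_has_sum[of n]] has_sum_imp_sums[OF even_has_sum[of "Suc n"]]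
    unfolding g_def h_def by (intro sums_add sums_mult) simp_all
  ultimately have "even_sum n + q ^ (2 * n + 1) * even_sum (Suc n) = u 0 - 1"
    using sums_unique2 by simp
  moreover have "u 0 = 2 * qpoch_inf (- (q ^ (2 * n + 1))) (q\<^sup>2) * qpoch_inf (- (q\<^sup>2)) (q\<^sup>2)"
    by (simp add: u_def g_def h_def power2_eq_square)
  ultimately show ?thesis by (simp add: algebra_simps)
qed

text \<open>The recurrence in n is iterated: the accumulated factors (-1)^n q^(n^2) tend to 0 while
  the sums stay bounded, so the remainder disappears.\<close>

lemma even_sums:
  "(\<lambda>n. (-1) ^ n * q ^ (n\<^sup>2) * (2 * qpoch_inf (- (q ^ (2 * n + 1))) (q\<^sup>2) * qpoch_inf (- (q\<^sup>2)) (q\<^sup>2) - 1)) sums even_sum 0"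
proof -
  define c :: "nat \<Rightarrow> complex" where "c n = (-1) ^ n * q ^ (n\<^sup>2)" for n
  define t where "t n = 2 * qpoch_inf (- (q ^ (2 * n + 1))) (q\<^sup>2) * qpoch_inf (- (q\<^sup>2)) (q\<^sup>2) - 1" for n
  have c: "c (Suc n) = - c n * q ^ (2 * n + 1)" for n
  proof -
    have "(Suc n)\<^sup>2 = n\<^sup>2 + (2 * n + 1)" by (simp add: power2_eq_square)
    then show ?thesis unfolding c_def by (simp only: power_add power_Suc) simp
  qed
  have part: "(\<Sum>n<N. c n * t n) = even_sum 0 - c N * even_sum N" for N
  proof (induction N)
    case 0
    then show ?case by (simp add: c_def)
  next
    case (Suc N)
    have "t N = even_sum N + q ^ (2 * N + 1) * even_sum (Suc N)"
      using even_rec[of N] by (simp add: t_def)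
    then have "(\<Sum>n<Suc N. c n * t n) = even_sum 0 - c N * even_sum N + c N * (even_sum N + q ^ (2 * N + 1) * even_sum (Suc N))"
      using Suc by simp
    then show ?case by (simp add: c algebra_simps)
  qed
  obtain B where B: "B > 0"
    "\<And>n k. norm ((q\<^sup>2) ^ k * qpoch_inf (- (q ^ (2 * (n + k) + 1))) (q\<^sup>2) * qpoch_inf (- (q ^ (2 * k + 2))) (q\<^sup>2)) \<le> B * norm q ^ k"
    using even_term_bound by blast
  define M where "M = infsum (\<lambda>k. B * norm q ^ k) (UNIV :: nat set)"
  have bd: "norm (even_sum N) \<le> M" for N
    unfolding M_def by (rule norm_infsum_le[OF even_has_sum has_sum_infsum[OF geometric_summable_on]]) (use B in auto)
  have M0: "M \<ge> 0" using bd[of 0] norm_ge_zero order_trans by blast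
  have "(\<lambda>N. M * norm q ^ N) \<longlonglongrightarrow> M * 0"
    using q(1) by (intro tendsto_mult tendsto_const LIMSEQ_power_zero) simp
  moreover have "norm (c N * even_sum N) \<le> M * norm q ^ N" for N
  proof -
    have "norm (c N) \<le> norm q ^ N"
      unfolding c_def norm_mult norm_power using q by (simp add: power_decreasing power2_eq_square)
    then have "norm (c N) * norm (even_sum N) \<le> norm q ^ N * M" using bd M0 by (intro mult_mono) auto
    then show ?thesis by (simp add: norm_mult mult.commute)
  qed
  ultimately have "(\<lambda>N. c N * even_sum N) \<longlonglongrightarrow> 0"
    by (intro Lim_null_comparison[of "\<lambda>N. c N * even_sum N" "\<lambda>N. M * norm q ^ N"]) auto
  then have "(\<lambda>N. even_sum 0 - c N * even_sum N) \<longlonglongrightarrow> even_sum 0 - 0" by (intro tendsto_diff tendsto_const)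
  then show ?thesis unfolding sums_def using part by (simp add: c_def t_def)
qed

lemma q_plus_split: "qpoch_inf (- (q ^ k)) q = qpoch_inf (- (q ^ k)) (q\<^sup>2) * qpoch_inf (- (q ^ (k + 1))) (q\<^sup>2)"
  using qpoch_inf_dissect[OF q(1), of 2 "- (q ^ k)"] by (simp add: numeral_2_eq_2)

text \<open>Two steps of \<open>fine_rec\<close> contribute the factors 1 + q^(2k+1) and 1 +
  q^(2k+2), exactly those by which the tails of (-q)_inf differ. After multiplication by these tails
  the recurrence telescopes.\<close>

lemma fine_odd_step:
  "qpoch_inf (- (q ^ (2 * k + 1))) q * infsum (fine_term (2 * k + 1)) UNIV
    = qpoch_inf (- (q ^ (2 * k + 3))) q * infsum (fine_term (2 * k + 3)) UNIV + 2 * q ^ (2 * k + 2) * qpoch_inf (- (q ^ (2 * k + 3))) q"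
proof -
  define t where "t = q ^ (2 * k + 1)"
  define P0 where "P0 = infsum (fine_term (2 * k + 1)) UNIV"
  define P1 where "P1 = infsum (fine_term (2 * k + 2)) UNIV"
  define P2 where "P2 = infsum (fine_term (2 * k + 3)) UNIV"
  have 1: "(1 + t) * P0 = 2 - P1" using fine_rec[of "2 * k + 1"] by (simp add: t_def P0_def P1_def algebra_simps)
  have 2: "(1 + q * t) * P1 = 2 - P2"
    using fine_rec[of "2 * k + 2"] by (simp add: t_def P2_def P1_def algebra_simps eval_nat_numeral)
  have "(1 + q * t) * ((1 + t) * P0) = 2 * (1 + q * t) - (1 + q * t) * P1" unfolding 1 by (simp add: algebra_simps)
  then have 3: "(1 + t) * (1 + q * t) * P0 = P2 + 2 * (q * t)" unfolding 2 by (simp add: algebra_simps)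
  have "qpoch_inf (- t) q = (1 + t) * (1 + q * t) * qpoch_inf (- (q ^ (2 * k + 3))) q"
    using qpoch_inf_rec[OF q(1), of "- t"] qpoch_inf_rec[OF q(1), of "- (q * t)"]
    by (simp add: t_def power_add eval_nat_numeral mult_ac)
  then have "qpoch_inf (- t) q * P0 = qpoch_inf (- (q ^ (2 * k + 3))) q * ((1 + t) * (1 + q * t) * P0)" by simp
  then show ?thesis unfolding 3 by (simp add: t_def P0_def P2_def algebra_simps)
qed

lemma fine_even_sum:
  "qpoch_inf (- q) q * infsum (fine_term 1) UNIV = 1 + 2 * (even_sum 0 - qpoch_inf (- q) q)"
proof -
  define p where "p k = qpoch_inf (- (q ^ (2 * k + 1))) q * infsum (fine_term (2 * k + 1)) UNIV" for k
  define t where "t k = q ^ (2 * k) * qpoch_inf (- (q ^ (2 * k + 1))) q" for k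
  have ts: "t sums even_sum 0"
    using has_sum_imp_sums[OF even_has_sum[of 0]] unfolding t_def q_plus_split
    by (simp add: power_mult[symmetric] mult.assoc)
  have "p k - p (Suc k) = 2 * t (Suc k)" for k
  proof -
    have "2 * Suc k + 1 = 2 * k + 3" "2 * Suc k = 2 * k + 2" by simp_all
    then show ?thesis using fine_odd_step[of k] unfolding p_def t_def by (simp only:) simp
  qed
  moreover have "(\<lambda>k. 2 * t (Suc k)) sums (2 * (even_sum 0 - t 0))"
    using ts by (intro sums_mult) (simp add: sums_Suc_iff)
  ultimately have 1: "(\<lambda>k. p k - p (Suc k)) sums (2 * (even_sum 0 - t 0))" by simp
  have sm: "strict_mono (\<lambda>k::nat. 2 * k + 1)" by (simp add: strict_mono_def)
  have m1: "qpoch_inf (- 1) q \<noteq> 0"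
    using qpoch_minus_nonzero(2)[OF q(1), of 0] by simp
  have "(\<lambda>n. qpoch_inf (- (q ^ n)) q) \<longlonglongrightarrow> 1"
    using qpoch_inf_tendsto_1[OF q(1) m1] by simp
  then have "p \<longlonglongrightarrow> 1 * 1"
    unfolding p_def[abs_def]
    using LIMSEQ_subseq_LIMSEQ[OF _ sm, of "\<lambda>n. qpoch_inf (- (q ^ n)) q" 1]
      LIMSEQ_subseq_LIMSEQ[OF fine_tendsto sm] by (intro tendsto_mult) (simp_all add: o_def)
  then have "(\<lambda>k. p k - p (Suc k)) sums (p 0 - 1)" by (intro telescope_sums') simp
  from sums_unique2[OF 1 this] show ?thesis by (simp add: p_def t_def algebra_simps)
qed

lemma theta4_int: "((\<lambda>n::int. (-1) powi n * q powi (n * n)) has_sum jtheta q (q\<^sup>2)) UNIV"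
  using jacobi_triple_product[OF q2 q(2)] two_tri_powi[OF q(2)] by (simp add: mult.assoc)

text \<open>The terms are even in n, so twice the series over n from 0 on is the bilateral series
  plus one extra term for n = 0.\<close>

lemma theta4_sums: "(\<lambda>n. (-1) ^ n * q ^ (n\<^sup>2)) sums ((1 + jtheta q (q\<^sup>2)) / 2)"
proof -
  define T where "T = jtheta q (q\<^sup>2)"
  define c :: "int \<Rightarrow> complex" where "c n = (-1) powi n * q powi (n * n)" for n
  define S where "S = infsum c {0..}"
  have c: "(c has_sum T) UNIV" unfolding c_def T_def by (rule theta4_int)
  have s: "c summable_on A" for A using summable_on_subset_banach[OF has_sum_imp_summable[OF c]] by blast
  have p: "(c has_sum S) {0..}" unfolding S_def by (rule has_sum_infsum[OF s])
  have m: "(c has_sum S) {..0}"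
    by (rule has_sum_reindex_bij_witness[of _ uminus uminus, THEN iffD1, OF _ _ _ _ _ _ p]) (auto simp: c_def)
  have z: "(c has_sum c 0) {0}" using has_sum_finite[of "{0}" c] by simp
  have "(c has_sum (S - c 0)) ({..0} - {0})"
    using has_sum_Diff[OF m z] by simp
  then have "(c has_sum (S - c 0 + S)) (({..0} - {0}) \<union> {0..})" by (intro has_sum_Un_disjoint p) auto
  moreover have "({..0} - {0}) \<union> {0..} = (UNIV :: int set)" by auto
  ultimately have "T = S - c 0 + S" using has_sum_unique[OF c] by simp
  then have "T = 2 * S - 1" by (simp add: c_def)
  then have S: "S = (1 + T) / 2" by simp
  have "{0..} = range int" by (auto simp: image_iff) (metis nonneg_int_cases)
  then have "((c \<circ> int) has_sum S) UNIV" using p has_sum_reindex[of int UNIV c S] by simp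
  then have "(\<lambda>n. c (int n)) sums S" using has_sum_imp_sums by (force simp: o_def)
  moreover have "c (int n) = (-1) ^ n * q ^ (n\<^sup>2)" for n
    by (simp add: c_def power_int_of_nat power2_eq_square flip: of_nat_mult)
  ultimately show ?thesis by (simp add: S T_def)
qed

text \<open>Since (-q;q^2)_inf (-q^2;q^2)_inf = (-q)_inf, the alternating series for
  \<open>even_sum 0\<close> has terms 2 (-q)_inf (-q)^(n^2)/(-q;q^2)_n minus the term of a theta
  series; n and n^2 have the same parity. As \<open>psi3\<close> starts at n = 1, the term n = 0
  appears as the summand 1.\<close>

lemma psi3_even_sum:
  "even_sum 0 = 2 * qpoch_inf (- q) q * (1 + psi3 (- q)) - (1 + jtheta q (q\<^sup>2)) / 2"
proof -
  define G where "G = qpoch_inf (- q) q"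
  define c :: "nat \<Rightarrow> complex" where "c n = (-1) ^ n * q ^ (n\<^sup>2)" for n
  have G: "qpoch_inf (- q) (q\<^sup>2) * qpoch_inf (- (q\<^sup>2)) (q\<^sup>2) = G"
    using q_plus_split[of 1] by (simp add: G_def power2_eq_square)
  have G0: "G \<noteq> 0" using qpoch_minus_nonzero(2)[OF q(1), of 1] by (simp add: G_def)
  have d: "2 * qpoch_inf (- (q ^ (2 * n + 1))) (q\<^sup>2) * qpoch_inf (- (q\<^sup>2)) (q\<^sup>2) = 2 * G / qpoch (- q) (q\<^sup>2) n" for n
  proof -
    have e: "(q\<^sup>2) ^ n * - q = - (q ^ (2 * n + 1))" by (simp add: power_mult[symmetric])
    have "qpoch_inf (- q) (q\<^sup>2) = qpoch (- q) (q\<^sup>2) n * qpoch_inf (- (q ^ (2 * n + 1))) (q\<^sup>2)"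
      using qpoch_inf_split[OF q2(1), of "- q" n] unfolding e .
    then show ?thesis using G G0 by (auto simp: field_simps)
  qed
  have "(\<lambda>n. c n * (2 * G / qpoch (- q) (q\<^sup>2) n - 1) + c n) sums (even_sum 0 + (1 + jtheta q (q\<^sup>2)) / 2)"
    using even_sums theta4_sums unfolding d c_def by (intro sums_add)
  moreover have "c n * (2 * G / qpoch (- q) (q\<^sup>2) n - 1) + c n = 2 * G * (c n / qpoch (- q) (q\<^sup>2) n)" for n
    by (simp add: algebra_simps)
  ultimately have "(\<lambda>n. 2 * G * (c n / qpoch (- q) (q\<^sup>2) n)) sums (even_sum 0 + (1 + jtheta q (q\<^sup>2)) / 2)" by simp
  from sums_divide[OF this, of "2 * G"] have s: "(\<lambda>n. c n / qpoch (- q) (q\<^sup>2) n) sums ((even_sum 0 + (1 + jtheta q (q\<^sup>2)) / 2) / (2 * G))"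
    using G0 by simp
  then have "(\<lambda>n. c (Suc n) / qpoch (- q) (q\<^sup>2) (Suc n)) sums ((even_sum 0 + (1 + jtheta q (q\<^sup>2)) / 2) / (2 * G) - 1)"
    by (subst sums_Suc_iff) (simp add: c_def)
  moreover have "c (Suc n) / qpoch (- q) (q\<^sup>2) (Suc n) = (let m = Suc n in (- q) ^ (m\<^sup>2) / qpoch (- q) ((- q)\<^sup>2) m)" for n
  proof -
    have "(- q) ^ (m\<^sup>2) = c m" for m
      by (simp add: c_def power_minus[of q "m\<^sup>2"]) (metis power2_eq_square power_mult power_minus1_even power_one uminus_power_if even_mult_iff)
    then show ?thesis by (simp add: Let_def)
  qed
  ultimately have "psi3 (- q) = (even_sum 0 + (1 + jtheta q (q\<^sup>2)) / 2) / (2 * G) - 1"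
    unfolding psi3_def using sums_unique by (metis (no_types, lifting) suminf_cong)
  then show ?thesis using G0 unfolding G_def[symmetric] by (simp add: field_simps)
qed

text \<open>Watson's relation between two third-order functions, obtained by eliminating
  \<open>even_sum 0\<close> from its two evaluations.\<close>

theorem f3_psi3: "qpoch_inf (- q) q * (f3 q + 4 * psi3 (- q)) = jtheta q (q\<^sup>2)"
proof -
  define G where "G = qpoch_inf (- q) q"
  have "G * f3 q = 2 * G - G * infsum (fine_term 1) UNIV" unfolding f3_fine by (simp add: algebra_simps)
  also have "\<dots> = 4 * G - 1 - 2 * even_sum 0" unfolding G_def fine_even_sum by (simp add: algebra_simps)
  also have "\<dots> = jtheta q (q\<^sup>2) - 4 * (G * psi3 (- q))"
    unfolding psi3_even_sum G_def[symmetric] by (simp add: algebra_simps)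
  finally show ?thesis unfolding G_def[symmetric] by (simp add: algebra_simps)
qed

end

section \<open>Laurent coefficients of \<open>1 / j(z;q)\<close>\<close>

lemma jtheta_powi_zero:
  assumes q: "norm q < 1" "q \<noteq> 0"
  shows "jtheta (q powi m) q = 0"
proof -
  have "jtheta 1 q = 0"
    using qpoch_inf_rec[OF q(1), of 1] by (simp add: jtheta_def)
  then show ?thesis using jtheta_shift[OF q, of 1 m] by simp
qed

text \<open>The Hecke-type sign in the expansion of 1/(1 - w q^n) for |q| < |w| < 1: for n from 0 on
  it runs over powers k from 0 on, and for n < 0 over negative powers with a minus sign.\<close>

definition quadrant_sign :: "int \<Rightarrow> int \<Rightarrow> complex" where
  "quadrant_sign n k = (if n \<ge> 0 \<and> k \<ge> 0 then 1 else if n < 0 \<and> k < 0 then -1 else 0)"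

lemma geometric_has_sum:
  fixes u :: complex
  assumes "norm u < 1"
  shows "((\<lambda>n. u ^ n) has_sum 1 / (1 - u)) UNIV"
proof (rule norm_summable_imp_has_sum)
  show "summable (\<lambda>n. norm (u ^ n))" using assms by (simp add: norm_power summable_geometric)
  show "(\<lambda>n. u ^ n) sums (1 / (1 - u))" using assms by (rule geometric_sums)
qed

lemma signed_geometric:
  fixes q w :: complex
  assumes q: "norm q < 1" "q \<noteq> 0" and w: "norm q < norm w" "norm w < 1"
  shows "((\<lambda>k. quadrant_sign n k * (w * q powi n) powi k) has_sum 1 / (1 - w * q powi n)) UNIV"
proof -
  define u where "u = w * q powi n"
  have w0: "w \<noteq> 0" using w q by auto
  then have u0: "u \<noteq> 0" using q by (simp add: u_def)
  have nu: "norm u = norm w * norm q powi n" by (simp add: u_def norm_mult norm_power_int)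
  have "((\<lambda>k. quadrant_sign n k * u powi k) has_sum 1 / (1 - u)) UNIV"
  proof (cases "n \<ge> 0")
    case True
    then have "norm q powi n \<le> 1" using q by (intro power_int_le_one) auto
    then have "norm u \<le> norm w" unfolding nu by (simp add: mult_left_le)
    then have "norm u < 1" using w by simp
    then have "((\<lambda>k. u powi k) has_sum 1 / (1 - u)) (range int)"
      using geometric_has_sum[of u] by (subst has_sum_reindex) (auto simp: o_def power_int_of_nat)
    then show ?thesis
    proof (rule has_sum_cong_neutral[THEN iffD1, rotated -1])
      show "quadrant_sign n x * u powi x = 0" if "x \<in> UNIV - range int" for x
      proof -
        have "x < 0" using that by (metis DiffD2 nonneg_int_cases not_le rangeI)
        then show ?thesis using True by (simp add: quadrant_sign_def)
      qed
    qed (use True in \<open>auto simp: quadrant_sign_def\<close>)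
  next
    case False
    then have "norm q powi n \<ge> norm q powi (-1)" using q by (intro power_int_decreasing) auto
    then have "norm u \<ge> norm w * norm q powi (-1)" unfolding nu by (intro mult_left_mono) auto
    moreover have "norm w * norm q powi (-1) > 1"
      using divide_strict_right_mono[OF w(1), of "norm q"] q(2)
      by (simp add: power_int_minus divide_inverse)
    ultimately have u1: "norm u > 1" by simp
    then have "((\<lambda>j. (1 / u) ^ j) has_sum 1 / (1 - 1 / u)) UNIV"
      by (intro geometric_has_sum) (simp add: norm_divide divide_less_eq)
    from has_sum_cmult_right[OF this, of "- 1 / u"]
    have "((\<lambda>j. - (u powi (- int j - 1))) has_sum (- 1 / u * (1 / (1 - 1 / u)))) UNIV"
      using u0 by (simp add: power_int_diff power_int_minus power_int_of_nat power_inverse divide_inverse mult_ac)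
    moreover have "- 1 / u * (1 / (1 - 1 / u)) = 1 / (1 - u)"
    proof -
      have "u \<noteq> 1" using u1 by auto
      then show ?thesis using u0 by (simp add: divide_simps)
    qed
    ultimately have "((\<lambda>j. - (u powi (- int j - 1))) has_sum 1 / (1 - u)) UNIV" by simp
    then have "((\<lambda>k. - (u powi k)) has_sum 1 / (1 - u)) (range (\<lambda>j. - int j - 1))"
      by (subst has_sum_reindex) (auto simp: o_def inj_on_def)
    then show ?thesis
    proof (rule has_sum_cong_neutral[THEN iffD1, rotated -1])
      show "quadrant_sign n x * u powi x = 0" if "x \<in> UNIV - range (\<lambda>j. - int j - 1)" for x
      proof -
        have "\<not> x < 0"
        proof
          assume "x < 0"
          then have "x = - int (nat (- x - 1)) - 1" by simp
          then show False using that by blast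
        qed
        then show ?thesis using False by (simp add: quadrant_sign_def)
      qed
    qed (use False in \<open>auto simp: quadrant_sign_def\<close>)
  qed
  then show ?thesis by (simp add: u_def)
qed

text \<open>Absolute convergence rests on the bound \<open>g\<close>, which depends on k alone: in
  the third quadrant n is at most -1, so |q|^(nk) is at most |q|^(-k), and |w| > |q| still gives
  geometric decay.\<close>

lemma signed_double_sum:
  fixes q w :: complex
  assumes q: "norm q < 1" "q \<noteq> 0" and w: "norm q < norm w" "norm w < 1" and c: "c summable_on (UNIV :: int set)"
  shows "((\<lambda>(n,k). c n * (quadrant_sign n k * (w * q powi n) powi k)) has_sum (\<Sum>\<^sub>\<infinity>n. c n / (1 - w * q powi n))) (UNIV \<times> UNIV)"
proof -
  have w0: "w \<noteq> 0" using w q by auto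
  define g where "g k = (if k \<ge> 0 then norm w powi k else (norm w / norm q) powi k)" for k :: int
  have g0: "g k \<ge> 0" for k by (auto simp: g_def)
  have "(\<lambda>k. complex_of_real (g k)) summable_on UNIV"
  proof (rule summable_on_two_sided[of "norm w" "norm w / norm q" _ 1 1])
    have ng: "norm (complex_of_real (g k)) = g k" for k using g0 by simp
    show "k \<ge> 0 \<Longrightarrow> norm (complex_of_real (g k)) \<le> 1 * norm w powi k"
      "k < 0 \<Longrightarrow> norm (complex_of_real (g k)) \<le> 1 * (norm w / norm q) powi k" for k
      unfolding ng by (simp_all add: g_def)
  qed (use w w0 q in auto)
  note gs = this
  have bound: "norm (quadrant_sign n k * (w * q powi n) powi k) \<le> g k" for n k
  proof -
    have e: "norm ((w * q powi n) powi k) = norm w powi k * norm q powi (n * k)"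
      by (simp add: norm_power_int norm_mult power_int_mult_distrib power_int_mult)
    consider "n \<ge> 0 \<and> k \<ge> 0" | "n < 0 \<and> k < 0" | "quadrant_sign n k = 0" unfolding quadrant_sign_def by argo
    then show ?thesis
    proof cases
      case 1
      then have "norm q powi (n * k) \<le> 1" using q by (intro power_int_le_one) auto
      then have "norm w powi k * norm q powi (n * k) \<le> norm w powi k * 1" by (intro mult_left_mono) auto
      then show ?thesis using 1 e by (simp add: quadrant_sign_def g_def)
    next
      case 2
      then have "- k \<le> n * k"
        using mult_right_mono_neg[of n "-1" k] by simp
      then have "norm q powi (n * k) \<le> norm q powi (- k)" using q by (intro power_int_decreasing) auto
      then have "norm w powi k * norm q powi (n * k) \<le> norm w powi k * norm q powi (- k)" by (intro mult_left_mono) auto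
      moreover have "g k = norm w powi k * norm q powi (- k)"
        using 2 by (simp add: g_def power_int_divide_distrib power_int_minus field_simps)
      ultimately show ?thesis using 2 e by (simp add: quadrant_sign_def)
    next
      case 3
      then show ?thesis using g0 by simp
    qed
  qed
  have "(\<lambda>(n,k). c n * complex_of_real (g k)) summable_on UNIV \<times> UNIV"
    using has_sum_product_complex[OF has_sum_infsum[OF c] has_sum_infsum[OF gs]] has_sum_imp_summable by blast
  then have "(\<lambda>(n,k). norm (c n * complex_of_real (g k))) summable_on UNIV \<times> UNIV"
    unfolding summable_on_iff_abs_summable_on_complex by (simp add: case_prod_unfold)
  then have "(\<lambda>z. norm (case z of (n,k) \<Rightarrow> c n * (quadrant_sign n k * (w * q powi n) powi k))) summable_on UNIV \<times> UNIV"
  proof (rule summable_on_comparison_test)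
    fix z :: "int \<times> int"
    obtain n k where z: "z = (n, k)" by force
    show "norm (case z of (n,k) \<Rightarrow> c n * (quadrant_sign n k * (w * q powi n) powi k)) \<le> (case z of (n,k) \<Rightarrow> norm (c n * complex_of_real (g k)))"
      using mult_left_mono[OF bound[of n k], of "norm (c n)"] g0[of k] by (simp add: z norm_mult)
  qed auto
  then have s: "(\<lambda>(n,k). c n * (quadrant_sign n k * (w * q powi n) powi k)) summable_on UNIV \<times> UNIV"
    by (rule abs_summable_summable)
  have inner: "((\<lambda>k. c n * (quadrant_sign n k * (w * q powi n) powi k)) has_sum c n / (1 - w * q powi n)) UNIV" for n
    using has_sum_cmult_right[OF signed_geometric[OF q w], of "c n" n] by simp
  have "((\<lambda>n. c n / (1 - w * q powi n)) has_sum infsum (\<lambda>(n,k). c n * (quadrant_sign n k * (w * q powi n) powi k)) (UNIV \<times> UNIV)) UNIV"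
    by (rule has_sum_SigmaD[OF has_sum_infsum[OF s]]) (use inner in auto)
  from infsumI[OF this] show ?thesis using has_sum_infsum[OF s] by simp
qed

context
  fixes q :: complex
  assumes q: "norm q < 1" "q \<noteq> 0"
begin

definition partial_theta :: "int \<Rightarrow> complex" where
  "partial_theta k = (\<Sum>\<^sub>\<infinity>n\<in>{0..}. (-1) powi n * q powi tri n * (q powi (k + 1)) powi n)"

lemma theta_summable: "(\<lambda>n. (-1) powi n * q powi tri n * (q powi m) powi n) summable_on A"
proof -
  have "(\<lambda>n. (-1) powi n * q powi tri n * (q powi m) powi n) summable_on UNIV"
    using has_sum_imp_summable[OF jacobi_triple_product[OF q, of "q powi m"]] q by simp
  then show ?thesis by (rule summable_on_subset_banach) simp
qed

text \<open>The full theta series vanishes at integral powers of q. Hence the sum over n from 0 on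
  also describes the coefficients with negative k, where the expansion only supplies n < 0 with a
  minus sign.\<close>

lemma theta_halves:
  "(\<Sum>\<^sub>\<infinity>n\<in>{0..}. (-1) powi n * q powi tri n * (q powi m) powi n)
    = - (\<Sum>\<^sub>\<infinity>n\<in>{..<0}. (-1) powi n * q powi tri n * (q powi m) powi n)"
proof -
  have "infsum (\<lambda>n. (-1) powi n * q powi tri n * (q powi m) powi n) UNIV = 0"
    using infsumI[OF jacobi_triple_product[OF q, of "q powi m"]] q by (simp add: jtheta_powi_zero[OF q])
  moreover have "UNIV = {0..} \<union> {..<0::int}" "{0..} \<inter> {..<0::int} = {}" by auto
  ultimately have "(\<Sum>\<^sub>\<infinity>n\<in>{0..}. (-1) powi n * q powi tri n * (q powi m) powi n)
    + (\<Sum>\<^sub>\<infinity>n\<in>{..<0}. (-1) powi n * q powi tri n * (q powi m) powi n) = 0"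
    using infsum_Un_disjoint[OF theta_summable theta_summable, of "{0..}" "{..<0}" m] by simp
  then show ?thesis by (simp add: add_eq_0_iff2)
qed

lemma partial_theta_rec: "partial_theta k = 1 - q powi (k + 1) * partial_theta (k + 1)"
proof -
  define c where "c k n = (-1) powi n * q powi tri n * (q powi (k + 1)) powi n" for k n :: int
  have s: "c k summable_on A" for k A unfolding c_def[abs_def] by (rule theta_summable)
  have "{0..} = {0} \<union> {1::int..}" by auto
  then have "infsum (c k) {0..} = infsum (c k) {0} + infsum (c k) {1..}"
    using infsum_Un_disjoint[of "c k" "{0}" "{1..}", OF s s] by auto
  moreover have "infsum (c k) {0} = 1" by (simp add: c_def)
  moreover have "infsum (c k) {1..} = infsum (\<lambda>n. - (q powi (k + 1)) * c (k + 1) n) {0..}"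
  proof (rule infsum_reindex_bij_witness[of _ "\<lambda>n. n + 1" "\<lambda>n. n - 1"])
    fix n :: int
    define m where "m = n - 1"
    have n: "n = m + 1" by (simp add: m_def)
    have "q powi tri (m + 1) * (q powi (k + 1)) powi (m + 1) = q powi (k + 1) * (q powi tri m * (q powi (k + 1 + 1)) powi m)"
      using q by (simp add: tri_add power_int_mult[symmetric] power_int_add[symmetric] algebra_simps)
    then show "- (q powi (k + 1)) * c (k + 1) (n - 1) = c k n"
      unfolding c_def m_def[symmetric] n by (simp add: mult_ac)
  qed auto
  ultimately have "infsum (c k) {0..} = 1 + (\<Sum>\<^sub>\<infinity>n\<in>{0..}. - (q powi (k + 1)) * c (k + 1) n)" by simp
  then show ?thesis unfolding infsum_cmult_right' by (simp add: partial_theta_def c_def[abs_def])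
qed

text \<open>The map n -> -n exchanges the half sums belonging to k and -k - 1, and the term n = 0
  accounts for the 1. This carries the symmetry z -> 1/z of the reciprocal theta function.\<close>

lemma partial_theta_reflect: "partial_theta (- k - 1) = 1 - partial_theta k"
proof -
  define c where "c k n = (-1) powi n * q powi tri n * (q powi (k + 1)) powi n" for k n :: int
  have s: "c k summable_on A" for k A unfolding c_def[abs_def] by (rule theta_summable)
  have "partial_theta (- k - 1) = - infsum (c (- k - 1)) {..<0}"
    unfolding partial_theta_def c_def[abs_def] by (rule theta_halves)
  also have "infsum (c (- k - 1)) {..<0} = infsum (c k) {1..}"
  proof (rule infsum_reindex_bij_witness[of _ uminus uminus])
    fix n :: int
    show "c k (- n) = c (- k - 1) n"
      using q by (simp add: c_def tri_minus power_int_mult[symmetric] power_int_add[symmetric] algebra_simps)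
  qed auto
  also have "infsum (c k) {0..} = infsum (c k) {0} + infsum (c k) {1..}"
  proof -
    have "{0..} = {0} \<union> {1::int..}" by auto
    then show ?thesis using infsum_Un_disjoint[of "c k" "{0}" "{1..}", OF s s] by auto
  qed
  then have "infsum (c k) {1..} = partial_theta k - 1" by (simp add: partial_theta_def c_def[abs_def])
  finally show ?thesis by simp
qed

lemma partial_theta_signed: "((\<lambda>n. quadrant_sign n k * ((-1) powi n * q powi tri n * (q powi (k + 1)) powi n)) has_sum partial_theta k) UNIV"
proof (cases "k \<ge> 0")
  case True
  have "((\<lambda>n. (-1) powi n * q powi tri n * (q powi (k + 1)) powi n) has_sum partial_theta k) {0..}"
    unfolding partial_theta_def by (rule has_sum_infsum[OF theta_summable])
  then show ?thesis
    by (rule has_sum_cong_neutral[THEN iffD1, rotated -1]) (use True in \<open>auto simp: quadrant_sign_def\<close>)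
next
  case False
  have "((\<lambda>n. - ((-1) powi n * q powi tri n * (q powi (k + 1)) powi n)) has_sum partial_theta k) {..<0}"
    unfolding partial_theta_def theta_halves by (rule has_sum_uminusI, rule has_sum_infsum[OF theta_summable])
  then show ?thesis
    by (rule has_sum_cong_neutral[THEN iffD1, rotated -1]) (use False in \<open>auto simp: quadrant_sign_def\<close>)
qed

text \<open>Each polar term of the partial fraction expansion is expanded geometrically in the
  annulus and the two summations are exchanged; the quadrant sign then cuts the theta series over n
  down to a partial one.\<close>

theorem inverse_theta_laurent:
  assumes z: "norm q < norm z" "norm z < 1"
  shows "((\<lambda>k. partial_theta k * z powi k) has_sum qpoch_inf q q ^ 3 / jtheta z q) UNIV"
proof -
  have z0: "z \<noteq> 0" using z q by auto
  define c where "c n = (-1) powi n * q powi tri n * q powi n" for n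
  have c: "c summable_on UNIV"
    using theta_summable[of 1] by (simp add: c_def[abs_def])
  have "(\<Sum>\<^sub>\<infinity>n. c n / (1 - z * q powi n)) = qpoch_inf q q ^ 3 / jtheta z q"
    unfolding c_def by (rule infsumI[OF theta_partial_fractions[OF q z0 annulus_no_pole[OF q z]]])
  then have "((\<lambda>(n,k). c n * (quadrant_sign n k * (z * q powi n) powi k)) has_sum qpoch_inf q q ^ 3 / jtheta z q) (UNIV \<times> UNIV)"
    using signed_double_sum[OF q z c] by simp
  then have sw: "((\<lambda>(k,n). c n * (quadrant_sign n k * (z * q powi n) powi k)) has_sum qpoch_inf q q ^ 3 / jtheta z q) (UNIV \<times> UNIV)"
    by (subst (asm) has_sum_swap) simp
  show ?thesis
  proof (rule has_sum_SigmaD[OF sw])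
    fix k :: int
    have "((\<lambda>n. quadrant_sign n k * ((-1) powi n * q powi tri n * (q powi (k + 1)) powi n) * z powi k) has_sum partial_theta k * z powi k) UNIV"
      by (intro has_sum_cmult_left partial_theta_signed)
    moreover have "quadrant_sign n k * ((-1) powi n * q powi tri n * (q powi (k + 1)) powi n) * z powi k = c n * (quadrant_sign n k * (z * q powi n) powi k)" for n
    proof -
      have "(q powi (k + 1)) powi n = q powi n * (q powi n) powi k"
        using q by (simp add: power_int_mult[symmetric] power_int_add[symmetric] algebra_simps)
      then show ?thesis by (simp add: c_def power_int_mult_distrib mult_ac)
    qed
    ultimately show "((\<lambda>n. case (k, n) of (k, n) \<Rightarrow> c n * (quadrant_sign n k * (z * q powi n) powi k)) has_sum partial_theta k * z powi k) UNIV"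
      by simp
  qed
qed

text \<open>Three steps at once, because at the index k - m they produce the factor q^(-3m), which
  is the one that \<open>num_coeff_shift\<close> absorbs.\<close>

lemma partial_theta_rec3: "partial_theta k = 1 - q powi (k + 1) + q powi (2 * k + 3) - q powi (3 * k + 6) * partial_theta (k + 3)"
proof -
  have e: "k + 1 + 1 = k + 2" "k + 2 + 1 = k + 3" by simp_all
  have "partial_theta k = 1 - q powi (k + 1) * (1 - q powi (k + 2) * (1 - q powi (k + 3) * partial_theta (k + 3)))"
    using partial_theta_rec[of k] partial_theta_rec[of "k + 1"] partial_theta_rec[of "k + 2"] unfolding e by simp
  also have "\<dots> = 1 - q powi (k + 1) + q powi (k + 1) * q powi (k + 2) - q powi (k + 1) * q powi (k + 2) * q powi (k + 3) * partial_theta (k + 3)"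
    by (simp add: algebra_simps)
  finally show ?thesis using q by (simp add: power_int_add[symmetric])
qed

end

section \<open>Coefficients of the character\<close>

text \<open>
  The numerator of the level \<open>2/3\<close> admissible character with \<open>l = 2 s - 1\<close>, after removing the
  fractional powers: it is \<open>\<Sum> num_coeff q s m * z\<^sup>m\<close>.
\<close>

definition num_coeff :: "complex \<Rightarrow> int \<Rightarrow> int \<Rightarrow> complex" where
  "num_coeff q s m = (if 8 dvd m then q powi (3 * (m * (m - 2 * s)) div 8)
     else if 8 dvd m - 2 * s then - (q powi (3 * (m * (m - 2 * s)) div 8)) else 0)"

text \<open>For p = 3, p' = 8 and l = 2s - 1 the exponents 6s, 24 and 48 are p(l+1), p p' and 2 p
  p'.\<close>

definition char_num :: "complex \<Rightarrow> int \<Rightarrow> complex \<Rightarrow> complex" where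
  "char_num q s z = jtheta (- (q powi (6 * s + 24) * z powi (-8))) (q ^ 48)
     - z powi (2 * s) * jtheta (- (q powi (24 - 6 * s) * z powi (-8))) (q ^ 48)"

lemma num_coeff_mult8:
  assumes "s \<in> {1,2,3}"
  shows "num_coeff q s (8 * k) = q powi (3 * (k * (8 * k - 2 * s)))"
    "num_coeff q s (2 * s + 8 * k) = - (q powi (3 * (k * (8 * k + 2 * s))))"
proof -
  have "3 * (8 * k * (8 * k - 2 * s)) = 8 * (3 * (k * (8 * k - 2 * s)))" by (simp add: algebra_simps)
  then show "num_coeff q s (8 * k) = q powi (3 * (k * (8 * k - 2 * s)))" by (simp add: num_coeff_def)
  have e: "3 * ((2 * s + 8 * k) * (2 * s + 8 * k - 2 * s)) = 8 * (3 * (k * (8 * k + 2 * s)))" by (simp add: algebra_simps)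
  have "\<not> 8 dvd 2 * s" using assms by auto
  then have "\<not> 8 dvd 2 * s + 8 * k" by (simp add: dvd_add_left_iff)
  then show "num_coeff q s (2 * s + 8 * k) = - (q powi (3 * (k * (8 * k + 2 * s))))"
    unfolding num_coeff_def e by simp
qed

lemma num_coeff_zero: "\<not> 8 dvd m \<Longrightarrow> \<not> 8 dvd m - 2 * s \<Longrightarrow> num_coeff q s m = 0"
  by (simp add: num_coeff_def)

lemma num_coeff_cases:
  fixes m s :: int
  obtains k where "m = 8 * k" | k where "m = 2 * s + 8 * k" | "\<not> 8 dvd m" "\<not> 8 dvd m - 2 * s"
proof -
  consider "8 dvd m" | "8 dvd m - 2 * s" | "\<not> 8 dvd m" "\<not> 8 dvd m - 2 * s" by blast
  then show ?thesis
  proof cases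
    case 2
    then obtain k where "m - 2 * s = 8 * k" by blast
    then have "m = 2 * s + 8 * k" by simp
    then show ?thesis by (rule that(2))
  qed (use that in blast)+
qed

text \<open>The exponent m (m - 2s) is invariant under m -> 2s - m, while the two residue classes
  modulo 8, which carry opposite signs, are exchanged.\<close>

lemma num_coeff_reflect:
  assumes "s \<in> {1,2,3}"
  shows "num_coeff q s (2 * s - m) = - num_coeff q s m"
proof (cases rule: num_coeff_cases[where m = m and s = s])
  case (1 k)
  show ?thesis using num_coeff_mult8[OF assms, of q "- k"] num_coeff_mult8(1)[OF assms, of q k] unfolding 1
    by (simp add: algebra_simps)
next
  case (2 k)
  show ?thesis using num_coeff_mult8(1)[OF assms, of q "- k"] num_coeff_mult8(2)[OF assms, of q k] unfolding 2
    by (simp add: algebra_simps)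
next
  case 3
  have "\<not> 8 dvd 2 * s - m" using 3(2) by (simp add: dvd_diff_commute)
  moreover have "\<not> 8 dvd 2 * s - m - 2 * s" using 3(1) by simp
  ultimately show ?thesis using 3 by (simp add: num_coeff_zero)
qed

text \<open>With m' = m - 2s and s' = 4 - s one has 3m(m - 2s)/8 - 3m = 3m'(m' - 2s')/8 - 6s, and
  the two residue classes modulo 8 are exchanged, which gives the sign. This is the origin of the
  reflection r -> 2 - r.\<close>

lemma num_coeff_shift:
  assumes "s \<in> {1,2,3}" "q \<noteq> 0"
  shows "num_coeff q s m * q powi (- 3 * m) = - (q powi (- 6 * s)) * num_coeff q (4 - s) (m - 2 * s)"
proof -
  have s': "4 - s \<in> {1,2,3}" using assms by auto
  show ?thesis
  proof (cases rule: num_coeff_cases[where m = m and s = s])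
    case (1 k)
    have e: "m - 2 * s = 2 * (4 - s) + 8 * (k - 1)" unfolding 1 by simp
    show ?thesis unfolding e num_coeff_mult8(2)[OF s'] unfolding 1 num_coeff_mult8(1)[OF assms(1)]
      using assms(2) by (simp add: power_int_add[symmetric] algebra_simps)
  next
    case (2 k)
    have e: "m - 2 * s = 8 * k" unfolding 2 by simp
    show ?thesis unfolding e num_coeff_mult8(1)[OF s'] unfolding 2 num_coeff_mult8(2)[OF assms(1)]
      using assms(2) by (simp add: power_int_add[symmetric] algebra_simps)
  next
    case 3
    have "m - 2 * s - 2 * (4 - s) = m - 8" by simp
    then have "\<not> 8 dvd m - 2 * s - 2 * (4 - s)" using 3(1) by (simp add: dvd_diff_left_iff)
    then show ?thesis using 3 by (simp add: num_coeff_zero)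
  qed
qed

context
  fixes q :: complex
  assumes q: "norm q < 1" "q \<noteq> 0"
begin

lemma char_num_has_sum:
  assumes s: "s \<in> {1,2,3}" and z: "z \<noteq> 0"
  shows "((\<lambda>m. num_coeff q s m * z powi m) has_sum char_num q s z) UNIV"
proof -
  have Q: "norm (q ^ 48) < 1" "q ^ 48 \<noteq> 0" using q by (auto simp: norm_power power_less_one_iff)
  have Qp: "(q ^ 48) powi k = q powi (48 * k)" for k
    by (metis of_nat_numeral power_int_mult power_int_of_nat)
  have th: "((\<lambda>k. q powi (48 * tri k + a * k) * z powi (- 8 * k)) has_sum jtheta (- (q powi a * z powi (-8))) (q ^ 48)) UNIV" for a
  proof -
    have "((\<lambda>k. (-1) powi k * (q ^ 48) powi tri k * (- (q powi a * z powi (-8))) powi k) has_sum jtheta (- (q powi a * z powi (-8))) (q ^ 48)) UNIV"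
      by (rule jacobi_triple_product[OF Q]) (use q z in auto)
    moreover have "(-1) powi k * (q ^ 48) powi tri k * (- (q powi a * z powi (-8))) powi k = q powi (48 * tri k + a * k) * z powi (- 8 * k)" for k
    proof -
      have "(- (q powi a * z powi (-8))) powi k = ((-1) * (q powi a * z powi (-8))) powi k" by simp
      also have "\<dots> = (-1) powi k * (q powi (a * k) * z powi (- 8 * k))"
        unfolding power_int_mult_distrib power_int_mult ..
      finally have "(-1) powi k * (q ^ 48) powi tri k * (- (q powi a * z powi (-8))) powi k
          = ((-1) powi k * (-1) powi k) * (q powi (48 * tri k) * q powi (a * k)) * z powi (- 8 * k)"
        unfolding Qp by (simp only: mult_ac)
      then show ?thesis unfolding m1_powi_sq using q by (simp add: power_int_add)
    qed
    ultimately show ?thesis by simp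
  qed
  have e1: "48 * tri k + (6 * s + 24) * k = 3 * (- k * (8 * - k - 2 * s))" for k
    using two_tri[of k] by (simp add: algebra_simps)
  have e2: "48 * tri k + (24 - 6 * s) * k = 3 * (- k * (8 * - k + 2 * s))" for k
    using two_tri[of k] by (simp add: algebra_simps)
  have 1: "((\<lambda>m. num_coeff q s m * z powi m) has_sum jtheta (- (q powi (6 * s + 24) * z powi (-8))) (q ^ 48)) {m. 8 dvd m}"
  proof (rule has_sum_reindex_bij_witness[of _ "\<lambda>m. - (m div 8)" "\<lambda>k. 8 * (- k)", THEN iffD1, OF _ _ _ _ _ _ th[of "6 * s + 24"]])
    show "num_coeff q s (8 * (- k)) * z powi (8 * (- k)) = q powi (48 * tri k + (6 * s + 24) * k) * z powi (- 8 * k)" for k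
      unfolding num_coeff_mult8(1)[OF s] e1 by simp
  qed auto
  have "((\<lambda>k. - (z powi (2 * s) * (q powi (48 * tri k + (24 - 6 * s) * k) * z powi (- 8 * k)))) has_sum
      - (z powi (2 * s) * jtheta (- (q powi (24 - 6 * s) * z powi (-8))) (q ^ 48))) UNIV"
    by (intro has_sum_uminusI has_sum_cmult_right th)
  then have 2: "((\<lambda>m. num_coeff q s m * z powi m) has_sum - (z powi (2 * s) * jtheta (- (q powi (24 - 6 * s) * z powi (-8))) (q ^ 48))) {m. 8 dvd m - 2 * s}"
  proof (rule has_sum_reindex_bij_witness[of _ "\<lambda>m. - ((m - 2 * s) div 8)" "\<lambda>k. 2 * s + 8 * (- k)", THEN iffD1, rotated -1])
    show "num_coeff q s (2 * s + 8 * (- k)) * z powi (2 * s + 8 * (- k)) = - (z powi (2 * s) * (q powi (48 * tri k + (24 - 6 * s) * k) * z powi (- 8 * k)))" for k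
    proof -
      have e: "z powi (2 * s + 8 * (- k)) = z powi (2 * s) * z powi (- 8 * k)"
        using z by (simp add: power_int_add[symmetric])
      show ?thesis unfolding num_coeff_mult8(2)[OF s] e2 e by simp
    qed
  qed auto
  have "{m. 8 dvd m} \<inter> {m. 8 dvd m - 2 * s} = {}"
  proof (rule ccontr)
    assume "\<not> ?thesis"
    then obtain m where "8 dvd m" "8 dvd m - 2 * s" by blast
    then have "8 dvd m - (m - 2 * s)" by (rule dvd_diff)
    then show False using s by auto
  qed
  from has_sum_Un_disjoint[OF 1 2 this]
  have "((\<lambda>m. num_coeff q s m * z powi m) has_sum char_num q s z) ({m. 8 dvd m} \<union> {m. 8 dvd m - 2 * s})"
    by (simp add: char_num_def)
  then show ?thesis
    by (rule has_sum_cong_neutral[THEN iffD1, rotated -1]) (auto simp: num_coeff_zero)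
qed

lemma char_num_1: assumes s: "s \<in> {1,2,3}" shows "char_num q s 1 = 0"
proof -
  have h: "(num_coeff q s has_sum char_num q s 1) UNIV" using char_num_has_sum[OF s, of 1] by simp
  have "((\<lambda>m. - num_coeff q s m) has_sum char_num q s 1) UNIV"
    by (rule has_sum_reindex_bij_witness[of _ "\<lambda>m. 2 * s - m" "\<lambda>m. 2 * s - m", THEN iffD1, OF _ _ _ _ _ _ h])
       (auto simp: num_coeff_reflect[OF s])
  then have "(num_coeff q s has_sum - char_num q s 1) UNIV" using has_sum_uminusI by fastforce
  then have "char_num q s 1 = - char_num q s 1" using has_sum_unique[OF h] by blast
  then show ?thesis by simp
qed

lemma char_num_inverse:
  assumes s: "s \<in> {1,2,3}" and z: "z \<noteq> 0"
  shows "char_num q s (1 / z) = - (z powi (- 2 * s)) * char_num q s z"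
proof (rule has_sum_unique)
  show "((\<lambda>m. num_coeff q s m * (1 / z) powi m) has_sum char_num q s (1 / z)) UNIV" by (rule char_num_has_sum[OF s]) (use z in auto)
  have "((\<lambda>m. - (z powi (- 2 * s)) * (num_coeff q s m * z powi m)) has_sum - (z powi (- 2 * s)) * char_num q s z) UNIV"
    by (intro has_sum_cmult_right char_num_has_sum s z)
  then show "((\<lambda>m. num_coeff q s m * (1 / z) powi m) has_sum - (z powi (- 2 * s)) * char_num q s z) UNIV"
  proof (rule has_sum_reindex_bij_witness[of _ "\<lambda>m. 2 * s - m" "\<lambda>m. 2 * s - m", THEN iffD1, rotated -1])
    fix m :: int
    have "(1 / z) powi (2 * s - m) = z powi (- 2 * s) * z powi m"
      using z by (simp add: power_int_add[symmetric] power_int_divide_distrib) (simp add: power_int_minus divide_inverse flip: power_int_minus)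
    then show "num_coeff q s (2 * s - m) * (1 / z) powi (2 * s - m) = - (z powi (- 2 * s)) * (num_coeff q s m * z powi m)"
      by (simp add: num_coeff_reflect[OF s])
  qed auto
qed

text \<open>The power q^(-2m) is q^(-3m) q^m, so the value at q^(-2) is a twisted value at q, to
  which \<open>num_coeff_shift\<close> applies.\<close>

lemma char_num_q_minus_2:
  assumes s: "s \<in> {1,2,3}"
  shows "char_num q s (q powi (-2)) = - (q powi (- 4 * s)) * char_num q (4 - s) q"
proof (rule has_sum_unique)
  have s': "4 - s \<in> {1,2,3}" using s by auto
  show "((\<lambda>m. num_coeff q s m * (q powi (-2)) powi m) has_sum char_num q s (q powi (-2))) UNIV"
    by (rule char_num_has_sum[OF s]) (use q in auto)
  have "((\<lambda>m. - (q powi (- 4 * s)) * (num_coeff q (4 - s) m * q powi m)) has_sum - (q powi (- 4 * s)) * char_num q (4 - s) q) UNIV"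
    by (intro has_sum_cmult_right char_num_has_sum s' q)
  then show "((\<lambda>m. num_coeff q s m * (q powi (-2)) powi m) has_sum - (q powi (- 4 * s)) * char_num q (4 - s) q) UNIV"
  proof (rule has_sum_reindex_bij_witness[of _ "\<lambda>m. m - 2 * s" "\<lambda>m. m + 2 * s", THEN iffD1, rotated -1])
    fix m :: int
    have "num_coeff q s (m + 2 * s) * (q powi (-2)) powi (m + 2 * s) = num_coeff q s (m + 2 * s) * q powi (- 3 * (m + 2 * s)) * q powi (m + 2 * s)"
      using q by (simp add: power_int_mult[symmetric] power_int_add[symmetric] algebra_simps)
    also have "\<dots> = - (num_coeff q (4 - s) m * (q powi (- 6 * s) * q powi (m + 2 * s)))"
      unfolding num_coeff_shift[OF s q(2)] by (simp add: mult_ac)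
    also have "q powi (- 6 * s) * q powi (m + 2 * s) = q powi (- 4 * s) * q powi m"
      using q by (simp add: power_int_add[symmetric])
    finally show "num_coeff q s (m + 2 * s) * (q powi (-2)) powi (m + 2 * s) = - (q powi (- 4 * s)) * (num_coeff q (4 - s) m * q powi m)"
      by (simp add: mult_ac)
  qed auto
qed

text \<open>Only even powers of z occur. Hence the value at the limit point -q is the one at q,
  which also governs the inhomogeneous terms of the recurrence.\<close>

lemma char_num_minus: "char_num q s (- z) = char_num q s z"
  by (simp add: char_num_def power_int_minus_left)

definition char_coeff :: "int \<Rightarrow> int \<Rightarrow> complex" where
  "char_coeff s k = (\<Sum>\<^sub>\<infinity>m. num_coeff q s m * partial_theta q (k - m))"

lemma char_coeff_laurent:
  assumes s: "s \<in> {1,2,3}" and z: "norm q < norm z" "norm z < 1"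
  shows "((\<lambda>k. char_coeff s k * z powi k) has_sum char_num q s z * (qpoch_inf q q ^ 3 / jtheta z q)) UNIV"
    and "(\<lambda>m. num_coeff q s m * partial_theta q (k - m)) summable_on UNIV"
proof -
  have z0: "z \<noteq> 0" using z q by auto
  have e: "num_coeff q s m * z powi m * (partial_theta q (k - m) * z powi (k - m)) = num_coeff q s m * partial_theta q (k - m) * z powi k" for m k
    using z0 by (simp add: power_int_diff)
  note c = has_sum_convolution[OF char_num_has_sum[OF s z0] inverse_theta_laurent[OF q z]]
  show "((\<lambda>k. char_coeff s k * z powi k) has_sum char_num q s z * (qpoch_inf q q ^ 3 / jtheta z q)) UNIV"
    using c(1) unfolding e infsum_cmult_left' char_coeff_def .
  have "(\<lambda>m. num_coeff q s m * partial_theta q (k - m) * z powi k * z powi (- k)) summable_on UNIV"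
    by (rule summable_on_cmult_left) (use c(2)[of k] in \<open>simp add: e\<close>)
  then show "(\<lambda>m. num_coeff q s m * partial_theta q (k - m)) summable_on UNIV"
    using z0 by (simp add: power_int_minus mult.assoc)
qed

lemma char_coeff_has_sum:
  assumes s: "s \<in> {1,2,3}"
  shows "((\<lambda>m. num_coeff q s m * partial_theta q (k - m)) has_sum char_coeff s k) UNIV"
proof -
  \<comment> \<open>Any point of the annulus would do, since the asserted sum does not involve z;
    |z| = sqrt |q| lies in it for every q.\<close>
  define z where "z = complex_of_real (sqrt (norm q))"
  have "norm q < sqrt (norm q)" "sqrt (norm q) < 1"
    using q by (auto intro!: real_less_rsqrt simp: power2_eq_square mult_less_cancel_right2)
  then have "norm q < norm z" "norm z < 1" by (auto simp: z_def)
  from has_sum_infsum[OF char_coeff_laurent(2)[OF s this]] show ?thesis unfolding char_coeff_def .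
qed

text \<open>Under m -> 2s - m the numerator coefficients change sign and the partial theta values
  become 1 minus their partners; the ones add up to the numerator at z = 1, which is 0. In weights
  this says that m = -1 and m = 1 have equal coefficients.\<close>

lemma char_coeff_symmetric:
  assumes s: "s \<in> {1,2,3}"
  shows "char_coeff s s = char_coeff s (s - 1)"
proof -
  have "((\<lambda>m. num_coeff q s m * 1 - num_coeff q s m * partial_theta q (m - s - 1)) has_sum char_coeff s s) UNIV"
  proof -
    have "partial_theta q (s - m) = 1 - partial_theta q (m - s - 1)" for m
      using partial_theta_reflect[OF q, of "m - s - 1"] by simp
    then show ?thesis using char_coeff_has_sum[OF s, of s] by (simp add: right_diff_distrib)
  qed
  moreover have "((\<lambda>m. num_coeff q s m * 1 - num_coeff q s m * partial_theta q (m - s - 1)) has_sum (0 - (- char_coeff s (s - 1)))) UNIV"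
  proof (intro has_sum_diff)
    show "((\<lambda>m. num_coeff q s m * 1) has_sum 0) UNIV" using char_num_has_sum[OF s, of 1] char_num_1[OF s] by simp
    have "((\<lambda>m. - (num_coeff q s m * partial_theta q (s - 1 - m))) has_sum - char_coeff s (s - 1)) UNIV"
      by (intro has_sum_uminusI char_coeff_has_sum s)
    then show "((\<lambda>m. num_coeff q s m * partial_theta q (m - s - 1)) has_sum - char_coeff s (s - 1)) UNIV"
    proof (rule has_sum_reindex_bij_witness[of _ "\<lambda>m. 2 * s - m" "\<lambda>m. 2 * s - m", THEN iffD1, rotated -1])
      show "num_coeff q s (2 * s - m) * partial_theta q (2 * s - m - s - 1) = - (num_coeff q s m * partial_theta q (s - 1 - m))" for m
        unfolding num_coeff_reflect[OF s] by (simp add: algebra_simps)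
    qed auto
  qed
  ultimately show ?thesis using has_sum_unique by fastforce
qed

text \<open>The three explicit terms of \<open>partial_theta_rec3\<close> sum to the numerator at 1,
  1/q and q^(-2). The first value is 0, the others reduce to values at q, and the remaining term is
  a coefficient of the reflected character.\<close>

lemma char_coeff_rec:
  assumes s: "s \<in> {1,2,3}"
  shows "char_coeff s k = q powi (k + 1 - 2 * s) * char_num q s q - q powi (2 * k + 3 - 4 * s) * char_num q (4 - s) q
    + q powi (3 * k + 6 - 6 * s) * char_coeff (4 - s) (k + 3 - 2 * s)"
proof -
  have s': "4 - s \<in> {1,2,3}" using s by auto
  define f where "f m = num_coeff q s m * partial_theta q (k - m)" for m
  have f: "f m = num_coeff q s m * 1 powi m - q powi (k + 1) * (num_coeff q s m * (1 / q) powi m) + q powi (2 * k + 3) * (num_coeff q s m * (q powi (-2)) powi m)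
      - (- (q powi (3 * k + 6 - 6 * s))) * (num_coeff q (4 - s) (m - 2 * s) * partial_theta q (k + 3 - m))" for m
  proof -
    have p: "q powi (k - m + 1) = q powi (k + 1) * (1 / q) powi m" "q powi (2 * (k - m) + 3) = q powi (2 * k + 3) * (q powi (-2)) powi m"
      "q powi (3 * (k - m) + 6) = q powi (3 * k + 6) * q powi (- 3 * m)"
    proof -
      have i: "(1 / q) powi m = q powi (- m)" "(q powi (-2)) powi m = q powi (- 2 * m)"
        by (simp add: power_int_minus power_int_inverse divide_inverse, simp only: power_int_mult)
      show "q powi (k - m + 1) = q powi (k + 1) * (1 / q) powi m" "q powi (2 * (k - m) + 3) = q powi (2 * k + 3) * (q powi (-2)) powi m"
        "q powi (3 * (k - m) + 6) = q powi (3 * k + 6) * q powi (- 3 * m)"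
        unfolding i using q by (simp_all add: power_int_add[symmetric] algebra_simps)
    qed
    have "f m = num_coeff q s m * (1 - q powi (k - m + 1) + q powi (2 * (k - m) + 3) - q powi (3 * (k - m) + 6) * partial_theta q (k - m + 3))"
      unfolding f_def by (subst partial_theta_rec3[OF q]) simp
    also have "\<dots> = num_coeff q s m * 1 powi m - q powi (k + 1) * (num_coeff q s m * (1 / q) powi m) + q powi (2 * k + 3) * (num_coeff q s m * (q powi (-2)) powi m)
        - q powi (3 * k + 6) * (num_coeff q s m * q powi (- 3 * m)) * partial_theta q (k + 3 - m)"
      unfolding p by (simp add: algebra_simps)
    also have "q powi (3 * k + 6) * (num_coeff q s m * q powi (- 3 * m)) = - (q powi (3 * k + 6 - 6 * s)) * num_coeff q (4 - s) (m - 2 * s)"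
      unfolding num_coeff_shift[OF s q(2)] using q by (simp add: power_int_diff power_int_minus divide_inverse power_int_add)
    finally show ?thesis by (simp only: mult.assoc)
  qed
  have 4: "((\<lambda>m. num_coeff q (4 - s) (m - 2 * s) * partial_theta q (k + 3 - m)) has_sum char_coeff (4 - s) (k + 3 - 2 * s)) UNIV"
    by (rule has_sum_reindex_bij_witness[of _ "\<lambda>m. m - 2 * s" "\<lambda>m. m + 2 * s", THEN iffD1, OF _ _ _ _ _ _ char_coeff_has_sum[OF s', of "k + 3 - 2 * s"]])
       (auto simp: algebra_simps)
  have "(f has_sum (char_num q s 1 - q powi (k + 1) * char_num q s (1 / q) + q powi (2 * k + 3) * char_num q s (q powi (-2))
      - (- (q powi (3 * k + 6 - 6 * s))) * char_coeff (4 - s) (k + 3 - 2 * s))) UNIV"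
    unfolding f[abs_def] by (intro has_sum_diff has_sum_add has_sum_cmult_right char_num_has_sum s 4) (use q in auto)
  then have "char_coeff s k = char_num q s 1 - q powi (k + 1) * char_num q s (1 / q) + q powi (2 * k + 3) * char_num q s (q powi (-2))
      - (- (q powi (3 * k + 6 - 6 * s))) * char_coeff (4 - s) (k + 3 - 2 * s)"
    using has_sum_unique[OF char_coeff_has_sum[OF s, of k]] unfolding f_def[abs_def] by blast
  then show ?thesis
    unfolding char_num_1[OF s] char_num_inverse[OF s q(2)] char_num_q_minus_2[OF s]
    using q by (simp add: power_int_add[symmetric] mult.assoc[symmetric])
qed

text \<open>The index is normalised so that k belongs to the weight m = 1 - 2k, independently of s;
  thus k = 0 is the coefficient of the theorem and k = 1 is m = -1.\<close>

definition string_coeff :: "int \<Rightarrow> int \<Rightarrow> complex" where "string_coeff s k = char_coeff s (k + s - 1)"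

text \<open>Up to a factor q, the residue at z = q of z^(1-s) \<open>char_num q s z\<close>
  (q)_inf^3/j(z;q), the generating function of \<open>string_coeff q s\<close>.\<close>

definition section_residue :: "int \<Rightarrow> complex" where "section_residue s = q powi (1 - s) * char_num q s q"

lemma string_coeff_rec:
  assumes s: "s \<in> {1,2,3}"
  shows "string_coeff s k = q powi (k - 1) * section_residue s - q powi (2 * k + 4 - 3 * s) * section_residue (4 - s) + q powi (3 * k + 3 - 3 * s) * string_coeff (4 - s) (k - 1)"
proof -
  have e: "k + s - 1 + 3 - 2 * s = k - 1 + (4 - s) - 1" by simp
  show ?thesis
    unfolding string_coeff_def section_residue_def char_coeff_rec[OF s, of "k + s - 1"] e mult.assoc[symmetric] power_int_add[OF disjI1[OF q(2)], symmetric]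
    by (simp add: algebra_simps)
qed

lemma string_coeff_0_1: assumes s: "s \<in> {1,2,3}" shows "string_coeff s 1 = string_coeff s 0"
  using char_coeff_symmetric[OF s] by (simp add: string_coeff_def)

end

section \<open>Solutions of a \<open>q\<close>-difference equation\<close>

text \<open>Serves as a dominating term for positive and negative exponents alike when |z| varies in
  a closed annulus.\<close>

lemma powi_le_add:
  fixes a b x :: real
  assumes "0 < a" "a \<le> x" "x \<le> b"
  shows "x powi k \<le> a powi k + b powi k"
proof (cases "k \<ge> 0")
  case True
  then have "x powi k \<le> b powi k" using assms by (intro power_int_mono) auto
  then show ?thesis using assms by (smt (verit) zero_le_power_int)
next
  case False
  then have "a powi (- k) \<le> x powi (- k)" using assms by (intro power_int_mono) auto
  then have "inverse (x powi (- k)) \<le> inverse (a powi (- k))"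
    using assms by (intro le_imp_inverse_le) auto
  then have "x powi k \<le> a powi k" by (simp add: power_int_minus)
  then show ?thesis using assms by (smt (verit) zero_le_power_int)
qed

lemma jtheta_isCont:
  assumes q: "norm q < 1" "q \<noteq> 0" and z: "z0 \<noteq> 0"
  shows "isCont (\<lambda>z. jtheta z q) z0"
  unfolding isCont_def
proof -
  define t where "t z k = (-1) powi k * q powi tri k * z powi k" for z k
  define a where "a = norm z0 / 2"
  define b where "b = 2 * norm z0"
  have ab: "a > 0" "b > 0" using z by (auto simp: a_def b_def)
  have ev: "\<forall>\<^sub>F z in at z0. a \<le> norm z \<and> norm z \<le> b"
  proof -
    have "\<forall>\<^sub>F z in at z0. dist z z0 < a" using ab(1) eventually_at by blast
    then show ?thesis
    proof eventually_elim
      case (elim z)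
      have "norm z0 \<le> norm z + dist z z0" "norm z \<le> norm z0 + dist z z0"
        using norm_triangle_sub[of z0 z] norm_triangle_sub[of z z0] by (simp_all add: dist_norm norm_minus_commute)
      then show ?case using elim by (simp add: a_def b_def)
    qed
  qed
  have J: "infsum (t z) UNIV = jtheta z q" if "z \<noteq> 0" for z
    unfolding t_def[abs_def] by (rule infsumI[OF jacobi_triple_product[OF q that]])
  have "((\<lambda>z. infsum (t z) UNIV) \<longlongrightarrow> infsum (t z0) UNIV) (at z0)"
  proof (rule infsum_tendsto_dominated)
    show "(\<lambda>k. norm q powi tri k * a powi k + norm q powi tri k * b powi k) summable_on UNIV"
      by (intro summable_on_add summable_gauss_real) (use q ab in auto)
    show "\<forall>\<^sub>F z in at z0. \<forall>k\<in>UNIV. norm (t z k) \<le> norm q powi tri k * a powi k + norm q powi tri k * b powi k"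
      using ev
    proof eventually_elim
      case (elim z)
      show ?case
      proof
        fix k :: int
        have "norm q powi tri k * norm z powi k \<le> norm q powi tri k * (a powi k + b powi k)"
          using elim ab by (intro mult_left_mono powi_le_add) auto
        then show "norm (t z k) \<le> norm q powi tri k * a powi k + norm q powi tri k * b powi k"
          by (simp add: t_def norm_mult norm_power_int distrib_left)
      qed
    qed
    show "((\<lambda>z. t z k) \<longlongrightarrow> t z0 k) (at z0)" for k
      unfolding t_def by (intro tendsto_intros z)
  qed simp
  moreover have "\<forall>\<^sub>F z in at z0. infsum (t z) UNIV = jtheta z q"
    using ev
  proof eventually_elim
    case (elim z)
    then have "z \<noteq> 0" using ab by auto
    then show ?case by (rule J)
  qed
  ultimately show "(\<lambda>z. jtheta z q) \<midarrow>z0\<rightarrow> jtheta z0 q"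
    unfolding J[OF z] by (rule Lim_transform_eventually)
qed

section \<open>Particular solutions of the recurrence as polar bilateral sums\<close>

definition section_sum :: "complex \<Rightarrow> complex \<Rightarrow> complex \<Rightarrow> complex" where
  "section_sum Q y z = (\<Sum>\<^sub>\<infinity>n. Q powi tri n * z powi n / (1 - y * z * Q powi n))"

text \<open>The contribution of n to the coefficient of z^m in \<open>section_sum Q y z\<close>. The
  index n is shifted by one because the pole is expanded in y Q z, which is assumed to lie between
  |Q| and 1 in absolute value, whereas y z then does not.\<close>

definition section_term :: "complex \<Rightarrow> complex \<Rightarrow> int \<Rightarrow> int \<Rightarrow> complex" where
  "section_term Q y m n = quadrant_sign n (m - 1 - n) * (Q powi tri (n + 1) * (y * Q) powi (m - 1 - n) * Q powi (n * (m - 1 - n)))"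

lemma section_term_summable: "section_term Q y m summable_on UNIV"
proof (rule finite_nonzero_values_imp_summable_on)
  have "{n \<in> UNIV. section_term Q y m n \<noteq> 0} \<subseteq> {- \<bar>m\<bar>..\<bar>m\<bar>}"
    by (auto simp: section_term_def quadrant_sign_def split: if_splits)
  then show "finite {n \<in> UNIV. section_term Q y m n \<noteq> 0}" by (rule finite_subset) simp
qed

lemma section_term_0: "infsum (section_term Q y 0) UNIV = 0"
proof -
  have "section_term Q y 0 = (\<lambda>_. 0)" by (auto simp: section_term_def quadrant_sign_def)
  then show ?thesis by simp
qed

text \<open>With Q = q^3, the choices y = 1/q and y = 1/q^2 make the inhomogeneous term (y Q)^(m-1)
  equal to q^(2m-2) and q^(m-1), the two that occur in the recurrence of the string
  coefficients.\<close>

lemma section_term_rec: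
  assumes "Q \<noteq> 0"
  shows "infsum (section_term Q y m) UNIV = Q powi (m - 1) * infsum (section_term Q y (m - 1)) UNIV + (y * Q) powi (m - 1)"
proof -
  have "section_term Q y m n = Q powi (m - 1) * section_term Q y (m - 1) (n - 1) + (if n = 0 then (y * Q) powi (m - 1) else 0)" for n
  proof -
    define l where "l = m - 1 - n"
    have e: "m - 1 - 1 - (n - 1) = l" "n - 1 + 1 = n" by (simp_all add: l_def)
    have "Q powi (m - 1) * (Q powi tri n * (y * Q) powi l * Q powi ((n - 1) * l)) = (Q powi (m - 1) * Q powi tri n * Q powi ((n - 1) * l)) * (y * Q) powi l"
      by (simp only: mult_ac)
    also have "Q powi (m - 1) * Q powi tri n * Q powi ((n - 1) * l) = Q powi tri (n + 1) * Q powi (n * l)"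
      using assms by (simp add: tri_add power_int_add[symmetric] l_def algebra_simps)
    finally have "Q powi (m - 1) * section_term Q y (m - 1) (n - 1) = quadrant_sign (n - 1) l * (Q powi tri (n + 1) * (y * Q) powi l * Q powi (n * l))"
      unfolding section_term_def e by (auto simp: mult_ac)
    \<comment> \<open>The sign changes only between n = -1 and n = 0, by 1 for either sign of l;
      this jump creates the inhomogeneous term.\<close>
    moreover have "quadrant_sign n l = quadrant_sign (n - 1) l + (if n = 0 then 1 else 0)"
      by (auto simp: quadrant_sign_def)
    ultimately show ?thesis unfolding section_term_def[of Q y m n] l_def[symmetric] by (auto simp: algebra_simps l_def)
  qed
  note e = this
  have h: "(section_term Q y m has_sum infsum (section_term Q y m) UNIV) UNIV" for m by (rule has_sum_infsum[OF section_term_summable])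
  have 1: "((\<lambda>n. section_term Q y (m - 1) (n - 1)) has_sum infsum (section_term Q y (m - 1)) UNIV) UNIV"
    by (rule has_sum_reindex_bij_witness[of _ "\<lambda>n. n - 1" "\<lambda>n. n + 1", THEN iffD1, OF _ _ _ _ _ _ h]) auto
  have 2: "((\<lambda>n::int. if n = 0 then (y * Q) powi (m - 1) else 0) has_sum (y * Q) powi (m - 1)) UNIV"
    by (rule has_sum_finite_neutralI[of "{0}"]) auto
  have "((\<lambda>n. Q powi (m - 1) * section_term Q y (m - 1) (n - 1) + (if n = 0 then (y * Q) powi (m - 1) else 0)) has_sum
     (Q powi (m - 1) * infsum (section_term Q y (m - 1)) UNIV + (y * Q) powi (m - 1))) UNIV"
    by (intro has_sum_add has_sum_cmult_right 1 2)
  then show ?thesis unfolding e[symmetric] by (rule infsumI)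
qed

lemma section_sum_laurent:
  assumes Q: "norm Q < 1" "Q \<noteq> 0" and y: "y \<noteq> 0" and w: "norm Q < norm (y * Q * z)" "norm (y * Q * z) < 1"
  shows "((\<lambda>m. infsum (section_term Q y m) UNIV * z powi m) has_sum section_sum Q y z) UNIV"
proof -
  have z0: "z \<noteq> 0" using w Q by auto
  define c where "c n = Q powi tri (n + 1) * z powi (n + 1)" for n
  have c: "c summable_on UNIV"
  proof -
    have "(\<lambda>n. 1 * (Q powi tri n * (Q * z) powi n)) summable_on UNIV"
      by (rule summable_gauss[OF Q, where C = 1]) (use Q z0 in auto)
    then have "(\<lambda>n. (1 * (Q powi tri n * (Q * z) powi n)) * z) summable_on UNIV"
      by (rule summable_on_cmult_left)
    moreover have "c n = (1 * (Q powi tri n * (Q * z) powi n)) * z" for n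
      using Q z0 by (simp add: c_def tri_Suc power_int_add power_int_mult_distrib)
    ultimately show ?thesis by (simp add: c_def[abs_def])
  qed
  have "(\<Sum>\<^sub>\<infinity>n. c n / (1 - y * Q * z * Q powi n)) = section_sum Q y z"
    unfolding section_sum_def
  proof (rule infsum_reindex_bij_witness[of _ "\<lambda>n. n - 1" "\<lambda>n. n + 1"])
    show "Q powi tri (n + 1) * z powi (n + 1) / (1 - y * z * Q powi (n + 1)) = c n / (1 - y * Q * z * Q powi n)" for n
      using Q by (simp add: c_def power_int_add mult_ac)
  qed auto
  then have D: "((\<lambda>(n,k). c n * (quadrant_sign n k * (y * Q * z * Q powi n) powi k)) has_sum section_sum Q y z) (UNIV \<times> UNIV)"
    using signed_double_sum[OF Q w c] by simp
  have "((\<lambda>(m,n). section_term Q y m n * z powi m) has_sum section_sum Q y z) (UNIV \<times> UNIV)"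
  proof (rule has_sum_reindex_bij_witness[of _ "\<lambda>(m,n). (n, m - 1 - n)" "\<lambda>(n,k). (n + k + 1, n)", THEN iffD1, OF _ _ _ _ _ _ D])
    fix a :: "int \<times> int"
    obtain n k where a: "a = (n, k)" by force
    have e: "n + k + 1 - 1 - n = k" by simp
    have "z powi (n + k + 1) = z powi (n + 1) * z powi k" using z0 by (simp add: power_int_add mult_ac)
    then show "(case case a of (n, k) \<Rightarrow> (n + k + 1, n) of (m, n) \<Rightarrow> section_term Q y m n * z powi m) = (case a of (n, k) \<Rightarrow> c n * (quadrant_sign n k * (y * Q * z * Q powi n) powi k))"
      unfolding a prod.case section_term_def e c_def by (simp add: power_int_mult_distrib power_int_mult[symmetric] mult_ac)
  qed auto
  then show ?thesis
  proof (rule has_sum_SigmaD)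
    show "((\<lambda>n. case (m, n) of (m, n) \<Rightarrow> section_term Q y m n * z powi m) has_sum infsum (section_term Q y m) UNIV * z powi m) UNIV" for m
      unfolding prod.case by (intro has_sum_cmult_left has_sum_infsum section_term_summable)
  qed
qed

lemma first_order_recurrence_zero:
  fixes d :: "int \<Rightarrow> complex"
  assumes "Q \<noteq> 0" "d 0 = 0" "\<And>k. d k = Q powi (k - 1) * d (k - 1)"
  shows "d k = 0"
proof (induction k rule: int_induct[where k = 0])
  case base
  show ?case by (rule assms(2))
next
  case (step1 i)
  then show ?case using assms(3)[of "i + 1"] by simp
next
  case (step2 i)
  then show ?case using assms(3)[of i] assms(1) by simp
qed

context
  fixes q Q :: complex
  assumes q: "norm q < 1" "q \<noteq> 0" and Q: "Q = q ^ 3"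
begin

text \<open>The multiples of Q^(\<open>tri k\<close>) solve the homogeneous equation, and the two
  families of section coefficients supply a particular solution that vanishes at k = 0. A
  first-order recurrence is determined by its value at 0, in both directions.\<close>

lemma section_coeffs:
  fixes h :: "int \<Rightarrow> complex"
  assumes h: "\<And>k. h k = q powi (3 * k - 3) * h (k - 1) + (q powi (k - 1) - q powi (2 * k - 2)) * \<rho>"
  shows "h k = h 0 * Q powi tri k - \<rho> * (infsum (section_term Q (1 / q) k) UNIV - infsum (section_term Q (1 / q\<^sup>2) k) UNIV)"
proof -
  have Q0: "Q \<noteq> 0" using q by (simp add: Q)
  define d where "d k = h k - (h 0 * Q powi tri k - \<rho> * (infsum (section_term Q (1 / q) k) UNIV - infsum (section_term Q (1 / q\<^sup>2) k) UNIV))" for k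
  have "d k = 0" for k
  proof (rule first_order_recurrence_zero[OF Q0])
    show "d 0 = 0" by (simp add: d_def section_term_0)
    fix k :: int
    have y: "1 / q * Q = q\<^sup>2" "1 / q\<^sup>2 * Q = q" using q by (simp_all add: Q power2_eq_square power3_eq_cube)
    have p: "(q\<^sup>2) powi (k - 1) = q powi (2 * k - 2)" "q powi (3 * k - 3) = Q powi (k - 1)"
      by (simp_all add: power2_powi Q power3_powi algebra_simps)
    have t: "Q powi tri k = Q powi (k - 1) * Q powi tri (k - 1)"
      using Q0 tri_Suc[of "k - 1"] by (simp add: power_int_add)
    have "d k = Q powi (k - 1) * h (k - 1) + (q powi (k - 1) - q powi (2 * k - 2)) * \<rho> - (h 0 * (Q powi (k - 1) * Q powi tri (k - 1))
        - \<rho> * ((Q powi (k - 1) * infsum (section_term Q (1 / q) (k - 1)) UNIV + q powi (2 * k - 2)) - (Q powi (k - 1) * infsum (section_term Q (1 / q\<^sup>2) (k - 1)) UNIV + q powi (k - 1))))"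
      unfolding d_def t
      by (subst h, subst section_term_rec[OF Q0, of _ k], subst section_term_rec[OF Q0, of _ k]) (simp only: y p)
    also have "\<dots> = Q powi (k - 1) * d (k - 1)"
    proof -
      have "P * H + (a - b) * r - (g * (P * T) - r * ((P * X + b) - (P * Y + a))) = P * (H - (g * T - r * (X - Y)))"
        for P H a b r g T X Y :: complex by (simp add: algebra_simps)
      then show ?thesis unfolding d_def .
    qed
    finally show "d k = Q powi (k - 1) * d (k - 1)" .
  qed
  from this[of k] show ?thesis unfolding d_def right_minus_eq .
qed

lemma section_has_sum:
  fixes h :: "int \<Rightarrow> complex"
  assumes h: "\<And>k. h k = q powi (3 * k - 3) * h (k - 1) + (q powi (k - 1) - q powi (2 * k - 2)) * \<rho>"
    and z: "norm q < norm z" "norm z < 1"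
  shows "((\<lambda>k. h k * z powi k) has_sum (h 0 * jtheta (- z) Q - \<rho> * (section_sum Q (1 / q) z - section_sum Q (1 / q\<^sup>2) z))) UNIV"
proof -
  note Qb = Q_bounds[OF q Q]
  have z0: "z \<noteq> 0" using z q by auto
  have y: "1 / q * Q * z = q\<^sup>2 * z" "1 / q\<^sup>2 * Q * z = q * z" using q by (simp_all add: Q power2_eq_square power3_eq_cube)
  have qz: "norm q * norm q < norm q * norm z" "norm q * norm z < norm q" using z q by auto
  have q2: "norm q ^ 2 < 1" using q by (simp add: power_less_one_iff)
  have w1: "norm Q < norm (1 / q * Q * z)" "norm (1 / q * Q * z) < 1"
  proof -
    have "norm q ^ 2 * norm q < norm q ^ 2 * norm z" using z q by (intro mult_strict_left_mono) auto
    then show "norm Q < norm (1 / q * Q * z)" unfolding y by (simp add: Q norm_mult norm_power power3_eq_cube power2_eq_square)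
    have "norm q ^ 2 * norm z < 1 * 1" using z q q2 by (intro mult_strict_mono) auto
    then show "norm (1 / q * Q * z) < 1" unfolding y by (simp add: norm_mult norm_power)
  qed
  have w2: "norm Q < norm (1 / q\<^sup>2 * Q * z)" "norm (1 / q\<^sup>2 * Q * z) < 1"
  proof -
    have "norm q ^ 2 * norm q < 1 * (norm q * norm q)"
      using q by (simp add: power2_eq_square mult.assoc)
    then show "norm Q < norm (1 / q\<^sup>2 * Q * z)" unfolding y using qz by (simp add: Q norm_mult norm_power power3_eq_cube power2_eq_square)
    show "norm (1 / q\<^sup>2 * Q * z) < 1" unfolding y norm_mult using qz(2) q(1) by linarith
  qed
  have "((\<lambda>k. (-1) powi k * Q powi tri k * (- z) powi k) has_sum jtheta (- z) Q) UNIV"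
    by (rule jacobi_triple_product[OF Qb]) (use z0 in auto)
  moreover have "(-1) powi k * Q powi tri k * (- z) powi k = Q powi tri k * z powi k" for k
  proof -
    have "(- z) powi k = (-1) powi k * z powi k" using power_int_mult_distrib[of "-1" z k] by simp
    then have "(-1) powi k * Q powi tri k * (- z) powi k = ((-1) powi k * (-1) powi k) * (Q powi tri k * z powi k)"
      by (simp only: mult_ac)
    then show ?thesis unfolding m1_powi_sq by simp
  qed
  ultimately have th: "((\<lambda>k. Q powi tri k * z powi k) has_sum jtheta (- z) Q) UNIV" by simp
  have "((\<lambda>k. h 0 * (Q powi tri k * z powi k) - \<rho> * (infsum (section_term Q (1 / q) k) UNIV * z powi k - infsum (section_term Q (1 / q\<^sup>2) k) UNIV * z powi k)) has_sum
      (h 0 * jtheta (- z) Q - \<rho> * (section_sum Q (1 / q) z - section_sum Q (1 / q\<^sup>2) z))) UNIV"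
    by (intro has_sum_diff has_sum_cmult_right th section_sum_laurent Qb w1 w2) (use q in auto)
  moreover have "h 0 * (Q powi tri k * z powi k) - \<rho> * (infsum (section_term Q (1 / q) k) UNIV * z powi k - infsum (section_term Q (1 / q\<^sup>2) k) UNIV * z powi k) = h k * z powi k" for k
    by (subst (2) section_coeffs[OF h]) (simp add: algebra_simps)
  ultimately show ?thesis by simp
qed

text \<open>The upper bound for t is the midpoint of 1 and 1/|q|. For such t the number t |q|^j
  stays away from 1 whenever j is nonzero, and for j = 0 the value 1 + t is at least 1; this gives a
  lower bound uniform in j.\<close>

lemma one_plus_bound:
  fixes t :: real and j :: int
  assumes t: "1 \<le> t" "t \<le> (1 + norm q) / (2 * norm q)"
  shows "norm (1 + of_real t * q powi j) \<ge> (1 - norm q) / 2"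
proof -
  have nq: "0 < norm q" using q by simp
  consider "j = 0" | "j \<ge> 1" | "j \<le> -1" by linarith
  then show ?thesis
  proof cases
    case 1
    have "norm (1 + complex_of_real t) = 1 + t"
      using t by (metis norm_of_real abs_of_nonneg add_nonneg_nonneg of_real_1 of_real_add zero_le_one order_trans)
    moreover have "(1 - norm q) / 2 \<le> 1 + t"
    proof -
      have "(1 - x) / 2 \<le> 1" if "x \<ge> 0" for x :: real using that by simp
      from this[OF norm_ge_zero] have "(1 - norm q) / 2 \<le> 1" .
      also have "1 \<le> 1 + t" using t(1) by simp
      finally show ?thesis .
    qed
    ultimately show ?thesis using 1 by simp
  next
    case 2
    then have "norm q powi j \<le> norm q powi 1" using q by (intro power_int_decreasing) auto
    then have "t * norm q powi j \<le> (1 + norm q) / (2 * norm q) * norm q" using t by (intro mult_mono) auto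
    then have "norm (of_real t * q powi j) \<le> (1 + norm q) / 2" using t nq by (simp add: norm_mult norm_power_int)
    moreover have "norm (1 + of_real t * q powi j) \<ge> 1 - norm (of_real t * q powi j)"
      using norm_diff_ineq[of 1 "of_real t * q powi j"] by simp
    moreover have "1 - (1 + norm q) / 2 = (1 - norm q) / 2" by (simp add: field_simps)
    ultimately show ?thesis by linarith
  next
    case 3
    then have "norm q powi j \<ge> norm q powi (-1)" using q by (intro power_int_decreasing) auto
    then have "1 * norm q powi (-1) \<le> t * norm q powi j" using t(1) by (intro mult_mono) auto
    moreover have "norm (of_real t * q powi j) = t * norm q powi j"
      using t(1) by (simp add: norm_mult norm_power_int)
    ultimately have a: "1 / norm q \<le> norm (of_real t * q powi j)"
      by (simp only: mult_1 power_int_minus power_int_1_right inverse_eq_divide)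
    have "1 / norm q - 1 \<ge> 1 - norm q"
    proof -
      have "(1 - norm q) * norm q \<le> (1 - norm q) * 1" using q by (intro mult_left_mono) auto
      then have "1 - norm q \<le> (1 - norm q) / norm q" using nq by (simp add: pos_le_divide_eq)
      then show ?thesis using nq by (simp add: diff_divide_distrib)
    qed
    moreover have "norm (1 + of_real t * q powi j) \<ge> norm (of_real t * q powi j) - 1"
      using norm_diff_ineq[of "of_real t * q powi j" 1] by (simp add: add.commute)
    ultimately have "norm (1 + of_real t * q powi j) \<ge> 1 - norm q" using a by linarith
    moreover have "(1 - norm q) / 2 \<le> 1 - norm q" using q(1) by simp
    ultimately show ?thesis by linarith
  qed
qed

text \<open>The condition y q = q^i makes every denominator 1 + t q^(i+3n), so
  \<open>one_plus_bound\<close> yields the domination. The cases needed are i = 0 and i =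
  -1.\<close>

lemma section_sum_tendsto:
  assumes y: "y * q = q powi i"
  shows "((\<lambda>t. section_sum Q y (- (q * of_real t))) \<longlongrightarrow> section_sum Q y (- q)) (at_right 1)"
  unfolding section_sum_def
proof (rule infsum_tendsto_dominated)
  note Qb = Q_bounds[OF q Q]
  define D where "D = (1 - norm q) / 2"
  have D: "D > 0" using q by (simp add: D_def)
  define T where "T = (1 + norm q) / (2 * norm q)"
  have T: "T > 1" using q by (simp add: T_def field_simps)
  have den: "1 - y * - (q * of_real t) * Q powi n = 1 + of_real t * q powi (i + 3 * n)" for n t
  proof -
    have "1 - y * - (q * of_real t) * Q powi n = 1 + of_real t * ((y * q) * q powi (3 * n))"
      by (simp add: Q power3_powi mult_ac)
    then show ?thesis unfolding y using q by (simp add: power_int_add)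
  qed
  show "(\<lambda>n. (norm Q powi tri n * norm q powi n + norm Q powi tri n * (T * norm q) powi n) * (1 / D)) summable_on UNIV"
    by (intro summable_on_cmult_left summable_on_add summable_gauss_real) (use Qb q T in auto)
  have "\<forall>\<^sub>F t in at_right 1. t \<in> {1<..<T}" by (rule eventually_at_right_real[OF T])
  then show "\<forall>\<^sub>F t in at_right 1. \<forall>n\<in>UNIV. norm (Q powi tri n * (- (q * complex_of_real t)) powi n / (1 - y * - (q * of_real t) * Q powi n))
      \<le> (norm Q powi tri n * norm q powi n + norm Q powi tri n * (T * norm q) powi n) * (1 / D)"
  proof eventually_elim
    case (elim t)
    show ?case
    proof
      fix n :: int
      have "(t * norm q) powi n \<le> norm q powi n + (T * norm q) powi n"
        using elim q by (intro powi_le_add) auto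
      then have 1: "norm Q powi tri n * (t * norm q) powi n \<le> norm Q powi tri n * norm q powi n + norm Q powi tri n * (T * norm q) powi n"
        by (simp add: distrib_left[symmetric] mult_left_mono)
      have "norm (1 + of_real t * q powi (i + 3 * n)) \<ge> D"
        unfolding D_def by (rule one_plus_bound) (use elim in \<open>auto simp: T_def\<close>)
      then have 2: "1 / norm (1 + of_real t * q powi (i + 3 * n)) \<le> 1 / D" using D by (intro divide_left_mono) (auto intro: mult_pos_pos less_le_trans)
      have "norm (Q powi tri n * (- (q * complex_of_real t)) powi n / (1 - y * - (q * of_real t) * Q powi n))
         = (norm Q powi tri n * (t * norm q) powi n) * (1 / norm (1 + of_real t * q powi (i + 3 * n)))"
        unfolding den using elim by (simp add: norm_divide norm_mult norm_power_int mult.commute)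
      also have "\<dots> \<le> (norm Q powi tri n * norm q powi n + norm Q powi tri n * (T * norm q) powi n) * (1 / D)"
        using elim by (intro mult_mono 1 2) (auto intro!: add_nonneg_nonneg mult_nonneg_nonneg)
      finally show "norm (Q powi tri n * (- (q * complex_of_real t)) powi n / (1 - y * - (q * of_real t) * Q powi n))
         \<le> (norm Q powi tri n * norm q powi n + norm Q powi tri n * (T * norm q) powi n) * (1 / D)" .
    qed
  qed
  fix n :: int
  have d1: "1 - y * (- q) * Q powi n = 1 + of_real 1 * q powi (i + 3 * n)" using den[of 1 n] by simp
  have "norm (1 + of_real 1 * q powi (i + 3 * n)) \<ge> D"
    unfolding D_def by (rule one_plus_bound) (use T in \<open>auto simp: T_def\<close>)
  then have nz: "1 - y * (- q) * Q powi n \<noteq> 0" unfolding d1 using D by auto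
  have l: "((\<lambda>t. - (q * complex_of_real t)) \<longlongrightarrow> - (q * of_real 1)) (at_right 1)"
    by (intro tendsto_intros)
  then have l: "((\<lambda>t. - (q * complex_of_real t)) \<longlongrightarrow> - q) (at_right 1)" by simp
  show "((\<lambda>t. Q powi tri n * (- (q * complex_of_real t)) powi n / (1 - y * - (q * of_real t) * Q powi n))
     \<longlongrightarrow> Q powi tri n * (- q) powi n / (1 - y * (- q) * Q powi n)) (at_right 1)"
    by (intro tendsto_divide tendsto_mult tendsto_const tendsto_diff tendsto_power_int l nz) (use q in auto)
qed simp

lemma section_sum_values:
  "section_sum Q (1 / q\<^sup>2) (- q) = appell Q (1 / q\<^sup>2) (- 1 / q)"
  "section_sum Q (1 / q) (- q) = qpoch_inf q q - appell Q (1 / q) (-1)"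
proof -
  note Qb = Q_bounds[OF q Q]
  have mq: "(- q) powi n = (-1) powi n * q powi n" for n using power_int_mult_distrib[of "-1" q n] by simp
  have Q2: "Q * (1 / q\<^sup>2) = q" using q by (simp add: Q power2_eq_square power3_eq_cube)
  have "1 / q\<^sup>2 * - q = - 1 / q" using q by (simp add: power2_eq_square)
  then show "section_sum Q (1 / q\<^sup>2) (- q) = appell Q (1 / q\<^sup>2) (- 1 / q)"
    unfolding section_sum_def appell_def mq Q2 by (simp add: mult_ac)
  have "appell Q (1 / q\<^sup>2) (-1) = section_sum Q (1 / q) (- q)"
    unfolding section_sum_def appell_def mq Q2 using q by (simp add: mult_ac)
  moreover have "appell Q (1 / q\<^sup>2) (-1) + appell Q (Q * (1 / q\<^sup>2)) (-1) = jtheta (Q * (1 / q\<^sup>2)) Q"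
    using appell_shift[OF Qb, of "1 / q\<^sup>2" "-1"] q unit_q_powi_ne_1[OF Qb, of "-1"] by simp
  \<comment> \<open>The reflection k -> -k, already carried out in the third moment.\<close>
  moreover have "appell Q q (-1) = appell Q (1 / q) (-1)"
  proof -
    have "((\<lambda>k. (-1) powi k * Q powi tri k * (Q * q) powi k / (1 - (-1) * Q powi k)) has_sum appell Q q (-1)) UNIV"
      by (rule appell_has_sum[OF Qb]) (use q in auto)
    moreover have "(Q * q) powi k = (q\<^sup>2) powi k * (q powi k)\<^sup>2" for k
      by (simp add: Q power2_eq_square power3_eq_cube power_int_mult_distrib)
    ultimately have "((\<lambda>k. (-1) powi k * Q powi tri k * (q\<^sup>2) powi k * (q powi k)\<^sup>2 / (1 + Q powi k)) has_sum appell Q q (-1)) UNIV"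
      by (simp add: mult_ac)
    then show ?thesis using appell_moments(3)[OF q Q] has_sum_unique by blast
  qed
  ultimately show "section_sum Q (1 / q) (- q) = qpoch_inf q q - appell Q (1 / q) (-1)"
    unfolding Q2 using jtheta_q_q3(1)[OF q] by (simp add: Q algebra_simps)
qed

theorem section_constant:
  fixes h :: "int \<Rightarrow> complex"
  assumes h: "\<And>k. h k = q powi (3 * k - 3) * h (k - 1) + (q powi (k - 1) - q powi (2 * k - 2)) * \<rho>"
    and M: "\<And>z. norm q < norm z \<Longrightarrow> norm z < 1 \<Longrightarrow> ((\<lambda>k. h k * z powi k) has_sum M z) UNIV"
    and c: "isCont M (- q)"
  shows "h 0 * qpoch_inf q q = M (- q) + \<rho> * (qpoch_inf q q - 2 * appell Q (1 / q) (-1) + qpoch_inf Q Q ^ 3 / jtheta (-1) Q)"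
proof -
  note Qb = Q_bounds[OF q Q]
  have l: "((\<lambda>t. - (q * complex_of_real t)) \<longlongrightarrow> - (q * of_real 1)) (at_right 1)"
    by (intro tendsto_intros)
  then have l: "((\<lambda>t. - (q * complex_of_real t)) \<longlongrightarrow> - q) (at_right 1)" by simp
  have l': "((\<lambda>t. - (- (q * complex_of_real t))) \<longlongrightarrow> q) (at_right 1)" using tendsto_minus[OF l] by simp
  have "((\<lambda>t. h 0 * jtheta (- (- (q * complex_of_real t))) Q - \<rho> * (section_sum Q (1 / q) (- (q * of_real t)) - section_sum Q (1 / q\<^sup>2) (- (q * of_real t))))
     \<longlongrightarrow> h 0 * jtheta q Q - \<rho> * (section_sum Q (1 / q) (- q) - section_sum Q (1 / q\<^sup>2) (- q))) (at_right 1)"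
  proof (intro tendsto_diff tendsto_mult tendsto_const isCont_tendsto_compose[OF jtheta_isCont[OF Qb q(2)] l'])
    show "((\<lambda>t. section_sum Q (1 / q) (- (q * of_real t))) \<longlongrightarrow> section_sum Q (1 / q) (- q)) (at_right 1)"
      by (rule section_sum_tendsto[of _ 0]) (use q in auto)
    show "((\<lambda>t. section_sum Q (1 / q\<^sup>2) (- (q * of_real t))) \<longlongrightarrow> section_sum Q (1 / q\<^sup>2) (- q)) (at_right 1)"
      by (rule section_sum_tendsto[of _ "-1"]) (use q in \<open>auto simp: power2_eq_square power_int_minus divide_inverse\<close>)
  qed
  moreover have "\<forall>\<^sub>F t in at_right 1. h 0 * jtheta (- (- (q * complex_of_real t))) Q - \<rho> * (section_sum Q (1 / q) (- (q * of_real t)) - section_sum Q (1 / q\<^sup>2) (- (q * of_real t))) = M (- (q * of_real t))"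
  proof -
    have "1 < 1 / norm q" using q by simp
    then have "\<forall>\<^sub>F t in at_right 1. t \<in> {1<..<1 / norm q}" by (rule eventually_at_right_real)
    then show ?thesis
    proof eventually_elim
      case (elim t)
      have n: "norm (- (q * complex_of_real t)) = norm q * t" using elim by (simp add: norm_mult)
      have "norm q < norm q * t" "norm q * t < 1" using elim q by (auto simp: field_simps)
      then have z: "norm q < norm (- (q * complex_of_real t))" "norm (- (q * complex_of_real t)) < 1" unfolding n .
      show ?case by (rule has_sum_unique[OF section_has_sum[OF h z] M[OF z]])
    qed
  qed
  ultimately have "((\<lambda>t. M (- (q * complex_of_real t))) \<longlongrightarrow> h 0 * jtheta q Q - \<rho> * (section_sum Q (1 / q) (- q) - section_sum Q (1 / q\<^sup>2) (- q))) (at_right 1)"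
    by (rule Lim_transform_eventually)
  moreover have "((\<lambda>t. M (- (q * complex_of_real t))) \<longlongrightarrow> M (- q)) (at_right 1)"
    by (rule isCont_tendsto_compose[OF c l])
  ultimately have eq: "h 0 * jtheta q Q - \<rho> * (section_sum Q (1 / q) (- q) - section_sum Q (1 / q\<^sup>2) (- q)) = M (- q)"
    using tendsto_unique[OF trivial_limit_at_right_real] by blast
  have ar: "appell Q (1 / q\<^sup>2) (- 1 / q) = appell Q (1 / q) (-1) - qpoch_inf Q Q ^ 3 / jtheta (-1) Q"
    using appell_relation[OF q Q] by (simp add: algebra_simps)
  have j: "jtheta q Q = qpoch_inf q q" using jtheta_q_q3(1)[OF q] by (simp add: Q)
  show ?thesis unfolding eq[symmetric] section_sum_values ar j by (simp add: algebra_simps)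
qed

end

section \<open>Elimination of the Appell sum in favour of the mock theta functions\<close>

context
  fixes q Q J W K K3 :: complex
  assumes q: "norm q < 1" "q \<noteq> 0" and Q: "Q = q ^ 3"
    and J: "J = qpoch_inf q q" and W: "W = appell Q (1 / q) (-1)"
    and K: "K = J ^ 3 / jtheta (-1) q" and K3: "K3 = qpoch_inf Q Q ^ 3 / jtheta (-1) Q"
begin

lemma J_nonzero: "J \<noteq> 0"
  unfolding J by (rule qpoch_self_nonzero[OF q(1)])

text \<open>Euler's identity (q;q^2)_inf (-q)_inf = 1 turns (q)_inf times the theta quotient of
  \<open>f3_psi3\<close> into 2K; the Appell form of f_3 does the rest.\<close>

lemma psi3_appell: "J * (4 * psi3 (- q)) = 2 * K - 4 * W + 2 * K3"
proof -
  define G where "G = qpoch_inf (- q) q"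
  define A where "A = qpoch_inf q (q\<^sup>2)"
  define E where "E = qpoch_inf (q\<^sup>2) (q\<^sup>2)"
  have G0: "G \<noteq> 0" using qpoch_minus_nonzero(2)[OF q(1), of 1] by (simp add: G_def)
  have JA: "J = A * E" using qpoch_inf_dissect[OF q(1), of 2 q]
    by (simp add: J A_def E_def numeral_2_eq_2)
  have JG: "J * G = E" using qpoch_inf_plus_minus[OF q(1), of q] by (simp add: J G_def E_def)
  have "J * (A * G) = J * 1" using JA JG by (simp add: mult_ac)
  then have AG: "A * G = 1" using J_nonzero mult_cancel_left by blast
  have "q\<^sup>2 / q = q" using q by (simp add: power2_eq_square)
  then have "jtheta q (q\<^sup>2) = A * (A * E)" by (simp add: jtheta_def A_def E_def)
  also have "\<dots> = A * J" using JA by simp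
  finally have "G * (f3 q + 4 * psi3 (- q)) = A * J" using f3_psi3[OF q] by (simp add: G_def)
  then have "(A * G) * (f3 q + 4 * psi3 (- q)) = A * (A * J)" by (simp only: mult.assoc)
  then have f: "f3 q + 4 * psi3 (- q) = A * (A * J)" unfolding AG by simp
  have "qpoch_inf (- 1) q = 2 * G" using qpoch_inf_rec[OF q(1), of "- 1"] by (simp add: G_def)
  then have "jtheta (-1) q = 2 * G * G * J" by (simp add: jtheta_def G_def J)
  then have "K * (2 * (G * G)) = J * J"
    unfolding K using G0 J_nonzero by (simp add: power3_eq_cube)
  then have "2 * K * ((A * G) * (A * G)) = J * (A * (A * J))" by (simp add: mult_ac)
  then have "2 * K = J * (A * (A * J))" unfolding AG by simp
  then have "J * f3 q + J * (4 * psi3 (- q)) = 2 * K"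
    unfolding f[symmetric] by (simp add: distrib_left)
  moreover have "J * f3 q = 4 * W - 2 * K3"
    unfolding J W K3 by (rule f3_appell[OF q Q])
  ultimately show ?thesis by (simp add: algebra_simps)
qed

lemma chi3_appell': "J * chi3 q = W + K3"
  unfolding J W K3 by (rule chi3_appell[OF q Q])

definition scaled_char :: "int \<Rightarrow> complex \<Rightarrow> complex" where
  "scaled_char s z = z powi (1 - s) * (char_num q s z * (qpoch_inf q q ^ 3 / jtheta z q))"

lemma scaled_char_has_sum:
  assumes s: "s \<in> {1,2,3}" and z: "norm q < norm z" "norm z < 1"
  shows "((\<lambda>k. string_coeff q s k * z powi k) has_sum scaled_char s z) UNIV"
proof -
  have z0: "z \<noteq> 0" using z q by auto
  have "((\<lambda>k. z powi (1 - s) * (char_coeff q s k * z powi k)) has_sum scaled_char s z) UNIV"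
    unfolding scaled_char_def by (intro has_sum_cmult_right char_coeff_laurent(1)[OF q s z])
  then show ?thesis
  proof (rule has_sum_reindex_bij_witness[of _ "\<lambda>k. k + s - 1" "\<lambda>k. k + 1 - s", THEN iffD1, rotated -1])
    fix k :: int
    have "z powi (k + 1 - s) = z powi (1 - s) * z powi k"
      using z0 by (simp add: power_int_add[symmetric] algebra_simps)
    then show "string_coeff q s (k + 1 - s) * z powi (k + 1 - s) = z powi (1 - s) * (char_coeff q s k * z powi k)"
      by (simp add: string_coeff_def[OF q])
  qed auto
qed

lemma jtheta_minus_q: "jtheta (- q) q = jtheta (-1) q"
  using jtheta_reflect[of q "-1"] q by simp

lemma scaled_char_minus_q:
  shows "isCont (scaled_char s) (- q)" and "scaled_char s (- q) = (-1) powi (1 - s) * (section_residue q s * K)"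
proof -
  have nz: "jtheta (- q) q \<noteq> 0"
  proof (rule jtheta_nonzero[OF q])
    show "- q * q powi k \<noteq> 1" for k
      using unit_q_powi_ne_1[OF q, of "-1" "k + 1"] q by (simp add: power_int_add mult.commute)
  qed (use q in auto)
  have Q48: "norm (q ^ 48) < 1" "q ^ 48 \<noteq> 0" using q by (auto simp: norm_power power_less_one_iff)
  have c1: "isCont (\<lambda>z. jtheta (- (q powi a * z powi (-8))) (q ^ 48)) (- q)" for a
    by (rule isCont_o2[OF _ jtheta_isCont[OF Q48]]) (use q in \<open>auto intro!: continuous_intros\<close>)
  have c2: "isCont (\<lambda>z. jtheta z q) (- q)" by (rule jtheta_isCont[OF q]) (use q in auto)
  show "isCont (scaled_char s) (- q)"
    unfolding scaled_char_def[abs_def] char_num_def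
    by (intro continuous_intros c1 c2) (use q nz in auto)
  have "(- q) powi (1 - s) = (-1) powi (1 - s) * q powi (1 - s)" using power_int_mult_distrib[of "-1" q "1 - s"] by simp
  then show "scaled_char s (- q) = (-1) powi (1 - s) * (section_residue q s * K)"
    by (simp add: scaled_char_def char_num_minus[OF q] jtheta_minus_q section_residue_def[OF q] K J mult_ac)
qed

text \<open>For s = 2 the recurrence is closed and \<open>section_constant\<close> gives the value
  directly. For s = 1 and s = 3 it only gives a weighted sum; the weighted difference comes from the
  recurrence at k = 1 together with the equality of the values at k = 0 and k = 1.\<close>

theorem string_coeff_values:
  "string_coeff q 2 0 = section_residue q 2 * (1 - chi3 q + psi3 (- q) + 3 * (K3 - K) / (2 * J))"
  "string_coeff q 1 0 = section_residue q 1 * ((3 * K3 + K) / (2 * J) + 1 - chi3 q) + q ^ 3 * section_residue q 3 * psi3 (- q)"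
  "q ^ 3 * string_coeff q 3 0 = q ^ 3 * section_residue q 3 * ((3 * K3 + K) / (2 * J) + 1 - chi3 q) + section_residue q 1 * psi3 (- q)"
proof -
  define x where "x = chi3 q"
  define p where "p = psi3 (- q)"
  have W_eq: "W = J * x - K3" using chi3_appell' by (simp add: x_def)
  have "4 * (J * p) = 2 * K - 4 * W + 2 * K3" using psi3_appell by (simp add: p_def mult_ac)
  then have "2 * K = 2 * (2 * (J * x + J * p) - 3 * K3)" unfolding W_eq by (simp add: algebra_simps)
  then have KK: "K = 2 * (J * x + J * p) - 3 * K3" by (simp only: mult_cancel_left) simp
  \<comment> \<open>Eliminating W from the two mock theta evaluations leaves this relation. It later
    replaces 1 + psi_3(-q) by the theta quotient plus 1 - chi_3(q).\<close>
  have T: "(3 * K3 + K) / (2 * J) = x + p" unfolding KK using J_nonzero by (simp add: field_simps)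
  have p2: "q powi (2 * k - 2) = q powi (2 * k + 4 - 3 * 2)" for k :: int by simp
  have r2: "string_coeff q 2 k = q powi (3 * k - 3) * string_coeff q 2 (k - 1) + (q powi (k - 1) - q powi (2 * k - 2)) * section_residue q 2" for k
    using string_coeff_rec[OF q, of 2 k] by (simp add: algebra_simps)
  have "string_coeff q 2 0 * qpoch_inf q q = scaled_char 2 (- q) + section_residue q 2 * (qpoch_inf q q - 2 * appell Q (1 / q) (-1) + qpoch_inf Q Q ^ 3 / jtheta (-1) Q)"
    by (rule section_constant[OF q Q r2 scaled_char_has_sum scaled_char_minus_q(1)]) auto
  then have "string_coeff q 2 0 * J = section_residue q 2 * (J - 2 * W + K3 - K)"
    unfolding scaled_char_minus_q(2) J[symmetric] W[symmetric] K3[symmetric] by (simp add: algebra_simps)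
  then have "string_coeff q 2 0 * J = section_residue q 2 * (J - 2 * (J * x - K3) + K3 - K)" unfolding W_eq .
  moreover have "J - 2 * (J * x - K3) + K3 - K = (1 - x + p + 3 * (K3 - K) / (2 * J)) * J"
  proof -
    have e: "(1 - x + p + 3 * (K3 - K) / (2 * J)) * J = J - J * x + J * p + 3 * (K3 - K) / 2"
    proof -
      have "3 * (K3 - K) / (2 * J) * J = 3 * (K3 - K) / 2" using J_nonzero by simp
      then show ?thesis by (simp only: distrib_right left_diff_distrib mult_1_left mult.commute[of x J] mult.commute[of p J])
    qed
    show ?thesis unfolding e unfolding KK by (simp add: field_simps)
  qed
  ultimately have "string_coeff q 2 0 * J = section_residue q 2 * (1 - x + p + 3 * (K3 - K) / (2 * J)) * J" by simp
  then show "string_coeff q 2 0 = section_residue q 2 * (1 - chi3 q + psi3 (- q) + 3 * (K3 - K) / (2 * J))"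
    using J_nonzero by (simp add: x_def p_def)
  \<comment> \<open>The weight q^3 is forced: it turns the cross factors q^(2k+1) and q^(2k-5) both
    into q^(2k-2), and q^(3k) and q^(3k-6) both into q^(3k-3).\<close>
  define h where "h k = string_coeff q 1 k + q ^ 3 * string_coeff q 3 k" for k
  define r where "r = section_residue q 1 + q ^ 3 * section_residue q 3"
  have q3: "q ^ 3 = q powi 3" by (metis of_nat_numeral power_int_of_nat)
  have rh: "h k = q powi (3 * k - 3) * h (k - 1) + (q powi (k - 1) - q powi (2 * k - 2)) * r" for k
  proof -
    have 1: "string_coeff q 1 k = q powi (k - 1) * section_residue q 1 - q powi (2 * k + 1) * section_residue q 3 + q powi (3 * k) * string_coeff q 3 (k - 1)"
      using string_coeff_rec[OF q, of 1 k] by (simp add: add.commute)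
    have 3: "string_coeff q 3 k = q powi (k - 1) * section_residue q 3 - q powi (2 * k - 5) * section_residue q 1 + q powi (3 * k - 6) * string_coeff q 1 (k - 1)"
      using string_coeff_rec[OF q, of 3 k] by simp
    have pq: "q powi a * q ^ 3 = q powi (a + 3)" for a
      unfolding q3 by (rule power_int_add[symmetric]) (use q in simp)
    have e: "q powi (2 * k + 1) = q powi (2 * k - 2) * q ^ 3" "q ^ 3 * q powi (2 * k - 5) = q powi (2 * k - 2)"
      "q powi (3 * k) = q powi (3 * k - 3) * q ^ 3" "q ^ 3 * q powi (3 * k - 6) = q powi (3 * k - 3)"
      by (simp_all only: mult.commute[of "q ^ 3"] pq) (simp_all add: add.commute)
    have "q ^ 3 * string_coeff q 3 k = q powi (k - 1) * (q ^ 3 * section_residue q 3) - (q ^ 3 * q powi (2 * k - 5)) * section_residue q 1 + (q ^ 3 * q powi (3 * k - 6)) * string_coeff q 1 (k - 1)"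
      unfolding 3 by (simp add: algebra_simps)
    then show ?thesis unfolding h_def r_def 1 e by (simp add: algebra_simps)
  qed
  have "h 0 * qpoch_inf q q = (\<lambda>z. scaled_char 1 z + q ^ 3 * scaled_char 3 z) (- q) + r * (qpoch_inf q q - 2 * appell Q (1 / q) (-1) + qpoch_inf Q Q ^ 3 / jtheta (-1) Q)"
  proof (rule section_constant[OF q Q rh])
    show "((\<lambda>k. h k * z powi k) has_sum (scaled_char 1 z + q ^ 3 * scaled_char 3 z)) UNIV" if "norm q < norm z" "norm z < 1" for z
      using has_sum_add[OF scaled_char_has_sum[OF _ that, of 1] has_sum_cmult_right[OF scaled_char_has_sum[OF _ that, of 3], of "q ^ 3"]]
      by (simp add: h_def algebra_simps)
    show "isCont (\<lambda>z. scaled_char 1 z + q ^ 3 * scaled_char 3 z) (- q)" by (intro continuous_intros scaled_char_minus_q(1))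
  qed
  then have "h 0 * J = r * (J - 2 * W + K3 + K)"
    unfolding scaled_char_minus_q(2) J[symmetric] W[symmetric] K3[symmetric] r_def by (simp add: algebra_simps)
  then have "h 0 * J = r * (J - 2 * (J * x - K3) + K3 + K)" unfolding W_eq .
  moreover have "J - 2 * (J * x - K3) + K3 + K = (1 + 2 * p) * J" unfolding KK by (simp add: algebra_simps)
  ultimately have "h 0 * J = r * (1 + 2 * p) * J" by simp
  then have plus: "string_coeff q 1 0 + q ^ 3 * string_coeff q 3 0 = (section_residue q 1 + q ^ 3 * section_residue q 3) * (1 + 2 * p)"
    using J_nonzero by (simp add: h_def r_def)
  have minus: "string_coeff q 1 0 - q ^ 3 * string_coeff q 3 0 = section_residue q 1 - q ^ 3 * section_residue q 3"
  proof -
    have "string_coeff q 1 0 = section_residue q 1 - q powi 3 * section_residue q 3 + q powi 3 * string_coeff q 3 0"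
      using string_coeff_rec[OF q, of 1 1] string_coeff_0_1[OF q, of 1] by simp
    then show ?thesis unfolding q3 by (simp add: algebra_simps)
  qed
  have "2 * string_coeff q 1 0 = (string_coeff q 1 0 + q ^ 3 * string_coeff q 3 0) + (string_coeff q 1 0 - q ^ 3 * string_coeff q 3 0)" by simp
  also have "\<dots> = 2 * (section_residue q 1 * (1 + p) + q ^ 3 * section_residue q 3 * p)" unfolding plus minus by (simp add: algebra_simps)
  finally have "string_coeff q 1 0 = section_residue q 1 * (1 + p) + q ^ 3 * section_residue q 3 * p" by (simp only: mult_cancel_left) simp
  then show "string_coeff q 1 0 = section_residue q 1 * ((3 * K3 + K) / (2 * J) + 1 - chi3 q) + q ^ 3 * section_residue q 3 * psi3 (- q)"
    unfolding T by (simp add: x_def p_def)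
  have "2 * (q ^ 3 * string_coeff q 3 0) = (string_coeff q 1 0 + q ^ 3 * string_coeff q 3 0) - (string_coeff q 1 0 - q ^ 3 * string_coeff q 3 0)" by simp
  also have "\<dots> = 2 * (q ^ 3 * section_residue q 3 * (1 + p) + section_residue q 1 * p)" unfolding plus minus by (simp add: algebra_simps)
  finally have "q ^ 3 * string_coeff q 3 0 = q ^ 3 * section_residue q 3 * (1 + p) + section_residue q 1 * p" by (simp only: mult_cancel_left) simp
  then show "q ^ 3 * string_coeff q 3 0 = q ^ 3 * section_residue q 3 * ((3 * K3 + K) / (2 * J) + 1 - chi3 q) + section_residue q 1 * psi3 (- q)"
    unfolding T by (simp add: x_def p_def)
qed

end

section \<open>Uniqueness of the string functions\<close>

lemma roots_of_unity_sum:
  fixes m :: int and N :: nat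
  assumes "N > 0"
  shows "(\<Sum>j<N. cis (2 * pi * real j * of_int m / real N)) = (if int N dvd m then of_nat N else 0)"
proof -
  define w where "w = cis (2 * pi * of_int m / real N)"
  have cis1: "cis (2 * pi * of_int c) = 1" for c by (rule cis_multiple_2pi) simp
  have wj: "cis (2 * pi * real j * of_int m / real N) = w ^ j" for j
    unfolding w_def Complex.DeMoivre by (rule arg_cong[of _ _ cis]) simp
  show ?thesis
  proof (cases "int N dvd m")
    case True
    then obtain c where c: "m = int N * c" by blast
    have "w = cis (2 * pi * of_int c)" unfolding w_def c by (rule arg_cong[of _ _ cis]) (use assms in simp)
    then have "w = 1" by (simp only: cis1)
    then show ?thesis using True by (simp add: wj)
  next
    case False
    have "w \<noteq> 1"
    proof
      assume "w = 1"
      then have "cos (2 * pi * of_int m / real N) = 1" by (simp add: w_def complex_eq_iff)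
      then obtain c :: int where "2 * pi * of_int m / real N = of_int c * 2 * pi"
        unfolding cos_one_2pi_int by blast
      then have "(of_int m :: real) = of_int c * real N" using assms by (simp add: field_simps)
      then have "m = c * int N" by (metis of_int_eq_iff of_int_mult of_int_of_nat_eq)
      then show False using False by simp
    qed
    moreover have "w ^ N = 1"
    proof -
      have "w ^ N = cis (2 * pi * of_int m)" using assms by (simp add: w_def Complex.DeMoivre)
      then show ?thesis by (simp only: cis1)
    qed
    ultimately show ?thesis using False by (simp add: wj geometric_sum)
  qed
qed

lemma has_sum_sum_functions:
  fixes f :: "'i \<Rightarrow> 'a \<Rightarrow> complex"
  assumes "finite I" "\<And>i. i \<in> I \<Longrightarrow> (f i has_sum a i) A"
  shows "((\<lambda>x. \<Sum>i\<in>I. f i x) has_sum (\<Sum>i\<in>I. a i)) A"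
  using assms by (induction I rule: finite_induct) (auto intro!: has_sum_add)

text \<open>Averaging over N-th roots of unity keeps only the indices congruent to k modulo N, so
  their coefficients sum to 0; as N -> infinity only k itself survives. Absolute summability
  justifies the limit.\<close>

lemma fourier_unique:
  fixes d :: "int \<Rightarrow> complex"
  assumes h: "\<And>t::real. ((\<lambda>m. d m * cis (of_int m * t)) has_sum 0) UNIV"
  shows "d k = 0"
proof -
  have d: "d summable_on UNIV" using has_sum_imp_summable[OF h[of 0]] by simp
  have z: "infsum (\<lambda>m. if int N dvd (m - k) then d m else 0) UNIV = 0" if N: "N > 0" for N
  proof -
    have "((\<lambda>m. \<Sum>j<N. cis (- (2 * pi * real j * of_int k / real N)) * (d m * cis (of_int m * (2 * pi * real j / real N)))) has_sum
        (\<Sum>j<N. cis (- (2 * pi * real j * of_int k / real N)) * 0)) UNIV"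
      by (intro has_sum_sum_functions has_sum_cmult_right h) simp
    moreover have "(\<Sum>j<N. cis (- (2 * pi * real j * of_int k / real N)) * (d m * cis (of_int m * (2 * pi * real j / real N))))
       = of_nat N * (if int N dvd (m - k) then d m else 0)" for m
    proof -
      have "cis (- (2 * pi * real j * of_int k / real N)) * (d m * cis (of_int m * (2 * pi * real j / real N))) = d m * cis (2 * pi * real j * of_int (m - k) / real N)" for j
        by (simp add: cis_mult mult.left_commute diff_divide_distrib algebra_simps)
      then have "(\<Sum>j<N. cis (- (2 * pi * real j * of_int k / real N)) * (d m * cis (of_int m * (2 * pi * real j / real N))))
         = d m * (\<Sum>j<N. cis (2 * pi * real j * of_int (m - k) / real N))" by (simp only: sum_distrib_left)
      then show ?thesis unfolding roots_of_unity_sum[OF N] by simp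
    qed
    ultimately have "((\<lambda>m. of_nat N * (if int N dvd (m - k) then d m else 0)) has_sum 0) UNIV" by simp
    from infsumI[OF this] show ?thesis using N by (simp add: infsum_cmult_right')
  qed
  have "(\<lambda>N. infsum (\<lambda>m. if int (Suc N) dvd (m - k) then d m else 0) UNIV) \<longlonglongrightarrow> infsum (\<lambda>m. if m = k then d k else 0) UNIV"
  proof (rule infsum_tendsto_dominated)
    show "(\<lambda>m. norm (d m)) summable_on UNIV" using d summable_on_iff_abs_summable_on_complex by blast
    show "\<forall>\<^sub>F N in sequentially. \<forall>m\<in>UNIV. norm (if int (Suc N) dvd (m - k) then d m else 0) \<le> norm (d m)"
      by (intro always_eventually) auto
    show "(\<lambda>N. if int (Suc N) dvd (m - k) then d m else 0) \<longlonglongrightarrow> (if m = k then d k else 0)" for m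
    proof (cases "m = k")
      case False
      have "\<forall>\<^sub>F N in sequentially. (if int (Suc N) dvd (m - k) then d m else 0) = 0"
        using eventually_ge_at_top[of "nat \<bar>m - k\<bar>"]
      proof eventually_elim
        case (elim N)
        then have "\<not> int (Suc N) dvd (m - k)" using False zdvd_imp_le[of "int (Suc N)" "\<bar>m - k\<bar>"] by auto
        then show ?case by simp
      qed
      then show ?thesis using False by (simp add: tendsto_eventually)
    qed simp
  qed simp
  then have "infsum (\<lambda>m. if m = k then d k else 0) UNIV = 0"
    using z by (simp add: LIMSEQ_const_iff del: of_nat_Suc)
  moreover have "infsum (\<lambda>m. if m = k then d k else 0) UNIV = d k"
    by (rule infsumI, rule has_sum_finite_neutralI[of "{k}"]) auto
  ultimately show ?thesis by simp
qed

lemma epow_add: "epow t (a + b) = epow t a * epow t b"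
  unfolding epow_def by (simp add: exp_add[symmetric] algebra_simps)

lemma epow_0 [simp]: "epow t 0 = 1"
  by (simp add: epow_def)

lemma epow_nonzero [simp]: "epow t a \<noteq> 0"
  by (simp add: epow_def)

lemma epow_powi: "epow t a powi n = epow t (of_int n * a)"
  unfolding epow_def exp_power_int by (simp add: mult_ac)

lemma epow_of_int: "epow t (of_int n) = epow t 1 powi n"
  by (simp add: epow_powi)

lemma norm_epow: "norm (epow t 1) = exp (- (2 * pi * Im t))"
  by (simp add: epow_def norm_exp_eq_Re)

text \<open>The string functions are defined by a definite description, so the expansion must
  determine them. On the line Im u = Im \<tau> / 2 the difference of two expansions is a Fourier
  series with sum 0.\<close>

lemma string_family_unique:
  assumes t: "Im \<tau> > 0" and C: "is_string_family p p' l \<tau> C" and D: "is_string_family p p' l \<tau> D"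
  shows "C = D"
proof
  fix k :: int
  define e where "e m = epow \<tau> ((real_of_int m)\<^sup>2 / (4 * adm_level p p'))" for m
  define y where "y = Im \<tau> / 2"
  define d where "d m = (C m - D m) * e m * of_real (exp (pi * of_int m * y))" for m
  have "d k = 0"
  proof (rule fourier_unique)
    fix x :: real
    \<comment> \<open>The real part -x/pi is scaled so that exp(-pi i m u) = exp(pi m y) exp(i m x),
      which makes the frequencies the integers m.\<close>
    define u where "u = Complex (- (x / pi)) y"
    have u: "0 < Im u \<and> Im u < Im \<tau>" using t by (simp add: u_def y_def)
    have E: "epow u (- real_of_int m / 2) = of_real (exp (pi * of_int m * y)) * cis (of_int m * x)" for m
    proof -
      have "2 * of_real pi * \<i> * of_real (- real_of_int m / 2) * u = Complex (pi * of_int m * y) (of_int m * x)"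
        by (simp add: u_def complex_eq_iff)
      then show ?thesis unfolding epow_def by (simp add: exp_eq_polar)
    qed
    have "((\<lambda>m. C m * e m * epow u (- real_of_int m / 2) - D m * e m * epow u (- real_of_int m / 2)) has_sum
       (adm_char p p' l u \<tau> - adm_char p p' l u \<tau>)) {m. even (m - int l)}"
      using C D u unfolding is_string_family_def e_def by (intro has_sum_diff) blast+
    then have "((\<lambda>m. d m * cis (of_int m * x)) has_sum 0) {m. even (m - int l)}"
      unfolding E d_def by (simp add: algebra_simps)
    then show "((\<lambda>m. d m * cis (of_int m * x)) has_sum 0) UNIV"
    proof (rule has_sum_cong_neutral[THEN iffD1, rotated -1])
      fix m assume "m \<in> UNIV - {m. even (m - int l)}"
      then have "C m = 0" "D m = 0" using C D unfolding is_string_family_def by auto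
      then show "d m * cis (of_int m * x) = 0" by (simp add: d_def)
    qed auto
  qed
  then show "C k = D k" by (simp add: d_def e_def)
qed

context
  fixes \<tau> q :: complex and r :: nat and s :: int
  assumes t: "Im \<tau> > 0" and q: "q = epow \<tau> 1" and r: "r \<in> {0,1,2}" and s: "s = int r + 1"
begin

lemma q_bounds: "norm q < 1" "q \<noteq> 0"
  using t by (simp_all add: q norm_epow)

lemma s_range: "s \<in> {1,2,3}"
  using r s by auto

text \<open>The prefactor z^(1/2 - s) turns z^k into z^(-m/2) with m = 2s - 1 - 2k, which explains
  the index of \<open>char_coeff\<close>. The exponents 3 s^2/8 and 3 m^2/8 are p(l+1)^2/(4p') and
  m^2/(4N) at level N = 2/3.\<close>

definition string_family :: "int \<Rightarrow> complex" where
  "string_family m = (if odd (m - int (2 * r + 1)) then 0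
     else epow \<tau> (3 * (real_of_int s)\<^sup>2 / 8 - 1 / 8 - 3 * (real_of_int m)\<^sup>2 / 8) * char_coeff q s ((2 * s - 1 - m) div 2) / qpoch_inf q q ^ 3)"

lemma adm_char_eq:
  "adm_char 3 8 (2 * r + 1) u \<tau> = epow u (1 / 2 - of_int s) * epow \<tau> (3 * (real_of_int s)\<^sup>2 / 8 - 1 / 8) * (char_num q s (epow u 1) / jtheta (epow u 1) q)"
proof -
  have rs: "real r = of_int s - 1" using s by simp
  have a: "epow \<tau> (3 * (2 * of_int s) + 24) * epow u (- 8) = q powi (6 * s + 24) * epow u 1 powi (-8)"
    unfolding q epow_of_int[symmetric] by simp
  have b: "epow \<tau> (- 3 * (2 * of_int s) + 24) * epow u (- 8) = q powi (24 - 6 * s) * epow u 1 powi (-8)"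
    unfolding q epow_of_int[symmetric] by simp
  have c: "epow u (2 * of_int s) = epow u 1 powi (2 * s)"
    unfolding epow_of_int[symmetric] by simp
  have d: "epow \<tau> 48 = q ^ 48"
    using epow_of_int[of \<tau> 48] by (metis of_int_numeral of_nat_numeral power_int_of_nat q)
  have e: "epow u (1 / 2 - of_int s) = epow u (- of_int s) / epow u (- 1 / 2)"
    using epow_add[of u "1/2 - of_int s" "- 1/2"] by (simp add: field_simps)
  have f: "epow \<tau> (3 * (real_of_int s)\<^sup>2 / 8 - 1 / 8) = epow \<tau> (3 * (real_of_int s)\<^sup>2 / 8) / epow \<tau> (1 / 8)"
    using epow_add[of \<tau> "3 * (real_of_int s)\<^sup>2 / 8 - 1 / 8" "1/8"] by (simp add: field_simps)
  have l: "real (2 * r + 1) + 1 = 2 * of_int s" using rs by simp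
  show ?thesis
    unfolding adm_char_def l e f char_num_def
    using a b c d by (simp add: q[symmetric] power_mult_distrib)
qed

lemma string_family_string: "is_string_family 3 8 (2 * r + 1) \<tau> string_family"
  unfolding is_string_family_def
proof (intro conjI allI impI)
  show "string_family m = 0" if "odd (m - int (2 * r + 1))" for m using that by (simp add: string_family_def)
  fix u assume u: "0 < Im u \<and> Im u < Im \<tau>"
  define z where "z = epow u 1"
  have z: "norm q < norm z" "norm z < 1" using u by (simp_all add: z_def q norm_epow)
  have P0: "qpoch_inf q q ^ 3 \<noteq> 0" using qpoch_self_nonzero[OF q_bounds(1)] by simp
  define c where "c = epow u (1 / 2 - of_int s) * epow \<tau> (3 * (real_of_int s)\<^sup>2 / 8 - 1 / 8) / qpoch_inf q q ^ 3"
  have "((\<lambda>k. c * (char_coeff q s k * z powi k)) has_sum c * (char_num q s z * (qpoch_inf q q ^ 3 / jtheta z q))) UNIV"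
    by (intro has_sum_cmult_right char_coeff_laurent(1)[OF q_bounds s_range z])
  moreover have "c * (char_num q s z * (qpoch_inf q q ^ 3 / jtheta z q)) = adm_char 3 8 (2 * r + 1) u \<tau>"
    unfolding adm_char_eq c_def z_def[symmetric] using P0 by simp
  ultimately have "((\<lambda>k. c * (char_coeff q s k * z powi k)) has_sum adm_char 3 8 (2 * r + 1) u \<tau>) UNIV" by simp
  then show "((\<lambda>m. string_family m * epow \<tau> ((real_of_int m)\<^sup>2 / (4 * adm_level 3 8)) * epow u (- real_of_int m / 2)) has_sum adm_char 3 8 (2 * r + 1) u \<tau>)
       {m. even (m - int (2 * r + 1))}"
  proof (rule has_sum_reindex_bij_witness[of _ "\<lambda>m. (2 * s - 1 - m) div 2" "\<lambda>k. 2 * s - 1 - 2 * k", THEN iffD1, rotated -1])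
    fix k :: int
    define m where "m = 2 * s - 1 - 2 * k"
    have ev: "even (m - int (2 * r + 1))" by (simp add: m_def s)
    have dv: "(2 * s - 1 - m) div 2 = k" by (simp add: m_def)
    have N: "(real_of_int m)\<^sup>2 / (4 * adm_level 3 8) = 3 * (real_of_int m)\<^sup>2 / 8"
      by (simp add: adm_level_def)
    have E1: "epow \<tau> (3 * (real_of_int s)\<^sup>2 / 8 - 1 / 8 - 3 * (real_of_int m)\<^sup>2 / 8) * epow \<tau> (3 * (real_of_int m)\<^sup>2 / 8) = epow \<tau> (3 * (real_of_int s)\<^sup>2 / 8 - 1 / 8)"
      unfolding epow_add[symmetric] by simp
    have E2: "epow u (- real_of_int m / 2) = epow u (1 / 2 - of_int s) * z powi k"
      unfolding z_def epow_of_int[symmetric] epow_add[symmetric] by (simp add: m_def field_simps)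
    have "string_family m * epow \<tau> ((real_of_int m)\<^sup>2 / (4 * adm_level 3 8)) * epow u (- real_of_int m / 2)
      = (epow \<tau> (3 * (real_of_int s)\<^sup>2 / 8 - 1 / 8 - 3 * (real_of_int m)\<^sup>2 / 8) * epow \<tau> (3 * (real_of_int m)\<^sup>2 / 8)) * (char_coeff q s k / qpoch_inf q q ^ 3) * (epow u (1 / 2 - of_int s) * z powi k)"
      unfolding N E2 string_family_def dv using ev by simp
    also have "\<dots> = c * (char_coeff q s k * z powi k)"
      unfolding E1 c_def by (simp add: mult_ac)
    finally show "string_family (2 * s - 1 - 2 * k) * epow \<tau> ((real_of_int (2 * s - 1 - 2 * k))\<^sup>2 / (4 * adm_level 3 8)) * epow u (- real_of_int (2 * s - 1 - 2 * k) / 2)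
      = c * (char_coeff q s k * z powi k)"
      unfolding m_def .
  qed (auto simp: s)
qed

theorem norm_string_fun_string_coeff: "qpoch_inf q q ^ 3 * norm_string_fun 3 8 1 (2 * r + 1) \<tau> = string_coeff q s 0"
proof -
  have P0: "qpoch_inf q q ^ 3 \<noteq> 0" using qpoch_self_nonzero[OF q_bounds(1)] by simp
  have "(THE C. is_string_family 3 8 (2 * r + 1) \<tau> C) = string_family"
    by (rule the_equality) (use string_family_string string_family_unique[OF t] in blast)+
  then have S: "string_fun 3 8 1 (2 * r + 1) \<tau> = string_family 1" by (simp add: string_fun_def)
  define a where "a = 3 * (real_of_int s)\<^sup>2 / 8 - 1 / 8 - 3 / 8"
  have l: "real (2 * r + 1) + 1 = 2 * of_int s" using s by simp
  have e: "- 1 / 8 + real 3 * (real (2 * r + 1) + 1)\<^sup>2 / (4 * real 8) - (real_of_int 1)\<^sup>2 / (4 * adm_level 3 8) = a"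
    unfolding l a_def adm_level_def by (simp add: power2_eq_square)
  have "(2 * s - 1 - 1) div 2 = s - 1" by simp
  then have C1: "string_family 1 = epow \<tau> a * char_coeff q s (s - 1) / qpoch_inf q q ^ 3"
    by (simp add: string_family_def a_def)
  have "epow \<tau> (- a) * epow \<tau> a = 1" unfolding epow_add[symmetric] by simp
  then have "norm_string_fun 3 8 1 (2 * r + 1) \<tau> = char_coeff q s (s - 1) / qpoch_inf q q ^ 3"
    unfolding norm_string_fun_def Let_def e S C1 by (simp add: mult.assoc[symmetric])
  then show ?thesis using P0 by (simp add: string_coeff_def[OF q_bounds])
qed

end

section \<open>Theta product identities and eta quotients\<close>

lemma pow_bounds:
  fixes q :: complex
  assumes "norm q < 1" "q \<noteq> 0" "n > 0"
  shows "norm (q ^ n) < 1" "q ^ n \<noteq> 0"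
  using assms by (auto simp: norm_power power_less_one_iff)

lemma powi_pow: "(q ^ n) powi k = q powi (int n * k)" for q :: complex
  by (metis power_int_mult power_int_of_nat)

text \<open>A product of two series is collected along the lines m + c n = s. For theta series the
  inner sum over n is again a theta series, of another base.\<close>

lemma has_sum_dilated_convolution:
  fixes f g :: "int \<Rightarrow> complex"
  assumes "(f has_sum a) UNIV" "(g has_sum b) UNIV"
    and inner: "\<And>s. ((\<lambda>n. f (s - c * n) * g n) has_sum F s) UNIV"
  shows "(F has_sum (a * b)) UNIV"
proof -
  have "((\<lambda>(s,n). f (s - c * n) * g n) has_sum (a * b)) (UNIV \<times> UNIV)"
    by (rule has_sum_reindex_bij_witness[of _ "\<lambda>(s,n). (s - c * n, n)" "\<lambda>(m,n). (m + c * n, n)", THEN iffD1,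
        OF _ _ _ _ _ _ has_sum_product_complex[OF assms(1,2)]]) auto
  then show ?thesis by (rule has_sum_SigmaD) (use inner in simp)
qed

lemma has_sum_residue_pair:
  fixes F :: "int \<Rightarrow> complex"
  assumes m: "m > 1" and A: "((\<lambda>t. F (m * t)) has_sum a) UNIV" and B: "((\<lambda>t. F (m * t + 1)) has_sum b) UNIV"
    and Z: "\<And>s. \<not> m dvd s \<Longrightarrow> \<not> m dvd (s - 1) \<Longrightarrow> F s = 0"
  shows "(F has_sum (a + b)) UNIV"
proof -
  have 1: "(F has_sum a) {s. m dvd s}"
    by (rule has_sum_reindex_bij_witness[of _ "\<lambda>s. s div m" "\<lambda>t. m * t", THEN iffD1, OF _ _ _ _ _ _ A]) (use m in auto)
  have 2: "(F has_sum b) {s. m dvd (s - 1)}"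
    by (rule has_sum_reindex_bij_witness[of _ "\<lambda>s. (s - 1) div m" "\<lambda>t. m * t + 1", THEN iffD1, OF _ _ _ _ _ _ B]) (use m in auto)
  have "{s. m dvd s} \<inter> {s. m dvd (s - 1)} = {}"
  proof (rule ccontr)
    assume "\<not> ?thesis"
    then obtain s where "m dvd s" "m dvd (s - 1)" by blast
    then have "m dvd s - (s - 1)" by (rule dvd_diff)
    then show False using m by simp
  qed
  from has_sum_Un_disjoint[OF 1 2 this] show ?thesis
    by (rule has_sum_cong_neutral[THEN iffD1, rotated -1]) (use Z in auto)
qed

lemma minus_powi: "(- z) powi k = (-1) powi k * z powi k" for z :: complex
  using power_int_mult_distrib[of "-1" z k] by simp

lemma jacobi_triple_plus:
  assumes "norm P < 1" "P \<noteq> 0" "z \<noteq> 0"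
  shows "((\<lambda>t. P powi tri t * z powi t) has_sum jtheta (- z) P) UNIV"
proof -
  have e: "(-1) powi t * P powi tri t * (- z) powi t = P powi tri t * z powi t" for t
  proof -
    have "(-1) powi t * P powi tri t * (- z) powi t = ((-1) powi t * (-1) powi t) * (P powi tri t * z powi t)"
      unfolding minus_powi[of z] by (simp only: mult_ac)
    then show ?thesis unfolding m1_powi_sq by simp
  qed
  show ?thesis using jacobi_triple_product[of P "- z"] assms unfolding e by simp
qed

text \<open>Collected along m + 2n = s, the product has as inner sum the theta function of base P^6
  at P^(4-2s), which by quasi-periodicity depends essentially on s modulo 3. The classes 0 and 1
  give j(P^4;P^6) = j(P^2;P^6) = (P^2;P^2)_inf, and the class 2 gives j(1;P^6) = 0.\<close>

theorem quintuple_product: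
  fixes P x :: complex
  assumes P: "norm P < 1" "P \<noteq> 0" and x: "x \<noteq> 0"
  shows "jtheta (- x) P * jtheta (P * x\<^sup>2) (P\<^sup>2)
    = qpoch_inf (P\<^sup>2) (P\<^sup>2) * (jtheta (P * x ^ 3) (P ^ 3) + x * jtheta (P\<^sup>2 * x ^ 3) (P ^ 3))"
proof -
  note P2 = pow_bounds[OF P, of 2, OF zero_less_numeral] and P3 = pow_bounds[OF P, of 3, OF zero_less_numeral] and P6 = pow_bounds[OF P, of 6, OF zero_less_numeral]
  define E where "E = qpoch_inf (P\<^sup>2) (P\<^sup>2)"
  define F where "F s = P powi tri s * x powi s * jtheta (P powi (4 - 2 * s)) (P ^ 6)" for s
  have f: "((\<lambda>m. P powi tri m * x powi m) has_sum jtheta (- x) P) UNIV"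
    by (rule jacobi_triple_plus[OF P x])
  have g: "((\<lambda>n. (-1) powi n * (P powi (n * n) * x powi (2 * n))) has_sum jtheta (P * x\<^sup>2) (P\<^sup>2)) UNIV"
  proof -
    have "(P\<^sup>2) powi tri n * (P * x\<^sup>2) powi n = P powi (n * n) * x powi (2 * n)" for n
      using two_tri_powi[OF P(2), of n] by (simp add: power_int_mult_distrib power2_powi mult.assoc[symmetric])
    then show ?thesis using jacobi_triple_product[OF P2, of "P * x\<^sup>2"] P x by (simp add: mult.assoc)
  qed
  have "(F has_sum (jtheta (- x) P * jtheta (P * x\<^sup>2) (P\<^sup>2))) UNIV"
  proof (rule has_sum_dilated_convolution[OF f g, of 2])
    fix s :: int
    have "((\<lambda>n. P powi tri s * x powi s * ((-1) powi n * (P ^ 6) powi tri n * (P powi (4 - 2 * s)) powi n)) has_sum F s) UNIV"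
      unfolding F_def by (intro has_sum_cmult_right jacobi_triple_product P6) (use P in auto)
    moreover have "P powi tri s * x powi s * ((-1) powi n * (P ^ 6) powi tri n * (P powi (4 - 2 * s)) powi n)
        = P powi tri (s - 2 * n) * x powi (s - 2 * n) * ((-1) powi n * (P powi (n * n) * x powi (2 * n)))" for n
    proof -
      have "tri (2 * n) = tri n + tri n + n * n" using tri_add[of n n] by simp
      then have "tri s + (6 * tri n + (4 - 2 * s) * n) = tri (s - 2 * n) + n * n"
        using two_tri[of n] by (simp add: tri_diff algebra_simps)
      then have 1: "P powi tri s * ((P ^ 6) powi tri n * (P powi (4 - 2 * s)) powi n) = P powi tri (s - 2 * n) * P powi (n * n)"
        using P by (simp add: powi_pow power_int_mult[symmetric] power_int_add[symmetric])
      have 2: "x powi s = x powi (s - 2 * n) * x powi (2 * n)" using x by (simp add: power_int_add[symmetric])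
      have "P powi tri s * x powi s * ((-1) powi n * (P ^ 6) powi tri n * (P powi (4 - 2 * s)) powi n)
        = (P powi tri s * ((P ^ 6) powi tri n * (P powi (4 - 2 * s)) powi n)) * x powi s * (-1) powi n" by (simp only: mult_ac)
      then show ?thesis unfolding 1 2 by (simp only: mult_ac)
    qed
    ultimately show "((\<lambda>n. P powi tri (s - 2 * n) * x powi (s - 2 * n) * ((-1) powi n * (P powi (n * n) * x powi (2 * n)))) has_sum F s) UNIV"
      by simp
  qed
  moreover have "(F has_sum (jtheta (P * x ^ 3) (P ^ 3) * E + x * jtheta (P\<^sup>2 * x ^ 3) (P ^ 3) * E)) UNIV"
  proof (rule has_sum_residue_pair[of 3])
    have P22: "P\<^sup>2 = P powi 2" "P ^ 4 = P powi 4" by (metis of_nat_numeral power_int_of_nat)+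
    have p6: "(P\<^sup>2) ^ 3 = P ^ 6" "(P\<^sup>2)\<^sup>2 = P ^ 4" by (simp_all add: power_mult[symmetric])
    have J: "jtheta (P powi 2) (P ^ 6) = E" "jtheta (P powi 4) (P ^ 6) = E"
      using jtheta_q_q3[OF P2] unfolding p6 P22[symmetric] E_def by auto
    have sh: "jtheta (P powi (a - 6 * t)) (P ^ 6) = (-1) powi t * P powi (a * t - 6 * tri t - 6 * t) * jtheta (P powi a) (P ^ 6)" for a t
    proof -
      have "P powi (a - 6 * t) = P powi a * (P ^ 6) powi (- t)" using P by (simp add: powi_pow power_int_add[symmetric])
      moreover have "(P ^ 6) powi (- tri (- t)) * (P powi a) powi t = P powi (a * t - 6 * tri t - 6 * t)"
        using P by (simp add: powi_pow power_int_mult[symmetric] power_int_add[symmetric] tri_minus algebra_simps)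
      ultimately show ?thesis
        using jtheta_shift[OF P6, of "P powi a" "- t"] P by (simp add: mult.assoc)
    qed
    have t3: "tri (3 * t) = 9 * tri t + 3 * t" for t
      by (rule tri_eqI) (use two_tri[of t] in \<open>simp add: algebra_simps\<close>)
    show "((\<lambda>t. F (3 * t)) has_sum jtheta (P * x ^ 3) (P ^ 3) * E) UNIV"
    proof -
      have "((\<lambda>t. (-1) powi t * (P ^ 3) powi tri t * (P * x ^ 3) powi t * E) has_sum jtheta (P * x ^ 3) (P ^ 3) * E) UNIV"
        by (intro has_sum_cmult_left jacobi_triple_product P3) (use P x in auto)
      moreover have "(-1) powi t * (P ^ 3) powi tri t * (P * x ^ 3) powi t * E = F (3 * t)" for t
      proof -
        have e: "4 - 2 * (3 * t) = 4 - 6 * t" by simp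
        have "P powi tri (3 * t) * P powi (4 * t - 6 * tri t - 6 * t) = (P ^ 3) powi tri t * P powi t"
          using P by (simp add: t3 powi_pow power_int_add[symmetric] add.commute)
        then have "F (3 * t) = (-1) powi t * ((P ^ 3) powi tri t * P powi t) * x powi (3 * t) * E"
          unfolding F_def e sh J by (simp add: mult_ac)
        then show ?thesis by (simp add: power_int_mult_distrib powi_pow mult_ac)
      qed
      ultimately show ?thesis by simp
    qed
    show "((\<lambda>t. F (3 * t + 1)) has_sum x * jtheta (P\<^sup>2 * x ^ 3) (P ^ 3) * E) UNIV"
    proof -
      have "((\<lambda>t. x * ((-1) powi t * (P ^ 3) powi tri t * (P\<^sup>2 * x ^ 3) powi t) * E) has_sum x * jtheta (P\<^sup>2 * x ^ 3) (P ^ 3) * E) UNIV"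
        by (intro has_sum_cmult_left has_sum_cmult_right jacobi_triple_product P3) (use P x in auto)
      moreover have "x * ((-1) powi t * (P ^ 3) powi tri t * (P\<^sup>2 * x ^ 3) powi t) * E = F (3 * t + 1)" for t
      proof -
        have e: "4 - 2 * (3 * t + 1) = 2 - 6 * t" by simp
        have t4: "tri (3 * t + 1) = 9 * tri t + 6 * t" using tri_Suc[of "3 * t"] t3 by simp
        have "P powi tri (3 * t + 1) * P powi (2 * t - 6 * tri t - 6 * t) = (P ^ 3) powi tri t * P powi (2 * t)"
          unfolding t4 using P by (simp add: powi_pow power_int_add[symmetric] add.commute)
        then have "F (3 * t + 1) = (-1) powi t * ((P ^ 3) powi tri t * P powi (2 * t)) * x powi (3 * t + 1) * E"
          unfolding F_def e sh J by (simp add: mult_ac)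
        moreover have "x powi (3 * t + 1) = x powi (3 * t) * x" using x by (simp add: power_int_add)
        ultimately show ?thesis by (simp add: power_int_mult_distrib powi_pow power2_powi mult_ac)
      qed
      ultimately show ?thesis by simp
    qed
    fix s :: int assume "\<not> 3 dvd s" "\<not> 3 dvd (s - 1)"
    then have "s = 3 * (s div 3) + 2" by presburger
    then obtain t where s: "s = 3 * t + 2" by blast
    have e: "4 - 2 * (3 * t + 2) = 0 - 6 * t" by simp
    have "jtheta 1 (P ^ 6) = 0" using jtheta_powi_zero[OF P6, of 0] by simp
    then show "F s = 0" unfolding F_def s e sh by simp
  qed simp
  ultimately have "jtheta (- x) P * jtheta (P * x\<^sup>2) (P\<^sup>2) = jtheta (P * x ^ 3) (P ^ 3) * E + x * jtheta (P\<^sup>2 * x ^ 3) (P ^ 3) * E"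
    by (rule has_sum_unique)
  then show ?thesis by (simp add: E_def algebra_simps)
qed

text \<open>The method of the quintuple product along the lines m + n = s: the inner theta series
  has base P^2 and depends essentially on s modulo 2, so even and odd s give the two terms.\<close>

theorem theta_product_split:
  fixes P x y :: complex
  assumes P: "norm P < 1" "P \<noteq> 0" and x: "x \<noteq> 0" and y: "y \<noteq> 0"
  shows "jtheta x P * jtheta y P = jtheta (- (x * y)) (P\<^sup>2) * jtheta (- (P * y / x)) (P\<^sup>2)
    - x * jtheta (- (P * x * y)) (P\<^sup>2) * jtheta (- (y / x)) (P\<^sup>2)"
proof -
  note P2 = pow_bounds[OF P, of 2, OF zero_less_numeral]
  define F where "F s = (-1) powi s * P powi tri s * x powi s * jtheta (- (y / x) * P powi (1 - s)) (P\<^sup>2)" for s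
  have f: "((\<lambda>m. (-1) powi m * P powi tri m * z powi m) has_sum jtheta z P) UNIV" if "z \<noteq> 0" for z
    by (rule jacobi_triple_product[OF P that])
  note th = jacobi_triple_plus[OF P2]
  have "(F has_sum (jtheta x P * jtheta y P)) UNIV"
  proof (rule has_sum_dilated_convolution[OF f[OF x] f[OF y], of 1])
    fix s :: int
    have "((\<lambda>n. (-1) powi s * P powi tri s * x powi s * ((P\<^sup>2) powi tri n * (y / x * P powi (1 - s)) powi n)) has_sum F s) UNIV"
      unfolding F_def mult_minus_left by (intro has_sum_cmult_right th) (use P x y in auto)
    moreover have "(-1) powi s * P powi tri s * x powi s * ((P\<^sup>2) powi tri n * (y / x * P powi (1 - s)) powi n)
       = (-1) powi (s - 1 * n) * P powi tri (s - 1 * n) * x powi (s - 1 * n) * ((-1) powi n * P powi tri n * y powi n)" for n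
    proof -
      have t: "tri s + (2 * tri n + (1 - s) * n) = tri (s - n) + tri n"
        by (simp add: tri_diff algebra_simps)
      have "P powi tri s * ((P\<^sup>2) powi tri n * (P powi (1 - s)) powi n) = P powi (tri s + (2 * tri n + (1 - s) * n))"
        using P by (simp add: power2_powi power_int_mult[symmetric] power_int_add)
      also have "\<dots> = P powi tri (s - n) * P powi tri n"
        unfolding t using P by (simp add: power_int_add)
      finally have 1: "P powi tri s * ((P\<^sup>2) powi tri n * (P powi (1 - s)) powi n) = P powi tri (s - n) * P powi tri n" .
      have 2: "x powi s * (y / x) powi n = x powi (s - n) * y powi n"
        using x by (simp add: power_int_divide_distrib power_int_diff)
      have 3: "(-1 :: complex) powi s = (-1) powi (s - n) * (-1) powi n" by (simp flip: power_int_add)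
      have "(-1) powi s * P powi tri s * x powi s * ((P\<^sup>2) powi tri n * (y / x * P powi (1 - s)) powi n)
        = (-1) powi s * (P powi tri s * ((P\<^sup>2) powi tri n * (P powi (1 - s)) powi n)) * (x powi s * (y / x) powi n)"
        by (simp only: power_int_mult_distrib mult_ac)
      then show ?thesis unfolding 1 2 3 by (simp add: mult_ac)
    qed
    ultimately show "((\<lambda>n. (-1) powi (s - 1 * n) * P powi tri (s - 1 * n) * x powi (s - 1 * n) * ((-1) powi n * P powi tri n * y powi n)) has_sum F s) UNIV"
      by simp
  qed
  moreover have "(F has_sum (jtheta (- (x * y)) (P\<^sup>2) * jtheta (- (P * y / x)) (P\<^sup>2) + - (x * jtheta (- (P * x * y)) (P\<^sup>2) * jtheta (- (y / x)) (P\<^sup>2)))) UNIV"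
  proof (rule has_sum_residue_pair[of 2])
    have sh: "jtheta (- (y / x) * P powi (a - 2 * t)) (P\<^sup>2) = P powi (a * t - 2 * tri t - 2 * t) * (y / x) powi t * jtheta (- (y / x) * P powi a) (P\<^sup>2)" for a t
    proof -
      have e: "- (y / x) * P powi (a - 2 * t) = - (y / x * P powi a) * (P\<^sup>2) powi (- t)"
        using P by (simp add: power2_powi power_int_add[symmetric] mult.assoc)
      have a1: "(-1 :: complex) powi (- t) * (- (y / x * P powi a)) powi t = (y / x) powi t * (P powi a) powi t"
      proof -
        have "(-1 :: complex) powi (- t) * (- (y / x * P powi a)) powi t = ((-1) powi t * (-1) powi t) * ((y / x) powi t * (P powi a) powi t)"
          unfolding minus_powi[of "y / x * P powi a"] power_int_mult_distrib m1_powi_minus by (simp only: mult_ac)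
        then show ?thesis unfolding m1_powi_sq by simp
      qed
      have a2: "(P\<^sup>2) powi (- tri (- t)) * (P powi a) powi t = P powi (a * t - 2 * tri t - 2 * t)"
        using P by (simp add: power2_powi power_int_mult[symmetric] power_int_add[symmetric] tri_minus algebra_simps)
      have "jtheta (- (y / x) * P powi (a - 2 * t)) (P\<^sup>2) = (-1) powi (- t) * (P\<^sup>2) powi (- tri (- t)) * (- (y / x * P powi a)) powi t * jtheta (- (y / x) * P powi a) (P\<^sup>2)"
        unfolding e using jtheta_shift[OF P2, of "- (y / x * P powi a)" "- t"] P x y by simp
      also have "\<dots> = (P\<^sup>2) powi (- tri (- t)) * ((-1) powi (- t) * (- (y / x * P powi a)) powi t) * jtheta (- (y / x) * P powi a) (P\<^sup>2)"
        by (simp only: mult_ac)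
      also have "\<dots> = ((P\<^sup>2) powi (- tri (- t)) * (P powi a) powi t) * (y / x) powi t * jtheta (- (y / x) * P powi a) (P\<^sup>2)"
        unfolding a1 by (simp only: mult_ac)
      finally show ?thesis unfolding a2 .
    qed
    have t2: "tri (2 * t) = 4 * tri t + t" for t
      by (rule tri_eqI) (use two_tri[of t] in \<open>simp add: algebra_simps\<close>)
    have m2: "(-1 :: complex) powi (2 * t) = 1" for t
      by (simp only: power_int_mult) simp
    have w: "- (y / x) * P powi 1 = - (P * y / x)" "- (y / x) * P powi 0 = - (y / x)" by simp_all
    show "((\<lambda>t. F (2 * t)) has_sum jtheta (- (x * y)) (P\<^sup>2) * jtheta (- (P * y / x)) (P\<^sup>2)) UNIV"
    proof -
      have "((\<lambda>t. (P\<^sup>2) powi tri t * (x * y) powi t * jtheta (- (P * y / x)) (P\<^sup>2)) has_sum jtheta (- (x * y)) (P\<^sup>2) * jtheta (- (P * y / x)) (P\<^sup>2)) UNIV"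
        by (intro has_sum_cmult_left th) (use x y in auto)
      moreover have "(P\<^sup>2) powi tri t * (x * y) powi t * jtheta (- (P * y / x)) (P\<^sup>2) = F (2 * t)" for t
      proof -
        have 1: "P powi tri (2 * t) * P powi (1 * t - 2 * tri t - 2 * t) = (P\<^sup>2) powi tri t"
          using P by (simp add: t2 power2_powi power_int_add[symmetric])
        have "x\<^sup>2 * (y / x) = x * y" using x by (simp add: power2_eq_square)
        then have 2: "x powi (2 * t) * (y / x) powi t = (x * y) powi t"
          unfolding power2_powi[symmetric] power_int_mult_distrib[symmetric] by simp
        have "F (2 * t) = (P powi tri (2 * t) * P powi (1 * t - 2 * tri t - 2 * t)) * (x powi (2 * t) * (y / x) powi t) * jtheta (- (y / x) * P powi 1) (P\<^sup>2)"
          unfolding F_def sh m2 by (simp only: mult_ac mult_1_left)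
        then show ?thesis unfolding 1 2 w by simp
      qed
      ultimately show ?thesis by simp
    qed
    show "((\<lambda>t. F (2 * t + 1)) has_sum - (x * jtheta (- (P * x * y)) (P\<^sup>2) * jtheta (- (y / x)) (P\<^sup>2))) UNIV"
    proof -
      have "((\<lambda>t. - (x * ((P\<^sup>2) powi tri t * (P * x * y) powi t) * jtheta (- (y / x)) (P\<^sup>2))) has_sum - (x * jtheta (- (P * x * y)) (P\<^sup>2) * jtheta (- (y / x)) (P\<^sup>2))) UNIV"
        by (intro has_sum_uminusI has_sum_cmult_left has_sum_cmult_right th) (use P x y in auto)
      moreover have "- (x * ((P\<^sup>2) powi tri t * (P * x * y) powi t) * jtheta (- (y / x)) (P\<^sup>2)) = F (2 * t + 1)" for t
      proof -
        have e: "1 - (2 * t + 1) = 0 - 2 * t" by simp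
        have 1: "P powi tri (2 * t + 1) * P powi (0 * t - 2 * tri t - 2 * t) = (P\<^sup>2) powi tri t * P powi t"
          using P tri_Suc[of "2 * t"] by (simp add: t2 power2_powi power_int_add[symmetric])
        have "x\<^sup>2 * (y / x) = x * y" using x by (simp add: power2_eq_square)
        then have "x powi (2 * t) * (y / x) powi t = (x * y) powi t"
          unfolding power2_powi[symmetric] power_int_mult_distrib[symmetric] by simp
        moreover have "x powi (2 * t + 1) = x * x powi (2 * t)" using x by (simp add: power_int_add)
        ultimately have 2: "x powi (2 * t + 1) * (y / x) powi t = x * (x * y) powi t" by simp
        have "F (2 * t + 1) = - ((P powi tri (2 * t + 1) * P powi (0 * t - 2 * tri t - 2 * t)) * (x powi (2 * t + 1) * (y / x) powi t) * jtheta (- (y / x) * P powi 0) (P\<^sup>2))"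
          unfolding F_def e sh m1_powi_Suc m2 by (simp only: mult_ac mult_1_left mult_minus_left mult_minus_right)
        then show ?thesis unfolding 1 2 w by (simp add: power_int_mult_distrib mult_ac)
      qed
      ultimately show ?thesis by simp
    qed
    show "F s = 0" if "\<not> 2 dvd s" "\<not> 2 dvd (s - 1)" for s using that by presburger
  qed simp
  ultimately show ?thesis using has_sum_unique by fastforce
qed

section \<open>Eta quotients and theta values at powers of q\<close>

context
  fixes q :: complex
  assumes q: "norm q < 1" "q \<noteq> 0"
begin

lemma J_eq: "J a q = qpoch_inf (q ^ a) (q ^ a)"
  unfolding J_def qpoch_inf_def by (simp add: power_mult[symmetric] power_add[symmetric] add.commute)

lemma J_nz: "a > 0 \<Longrightarrow> J a q \<noteq> 0"
  unfolding J_eq by (intro qpoch_self_nonzero pow_bounds q)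

lemma qpoch_odd:
  assumes "a > 0"
  shows "qpoch_inf (q ^ a) (q ^ (2 * a)) * J (2 * a) q = J a q"
  using qpoch_inf_dissect[OF pow_bounds(1)[OF q assms], of 2 "q ^ a"]
  by (simp add: J_eq numeral_2_eq_2 power_mult[symmetric] power_add[symmetric] mult_2_right)

lemma qpoch_odd_plus:
  assumes "a > 0"
  shows "qpoch_inf (- (q ^ a)) (q ^ (2 * a)) * (J a q * J (4 * a) q) = J (2 * a) q ^ 2"
proof -
  have 2: "2 * a > 0" using assms by simp
  have "qpoch_inf (q ^ a) (q ^ (2 * a)) * qpoch_inf (- (q ^ a)) (q ^ (2 * a)) = qpoch_inf (q ^ (2 * a)) (q ^ (2 * (2 * a)))"
    using qpoch_inf_plus_minus[OF pow_bounds(1)[OF q 2], of "q ^ a"] by (simp add: power_mult[symmetric] mult.commute)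
  then have "(qpoch_inf (q ^ a) (q ^ (2 * a)) * J (2 * a) q) * qpoch_inf (- (q ^ a)) (q ^ (2 * a)) * J (2 * (2 * a)) q
     = (qpoch_inf (q ^ (2 * a)) (q ^ (2 * (2 * a))) * J (2 * (2 * a)) q) * J (2 * a) q"
    by (simp add: mult_ac)
  then have "J a q * qpoch_inf (- (q ^ a)) (q ^ (2 * a)) * J (2 * (2 * a)) q = J (2 * a) q * J (2 * a) q"
    unfolding qpoch_odd[OF assms] qpoch_odd[OF 2] .
  then show ?thesis by (simp add: power2_eq_square mult_ac)
qed

lemma jtheta_pow: "a < b \<Longrightarrow> jtheta (q ^ a) (q ^ b) = qpoch_inf (q ^ a) (q ^ b) * qpoch_inf (q ^ (b - a)) (q ^ b) * J b q"
  using q by (simp add: jtheta_def J_eq power_diff)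

lemma jtheta_neg_pow: "a < b \<Longrightarrow> jtheta (- (q ^ a)) (q ^ b) = qpoch_inf (- (q ^ a)) (q ^ b) * qpoch_inf (- (q ^ (b - a))) (q ^ b) * J b q"
  using q by (simp add: jtheta_def J_eq power_diff)

lemma jtheta_minus_1:
  assumes "a > 0"
  shows "jtheta (- 1) (q ^ a) * J a q = 2 * J (2 * a) q ^ 2"
proof -
  have m: "qpoch_inf (- 1) (q ^ a) = 2 * qpoch_inf (- (q ^ a)) (q ^ a)"
    using qpoch_inf_rec[OF pow_bounds(1)[OF q assms], of "-1"] by simp
  have e: "J a q * qpoch_inf (- (q ^ a)) (q ^ a) = J (2 * a) q"
    using qpoch_inf_plus_minus[OF pow_bounds(1)[OF q assms], of "q ^ a"] by (simp add: J_eq power_mult[symmetric] mult.commute)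
  have "jtheta (- 1) (q ^ a) * J a q = 2 * ((J a q * qpoch_inf (- (q ^ a)) (q ^ a)) * (J a q * qpoch_inf (- (q ^ a)) (q ^ a)))"
    by (simp add: jtheta_def m J_eq mult_ac)
  then show ?thesis unfolding e by (simp add: power2_eq_square)
qed

text \<open>The quintuple product with P = q^16 and x = -q^(2s), once the second theta function of
  the numerator has been reflected by z -> q^48/z.\<close>

theorem char_num_quintuple:
  assumes s: "s \<in> {1,2,3}"
  shows "char_num q s q = jtheta (q powi (2 * s)) (q ^ 16) * jtheta (q powi (16 + 4 * s)) (q ^ 32) / J 32 q"
proof -
  have n: "nat (2 * s) = nat (2 * s)" by simp
  define x where "x = - (q powi (2 * s))"
  have q16: "q ^ 16 = q powi 16" "q ^ 48 = q powi 48" by (metis of_nat_numeral power_int_of_nat)+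
  have x2: "x\<^sup>2 = q powi (4 * s)" "x ^ 3 = - (q powi (6 * s))"
    using q by (simp_all add: x_def power2_eq_square power3_eq_cube power_int_add[symmetric])
  have c1: "q ^ 16 * x\<^sup>2 = q powi (16 + 4 * s)" "q ^ 16 * x ^ 3 = - (q powi (16 + 6 * s))"
    unfolding x2 q16 mult_minus_right power_int_add[OF disjI1[OF q(2)]] by simp_all
  have c2: "q ^ 32 * x ^ 3 = - (q powi (32 + 6 * s))"
  proof -
    have "q ^ 32 = q powi 32" by (metis of_nat_numeral power_int_of_nat)
    then show ?thesis unfolding x2 mult_minus_right power_int_add[OF disjI1[OF q(2)]] by simp
  qed
  have p: "(q ^ 16)\<^sup>2 = q ^ 32" "(q ^ 16) ^ 3 = q ^ 48" by (simp_all add: power_mult[symmetric])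
  have "jtheta (q powi (2 * s)) (q ^ 16) * jtheta (q powi (16 + 4 * s)) (q ^ 32)
     = J 32 q * (jtheta (- (q powi (16 + 6 * s))) (q ^ 48) - q powi (2 * s) * jtheta (- (q powi (32 + 6 * s))) (q ^ 48))"
    using quintuple_product[OF pow_bounds[OF q, of 16], of x] q unfolding p c1 c2 by (simp add: x_def J_eq)
  moreover have "char_num q s q = jtheta (- (q powi (16 + 6 * s))) (q ^ 48) - q powi (2 * s) * jtheta (- (q powi (32 + 6 * s))) (q ^ 48)"
  proof -
    have a: "q powi (6 * s + 24) * q powi (-8) = q powi (16 + 6 * s)" "q powi (24 - 6 * s) * q powi (-8) = q powi (16 - 6 * s)"
      using q by (simp_all add: power_int_add[symmetric] algebra_simps)
    have "q ^ 48 / - (q powi (16 - 6 * s)) = - (q powi (32 + 6 * s))"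
      unfolding q16 divide_minus_right power_int_diff[OF disjI1[OF q(2)], symmetric] by simp
    then have "jtheta (- (q powi (16 - 6 * s))) (q ^ 48) = jtheta (- (q powi (32 + 6 * s))) (q ^ 48)"
      using jtheta_reflect[of "q ^ 48" "- (q powi (16 - 6 * s))"] q by simp
    then show ?thesis unfolding char_num_def a by simp
  qed
  ultimately show ?thesis using J_nz[of 32] by simp
qed

end

lemma pow_powi: "(q ^ n) powi k = (q powi k) ^ n" for q :: complex
  by (metis mult.commute power_int_mult power_int_of_nat)

lemma J_power: "J a (q ^ n) = J (n * a) q"
  by (simp add: J_def power_mult[symmetric] mult.assoc distrib_left)

context
  fixes q :: complex
  assumes q: "norm q < 1" "q \<noteq> 0"
begin

lemma minus_pow_pole: "n > 0 \<Longrightarrow> (-1) * (q ^ n) powi k \<noteq> 1"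
  by (rule unit_q_powi_ne_1[OF pow_bounds[OF q]]) auto

lemma kronecker_minus:
  assumes "0 < a" "a < b"
  shows "((\<lambda>n. (- (q ^ a)) powi n / (1 + (q ^ b) powi n)) has_sum
    (J b q ^ 3 * jtheta (q ^ a) (q ^ b) / (jtheta (- (q ^ a)) (q ^ b) * jtheta (- 1) (q ^ b)))) UNIV"
proof -
  have b: "b > 0" using assms by simp
  have x: "norm (q ^ b) < norm (- (q ^ a))" "norm (- (q ^ a)) < 1"
    using assms q by (auto simp: norm_power power_less_one_iff intro!: power_strict_decreasing)
  show ?thesis
    using kronecker_theta[OF pow_bounds[OF q b] x, of "-1"] minus_pow_pole[OF b] by (simp add: J_eq[OF q])
qed

lemma theta_ratio_eta:
  "J 2 q ^ 3 * jtheta (q ^ 1) (q ^ 2) / (jtheta (- (q ^ 1)) (q ^ 2) * jtheta (- 1) (q ^ 2)) = J 1 q ^ 4 / (2 * J 2 q ^ 2)"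
  "J 1 q ^ 3 / jtheta (- 1) q = J 1 q ^ 4 / (2 * J 2 q ^ 2)"
proof -
  note nz = J_nz[OF q]
  have nz': "J 1 q \<noteq> 0" "J 2 q \<noteq> 0" "J 4 q \<noteq> 0" by (rule nz; simp)+
  have 12: "2 * 1 = (2::nat)" "4 * 1 = (4::nat)" "2 * 2 = (4::nat)" by simp_all
  have A: "qpoch_inf (q ^ 1) (q ^ 2) * J 2 q = J 1 q" using qpoch_odd[OF q, of 1] unfolding 12 by simp
  have P: "qpoch_inf (- (q ^ 1)) (q ^ 2) * (J 1 q * J 4 q) = J 2 q ^ 2" using qpoch_odd_plus[OF q, of 1] unfolding 12 by simp
  have m: "jtheta (- 1) (q ^ 2) * J 2 q = 2 * J 4 q ^ 2" using jtheta_minus_1[OF q, of 2] unfolding 12 by simp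
  have "jtheta (q ^ 1) (q ^ 2) = qpoch_inf (q ^ 1) (q ^ 2) ^ 2 * J 2 q"
    using jtheta_pow[OF q, of 1 2] by (simp add: power2_eq_square[of "qpoch_inf _ _"])
  then have A': "jtheta (q ^ 1) (q ^ 2) = (J 1 q / J 2 q) ^ 2 * J 2 q"
    using A nz' by (metis nonzero_eq_divide_eq)
  have "jtheta (- (q ^ 1)) (q ^ 2) = qpoch_inf (- (q ^ 1)) (q ^ 2) ^ 2 * J 2 q"
    using jtheta_neg_pow[OF q, of 1 2] by (simp add: power2_eq_square[of "qpoch_inf _ _"])
  then have P': "jtheta (- (q ^ 1)) (q ^ 2) = (J 2 q ^ 2 / (J 1 q * J 4 q)) ^ 2 * J 2 q"
    using P nz' by (metis nonzero_eq_divide_eq mult_eq_0_iff)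
  have m': "jtheta (- 1) (q ^ 2) = 2 * J 4 q ^ 2 / J 2 q"
    using m nz' by (metis nonzero_eq_divide_eq)
  show "J 2 q ^ 3 * jtheta (q ^ 1) (q ^ 2) / (jtheta (- (q ^ 1)) (q ^ 2) * jtheta (- 1) (q ^ 2)) = J 1 q ^ 4 / (2 * J 2 q ^ 2)"
    unfolding A' P' m'
    using nz' by (simp add: field_simps power2_eq_square power3_eq_cube power4_eq_xxxx)
  have "jtheta (- 1) q * J 1 q = 2 * J 2 q ^ 2" using jtheta_minus_1[OF q, of 1] unfolding 12 by simp
  then have m1: "jtheta (- 1) q = 2 * J 2 q ^ 2 / J 1 q" using nz' by (metis nonzero_eq_divide_eq)
  show "J 1 q ^ 3 / jtheta (- 1) q = J 1 q ^ 4 / (2 * J 2 q ^ 2)"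
    unfolding m1 using nz' by (simp add: field_simps power2_eq_square power3_eq_cube power4_eq_xxxx)
qed

text \<open>Kronecker's sum of base q^2 and the quotient on the right are both J_1^4/(2 J_2^2). This
  form of K, and of K3 after q -> q^3, makes the two comparable through the denominators 1 + q^(2n)
  and 1 + q^(6n).\<close>

lemma lambert_K: "((\<lambda>n. (- q) powi n / (1 + (q ^ 2) powi n)) has_sum (J 1 q ^ 3 / jtheta (- 1) q)) UNIV"
  using kronecker_minus[of 1 2] unfolding theta_ratio_eta by simp

end

context
  fixes q K K3 :: complex
  assumes q: "norm q < 1" "q \<noteq> 0"
    and K: "K = J 1 q ^ 3 / jtheta (- 1) q" and K3: "K3 = J 3 q ^ 3 / jtheta (- 1) (q ^ 3)"
begin

text \<open>With u = q^n one has u/(1 + u^2) = (u - u^3 + u^5)/(1 + u^6). Summed with the signs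
  (-1)^n, the middle term gives K3 and the outer two agree under n -> -n, whence K = 2L - K3. The
  two combinations wanted are therefore multiples of K3 + L and K3 - L.\<close>

lemma eta_identities:
  "(3 * K3 + K) / (2 * J 1 q) = J 3 q * J 4 q ^ 3 / (J 2 q ^ 2 * J 12 q)"
  "3 * (K3 - K) / (2 * J 1 q) * J 4 q = 3 * q * (J 3 q * J 12 q ^ 3 / J 6 q ^ 2)"
proof -
  note q3 = pow_bounds[OF q, of 3, OF zero_less_numeral]
  have nz: "J 1 q \<noteq> 0" "J 2 q \<noteq> 0" "J 3 q \<noteq> 0" "J 4 q \<noteq> 0" "J 6 q \<noteq> 0" "J 12 q \<noteq> 0"
    by (rule J_nz[OF q]; simp)+
  define C where "C = J 6 q ^ 3 / jtheta (- 1) (q ^ 6)"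
  define j1 where "j1 = jtheta (q ^ 1) (q ^ 6)"
  define j3 where "j3 = jtheta (q ^ 3) (q ^ 6)"
  define m1 where "m1 = jtheta (- (q ^ 1)) (q ^ 6)"
  define m3 where "m3 = jtheta (- (q ^ 3)) (q ^ 6)"
  define S where "S = jtheta (q ^ 2) (q ^ 12)"
  have pole: "(q ^ n) powi k \<noteq> -1" if "n > 0" for n k
    using minus_pow_pole[OF q that, of k] by (metis mult_minus1 minus_minus)
  have K3s: "((\<lambda>n. (- (q ^ 3)) powi n / (1 + (q ^ 6) powi n)) has_sum K3) UNIV"
    using lambert_K[OF q3] unfolding K3 J_power by (simp add: power_mult[symmetric])
  have Ks: "((\<lambda>n. (- q) powi n / (1 + (q ^ 2) powi n)) has_sum K) UNIV"
    unfolding K by (rule lambert_K[OF q])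
  have K3v: "K3 = C * j3 / m3"
    using has_sum_unique[OF K3s kronecker_minus[OF q, of 3 6]] by (simp add: C_def j3_def m3_def)
  define L where "L = C * j1 / m1"
  have Ls: "((\<lambda>n. (- q) powi n / (1 + (q ^ 6) powi n)) has_sum L) UNIV"
    using kronecker_minus[OF q, of 1 6] by (simp add: C_def j1_def m1_def L_def mult_ac)
  have Ls': "((\<lambda>n. (- q) powi n * (q powi n) ^ 4 / (1 + (q ^ 6) powi n)) has_sum L) UNIV"
  proof (rule has_sum_reindex_bij_witness[of _ uminus uminus, THEN iffD1, OF _ _ _ _ _ _ Ls])
    fix n :: int
    define u where "u = q powi n"
    have u0: "u \<noteq> 0" using q by (simp add: u_def)
    have e: "(q ^ 6) powi n = u ^ 6" by (simp add: u_def pow_powi)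
    have s: "u ^ 6 + 1 \<noteq> 0" using pole[of 6 n] unfolding e by (simp add: add_eq_0_iff2)
    have "inverse u * inverse u ^ 4 / (1 + inverse (u ^ 6)) = u / (1 + u ^ 6)"
    proof -
      have "1 + inverse (u ^ 6) = (u ^ 6 + 1) / u ^ 6" using u0 by (simp add: field_simps)
      moreover have "inverse u * inverse u ^ 4 / (t / u ^ 6) = u / t" for t
        using u0 by (cases "t = 0") (simp_all add: field_simps eval_nat_numeral)
      ultimately show ?thesis by (simp add: add.commute)
    qed
    then have "(-1) powi n * (inverse u * inverse u ^ 4 / (1 + inverse (u ^ 6))) = (-1) powi n * (u / (1 + u ^ 6))" by simp
    then show "(- q) powi (- n) * (q powi (- n)) ^ 4 / (1 + (q ^ 6) powi (- n)) = (- q) powi n / (1 + (q ^ 6) powi n)"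
      unfolding minus_powi[of q] power_int_minus[of q] power_int_minus[of "q ^ 6"] e u_def[symmetric] m1_powi_minus by (simp add: mult.assoc)
  qed auto
  have "((\<lambda>n. (- q) powi n / (1 + (q ^ 6) powi n) - (- (q ^ 3)) powi n / (1 + (q ^ 6) powi n) + (- q) powi n * (q powi n) ^ 4 / (1 + (q ^ 6) powi n))
     has_sum (L - K3 + L)) UNIV"
    by (intro has_sum_add has_sum_diff Ls K3s Ls')
  moreover have "(- q) powi n / (1 + (q ^ 6) powi n) - (- (q ^ 3)) powi n / (1 + (q ^ 6) powi n) + (- q) powi n * (q powi n) ^ 4 / (1 + (q ^ 6) powi n)
     = (- q) powi n / (1 + (q ^ 2) powi n)" for n
  proof -
    define u where "u = q powi n"
    have e: "(q ^ 6) powi n = u ^ 6" "(q ^ 2) powi n = u ^ 2" "(q ^ 3) powi n = u ^ 3"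
      by (simp_all add: u_def pow_powi)
    have nz: "1 + u ^ 6 \<noteq> 0" "1 + u ^ 2 \<noteq> 0"
      using pole[of 6 n] pole[of 2 n] unfolding e by (auto simp: add_eq_0_iff)
    have "(u - u ^ 3 + u * u ^ 4) * (1 + u ^ 2) = u * (1 + u ^ 6)"
      by (simp add: algebra_simps eval_nat_numeral)
    then have "(u - u ^ 3 + u * u ^ 4) / (1 + u ^ 6) = u / (1 + u ^ 2)" using nz by (simp add: frac_eq_eq)
    then have "(-1) powi n * ((u - u ^ 3 + u * u ^ 4) / (1 + u ^ 6)) = (-1) powi n * (u / (1 + u ^ 2))" by simp
    then show ?thesis
      unfolding minus_powi[of q] minus_powi[of "q ^ 3"] e u_def[symmetric]
      by (simp add: add_divide_distrib diff_divide_distrib distrib_left right_diff_distrib mult.assoc)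
  qed
  ultimately have "((\<lambda>n. (- q) powi n / (1 + (q ^ 2) powi n)) has_sum (L - K3 + L)) UNIV" by simp
  then have KL: "K = 2 * L - K3" using has_sum_unique[OF Ks] by fastforce
  note q6 = pow_bounds[OF q, of 6, OF zero_less_numeral]
  have p12: "(q ^ 6)\<^sup>2 = q ^ 12" by (simp add: power_mult[symmetric])
  have q4: "jtheta (q ^ 4) (q ^ 12) = J 4 q" "jtheta (q ^ 8) (q ^ 12) = J 4 q"
    using jtheta_q_q3[OF pow_bounds[OF q, of 4, OF zero_less_numeral]] by (simp_all add: power_mult[symmetric] J_eq[OF q])
  have q10: "jtheta (q ^ 10) (q ^ 12) = S"
  proof -
    have "q ^ 12 / q ^ 2 = q ^ 10" using q power_diff[of q 2 12] by simp
    then show ?thesis using jtheta_reflect[of "q ^ 12" "q ^ 2"] q unfolding S_def by simp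
  qed
  have dv: "q ^ 6 * q ^ 3 / q = q ^ 8" "q ^ 9 / q = q ^ 8" "q ^ 3 / q = q ^ 2" "q * q ^ 3 = q ^ 4" "q ^ 6 * q * q ^ 3 = q ^ 10"
    using q by (simp_all add: eval_nat_numeral)
  \<comment> \<open>In base q^6 the pairs (-q, q^3) and (q, -q^3) split into the same theta
    functions of base q^12, with opposite signs in the second term. Thus K3 + L retains J_4^2 and K3
    - L retains q S^2.\<close>
  have s1: "m1 * j3 = J 4 q ^ 2 + q * S ^ 2"
    using theta_product_split[OF q6, of "- q" "q ^ 3"] q
    by (simp add: m1_def j3_def p12 dv q4 q10 S_def[symmetric] power2_eq_square[of "J 4 q"] power2_eq_square[of S] mult.assoc)
  have s2: "j1 * m3 = J 4 q ^ 2 - q * S ^ 2"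
    using theta_product_split[OF q6, of "q" "- (q ^ 3)"] q
    by (simp add: j1_def m3_def p12 dv q4 q10 S_def[symmetric] power2_eq_square[of "J 4 q"] power2_eq_square[of S] mult.assoc)
  define X where "X = qpoch_inf (- (q ^ 3)) (q ^ 6)"
  have X: "X = J 6 q ^ 2 / (J 3 q * J 12 q)" using qpoch_odd_plus[OF q, of 3] nz by (simp add: X_def field_simps)
  have 12: "2 * 1 = (2::nat)" "4 * 1 = (4::nat)" by simp_all
  have "qpoch_inf (- q) (q ^ 2) * (J 1 q * J 4 q) = J 2 q ^ 2" using qpoch_odd_plus[OF q, of 1] unfolding 12 by simp
  then have Z: "qpoch_inf (- q) (q ^ 2) = J 2 q ^ 2 / (J 1 q * J 4 q)" using nz by (metis nonzero_eq_divide_eq mult_eq_0_iff)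
  \<comment> \<open>The factors of (-q;q^2)_inf by residue modulo 6: Y takes the classes 1 and 5, X
    the class 3. Then \<open>m1\<close> times \<open>m3\<close> is Y X^3 up to J_6^2, which is an
    eta quotient although Y and X separate.\<close>
  define Y where "Y = qpoch_inf (- (q ^ 1)) (q ^ 6) * qpoch_inf (- (q ^ 5)) (q ^ 6)"
  have YX: "qpoch_inf (- q) (q ^ 2) = Y * X"
    using qpoch_inf_dissect[OF pow_bounds(1)[OF q, of 2], of 3 "- q"]
    by (simp add: Y_def X_def numeral_3_eq_3 power_mult[symmetric] power_add[symmetric]) (simp add: eval_nat_numeral mult_ac)
  have m1v: "m1 = Y * J 6 q" using jtheta_neg_pow[OF q, of 1 6] by (simp add: m1_def Y_def)
  have m3v: "m3 = X ^ 2 * J 6 q" using jtheta_neg_pow[OF q, of 3 6] by (simp add: m3_def X_def power2_eq_square)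
  have mm: "m1 * m3 = J 2 q ^ 2 / (J 1 q * J 4 q) * (J 6 q ^ 2 / (J 3 q * J 12 q)) * J 6 q ^ 2"
    unfolding m1v m3v Z[symmetric] YX X[symmetric] by (simp add: power2_eq_square mult_ac)
  have mm0: "m1 \<noteq> 0" "m3 \<noteq> 0" using mm nz by (metis (no_types, lifting) divide_eq_0_iff mult_eq_0_iff power_not_zero)+
  have Cv: "C = J 6 q ^ 4 / (2 * J 12 q ^ 2)"
  proof -
    have M: "jtheta (- 1) (q ^ 6) = 2 * J 12 q ^ 2 / J 6 q" using jtheta_minus_1[OF q, of 6] nz by (simp add: field_simps)
    show ?thesis
      unfolding C_def M using nz by (simp add: field_simps power2_eq_square power3_eq_cube power4_eq_xxxx)
  qed
  have Sv: "S = J 2 q * J 12 q ^ 2 / (J 4 q * J 6 q)"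
  proof -
    define s where "s = qpoch_inf (q ^ 2) (q ^ 12) * qpoch_inf (q ^ 10) (q ^ 12)"
    have i3: "{..<3} = {0, 1, 2::nat}" by auto
    have ex: "q ^ 2 * q ^ 4 = q ^ 6" "q ^ 2 * q ^ 8 = q ^ 10" by (simp_all flip: power_add)
    have "qpoch_inf (q ^ 2) (q ^ 4) = s * qpoch_inf (q ^ 6) (q ^ 12)"
      using qpoch_inf_dissect[OF pow_bounds(1)[OF q, of 4], of 3 "q ^ 2"]
      unfolding i3 by (simp add: s_def ex power_mult[symmetric] mult_ac)
    moreover have "qpoch_inf (q ^ 2) (q ^ 4) = J 2 q / J 4 q" "qpoch_inf (q ^ 6) (q ^ 12) = J 6 q / J 12 q"
      using qpoch_odd[OF q, of 2] qpoch_odd[OF q, of 6] nz by (simp_all add: field_simps)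
    ultimately have "s = J 2 q / J 4 q * (J 12 q / J 6 q)" using nz by (simp add: field_simps)
    moreover have "S = s * J 12 q" using jtheta_pow[OF q, of 2 12] by (simp add: S_def s_def)
    ultimately show ?thesis using nz by (simp add: field_simps power2_eq_square)
  qed
  have sum: "K3 + L = C * (2 * J 4 q ^ 2) / (m1 * m3)"
  proof -
    have "K3 + L = C * (m1 * j3 + j1 * m3) / (m1 * m3)" unfolding K3v L_def using mm0 by (simp add: field_simps)
    then show ?thesis unfolding s1 s2 by simp
  qed
  have dif: "K3 - L = C * (2 * (q * S ^ 2)) / (m1 * m3)"
  proof -
    have "K3 - L = C * (m1 * j3 - j1 * m3) / (m1 * m3)" unfolding K3v L_def using mm0 by (simp add: field_simps)
    then show ?thesis unfolding s1 s2 by simp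
  qed
  have "3 * K3 + K = 2 * (K3 + L)" unfolding KL by simp
  then have "(3 * K3 + K) / (2 * J 1 q) = (K3 + L) / J 1 q" by (simp only: mult_divide_mult_cancel_left[OF zero_neq_numeral[symmetric]])
  then show "(3 * K3 + K) / (2 * J 1 q) = J 3 q * J 4 q ^ 3 / (J 2 q ^ 2 * J 12 q)"
    unfolding sum mm Cv using nz by (simp add: field_simps eval_nat_numeral)
  have "K3 - K = 2 * (K3 - L)" unfolding KL by simp
  then have "3 * (K3 - K) / (2 * J 1 q) * J 4 q = 3 * (K3 - L) / J 1 q * J 4 q"
    by (simp only: mult.left_commute[of 3 2] mult_divide_mult_cancel_left[OF zero_neq_numeral[symmetric]])
  then show "3 * (K3 - K) / (2 * J 1 q) * J 4 q = 3 * q * (J 3 q * J 12 q ^ 3 / J 6 q ^ 2)"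
    unfolding dif mm Cv Sv using nz by (simp add: field_simps eval_nat_numeral)
qed

end

context
  fixes q :: complex
  assumes q: "norm q < 1" "q \<noteq> 0"
begin

lemma quintuple_4: "jtheta (q ^ 4) (q ^ 16) * jtheta (q ^ 24) (q ^ 32) / J 32 q = J 4 q"
proof -
  have nz: "J 4 q \<noteq> 0" "J 8 q \<noteq> 0" "J 16 q \<noteq> 0" "J 32 q \<noteq> 0" by (rule J_nz[OF q]; simp)+
  have a: "qpoch_inf (q ^ 4) (q ^ 16) * qpoch_inf (q ^ 12) (q ^ 16) = J 4 q / J 8 q"
  proof -
    have "qpoch_inf (q ^ 4) (q ^ 8) = qpoch_inf (q ^ 4) (q ^ 16) * qpoch_inf (q ^ 12) (q ^ 16)"
      using qpoch_inf_dissect[OF pow_bounds(1)[OF q, of 8], of 2 "q ^ 4"]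
      by (simp add: numeral_2_eq_2 power_mult[symmetric] power_add[symmetric])
    then show ?thesis using qpoch_odd[OF q, of 4] nz by (simp add: field_simps)
  qed
  have b: "qpoch_inf (q ^ 24) (q ^ 32) * qpoch_inf (q ^ 8) (q ^ 32) = J 8 q / J 16 q"
  proof -
    have "qpoch_inf (q ^ 8) (q ^ 16) = qpoch_inf (q ^ 8) (q ^ 32) * qpoch_inf (q ^ 24) (q ^ 32)"
      using qpoch_inf_dissect[OF pow_bounds(1)[OF q, of 16], of 2 "q ^ 8"]
      by (simp add: numeral_2_eq_2 power_mult[symmetric] power_add[symmetric])
    then show ?thesis using qpoch_odd[OF q, of 8] nz by (simp add: field_simps)
  qed
  have "jtheta (q ^ 4) (q ^ 16) = J 4 q / J 8 q * J 16 q" "jtheta (q ^ 24) (q ^ 32) = J 8 q / J 16 q * J 32 q"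
    using jtheta_pow[OF q, of 4 16] jtheta_pow[OF q, of 24 32] a b by simp_all
  then show ?thesis using nz by simp
qed

text \<open>The product (q^2;q^4)_inf splits into the classes 2, 6, 10, 14 modulo 16. Two of them
  occur in the theta function of base q^16; the other two are extracted from the base q^32 factors
  by (x;P)_inf (-x;P)_inf = (x^2;P^2)_inf, which leaves the theta function with the minus
  sign.\<close>

lemma quintuple_odd:
  assumes abc: "(a, b, c, d) \<in> {(2, 20, 6, 12), (6, 28, 2, 4)}"
  shows "jtheta (q ^ a) (q ^ 16) * jtheta (q ^ b) (q ^ 32) / J 32 q * (J 3 q * J 4 q ^ 3 / (J 2 q ^ 2 * J 12 q))
    = J 3 q * J 4 q ^ 2 / (J 2 q * J 12 q) * jtheta (- (q ^ c)) (q ^ 16)"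
proof -
  have nz: "J 2 q \<noteq> 0" "J 4 q \<noteq> 0" "J 12 q \<noteq> 0" "J 16 q \<noteq> 0" "J 32 q \<noteq> 0" by (rule J_nz[OF q]; simp)+
  define p where "p i = qpoch_inf (q ^ i) (q ^ 16)" for i
  define r where "r i = qpoch_inf (q ^ i) (q ^ 32)" for i
  have four: "J 2 q / J 4 q = p 2 * p 6 * p 10 * p 14"
  proof -
    have i4: "{..<4} = {0, 1, 2, 3::nat}" by auto
    have ex: "q ^ 2 * q ^ 4 = q ^ 6" "q ^ 2 * q ^ 8 = q ^ 10" "q ^ 2 * q ^ 12 = q ^ 14"
      by (simp_all flip: power_add)
    have "qpoch_inf (q ^ 2) (q ^ 4) = p 2 * p 6 * p 10 * p 14"
      using qpoch_inf_dissect[OF pow_bounds(1)[OF q, of 4], of 4 "q ^ 2"]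
            unfolding i4 by (simp add: p_def ex mult.assoc power_mult[symmetric] del: power2_eq_square)
    then show ?thesis using qpoch_odd[OF q, of 2] nz by (simp add: field_simps)
  qed
  have pm: "qpoch_inf (- (q ^ i)) (q ^ 16) * p i = r (2 * i)" for i
    using qpoch_inf_plus_minus[OF pow_bounds(1)[OF q, of 16], of "q ^ i"]
    by (simp add: p_def r_def power_mult[symmetric] mult.commute)
  have p0: "p 2 \<noteq> 0" "p 6 \<noteq> 0" "p 10 \<noteq> 0" "p 14 \<noteq> 0" using four nz by (auto simp: field_simps)
  have main: "jtheta (q ^ a) (q ^ 16) * jtheta (q ^ b) (q ^ 32) * J 4 q = J 2 q * J 32 q * jtheta (- (q ^ c)) (q ^ 16)"
  proof -
    from abc consider "a = 2" "b = 20" "c = 6" | "a = 6" "b = 28" "c = 2" by auto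
    then show ?thesis
    proof cases
      case 1
      have "jtheta (q ^ a) (q ^ 16) * jtheta (q ^ b) (q ^ 32) * J 4 q = p 2 * p 14 * J 16 q * (r 20 * r 12 * J 32 q) * J 4 q"
        using jtheta_pow[OF q, of 2 16] jtheta_pow[OF q, of 20 32] by (simp add: 1 p_def r_def)
      also have "\<dots> = (p 2 * p 6 * p 10 * p 14) * J 4 q * J 32 q * (qpoch_inf (- (q ^ 6)) (q ^ 16) * qpoch_inf (- (q ^ 10)) (q ^ 16) * J 16 q)"
        using pm[of 6, symmetric] pm[of 10, symmetric] by (simp add: mult_ac)
      also have "\<dots> = J 2 q * J 32 q * jtheta (- (q ^ 6)) (q ^ 16)"
        using four nz jtheta_neg_pow[OF q, of 6 16] by (simp add: field_simps)
      finally show ?thesis by (simp add: 1)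
    next
      case 2
      have "jtheta (q ^ a) (q ^ 16) * jtheta (q ^ b) (q ^ 32) * J 4 q = p 6 * p 10 * J 16 q * (r 28 * r 4 * J 32 q) * J 4 q"
        using jtheta_pow[OF q, of 6 16] jtheta_pow[OF q, of 28 32] by (simp add: 2 p_def r_def)
      also have "\<dots> = (p 2 * p 6 * p 10 * p 14) * J 4 q * J 32 q * (qpoch_inf (- (q ^ 2)) (q ^ 16) * qpoch_inf (- (q ^ 14)) (q ^ 16) * J 16 q)"
        using pm[of 2, symmetric] pm[of 14, symmetric] by (simp add: mult_ac)
      also have "\<dots> = J 2 q * J 32 q * jtheta (- (q ^ 2)) (q ^ 16)"
        using four nz jtheta_neg_pow[OF q, of 2 16] by (simp add: field_simps)
      finally show ?thesis by (simp add: 2)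
    qed
  qed
  have "jtheta (q ^ a) (q ^ 16) * jtheta (q ^ b) (q ^ 32) / J 32 q * (J 3 q * J 4 q ^ 3 / (J 2 q ^ 2 * J 12 q))
     = (jtheta (q ^ a) (q ^ 16) * jtheta (q ^ b) (q ^ 32) * J 4 q) * (J 3 q * J 4 q ^ 2 / (J 32 q * J 2 q ^ 2 * J 12 q))"
    using nz by (simp add: field_simps eval_nat_numeral)
  also have "\<dots> = J 3 q * J 4 q ^ 2 / (J 2 q * J 12 q) * jtheta (- (q ^ c)) (q ^ 16)"
    unfolding main using nz by (simp add: field_simps eval_nat_numeral)
  finally show ?thesis .
qed

end

theorem theorem2p7:
  fixes \<tau> q :: complex and r :: nat
  assumes "Im \<tau> > 0"
    and "q = exp (2 * of_real pi * \<i> * \<tau>)"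
    and "r \<in> {0, 1, 2}"
  shows "(qpoch_inf q q) ^ 3 * norm_string_fun 3 8 1 (2 * r + 1) \<tau> =
      Theta38 (2 * r + 1) q
      - q powi (1 - 2 * int r)
        * (jtheta (q powi (6 - 2 * int r)) (q ^ 16) * jtheta (q powi (28 - 4 * int r)) (q ^ 32)
           / J 32 q)
        * (- psi3 (- q))
      + q powi (- int r)
        * (jtheta (q powi (2 + 2 * int r)) (q ^ 16) * jtheta (q powi (20 + 4 * int r)) (q ^ 32)
           / J 32 q)
        * (1 - chi3 q)"
proof -
  have qe: "q = epow \<tau> 1" using assms(2) by (simp add: epow_def)
  define s where "s = int r + 1"
  have q: "norm q < 1" "q \<noteq> 0" using q_bounds[OF assms(1) qe assms(3) s_def] by auto
  have L: "(qpoch_inf q q) ^ 3 * norm_string_fun 3 8 1 (2 * r + 1) \<tau> = string_coeff q s 0"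
    by (rule norm_string_fun_string_coeff[OF assms(1) qe assms(3) s_def])
  define K where "K = J 1 q ^ 3 / jtheta (- 1) q"
  define K3 where "K3 = J 3 q ^ 3 / jtheta (- 1) (q ^ 3)"
  define T where "T = J 3 q * J 4 q ^ 3 / (J 2 q ^ 2 * J 12 q)"
  define x where "x = chi3 q"
  define p where "p = psi3 (- q)"
  \<comment> \<open>The numerators at q are n1, J_4 and n3 for r = 0, 1, 2; the first product in the
    statement is the one belonging to 2 - r.\<close>
  define n1 where "n1 = jtheta (q ^ 2) (q ^ 16) * jtheta (q ^ 20) (q ^ 32) / J 32 q"
  define n3 where "n3 = jtheta (q ^ 6) (q ^ 16) * jtheta (q ^ 28) (q ^ 32) / J 32 q"
  have J1: "J 1 q = qpoch_inf q q" using J_eq[OF q, of 1] by simp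
  have K3': "K3 = qpoch_inf (q ^ 3) (q ^ 3) ^ 3 / jtheta (- 1) (q ^ 3)" using J_eq[OF q, of 3] by (simp add: K3_def)
  note V = string_coeff_values[OF q refl J1 refl K_def K3', folded x_def p_def]
  note E = eta_identities[OF q K_def K3_def]
  have N: "char_num q 1 q = n1" "char_num q 2 q = J 4 q" "char_num q 3 q = n3"
    using char_num_quintuple[OF q, of 1] char_num_quintuple[OF q, of 2] char_num_quintuple[OF q, of 3] quintuple_4[OF q]
    by (simp_all add: n1_def n3_def)
  have R: "section_residue q 1 = n1" "section_residue q 2 = J 4 q / q" "q ^ 3 * section_residue q 3 = q * n3" "section_residue q 3 = n3 / q ^ 2"
    using q unfolding section_residue_def[OF q] N by (simp_all add: power_int_minus field_simps eval_nat_numeral)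
  have T1: "n1 * T = Theta38 1 q" using quintuple_odd[OF q, of 2 20 6 12] by (simp add: n1_def T_def Theta38_def)
  have T3: "n3 / q ^ 2 * T = Theta38 5 q"
    using arg_cong[OF quintuple_odd[OF q, of 6 28 2 4], of "\<lambda>t. t / q ^ 2"]
    by (simp add: n3_def T_def Theta38_def power_int_minus divide_inverse mult_ac)
  have T2: "J 4 q / q * (3 * (K3 - K) / (2 * J 1 q)) = Theta38 3 q"
    using arg_cong[OF E(2), of "\<lambda>t. t / q"] q by (simp add: Theta38_def) (simp add: mult_ac)
  from assms(3) consider "r = 0" | "r = 1" | "r = 2" by auto
  then show ?thesis
  proof cases
    case 1
    have "string_coeff q 1 0 = Theta38 1 q + n1 * (1 - x) + q * n3 * p"
      using V(2) q unfolding E(1) T_def[symmetric] R T1[symmetric] by (simp add: algebra_simps) (simp add: eval_nat_numeral)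
    then show ?thesis unfolding L using 1 by (simp add: s_def n1_def n3_def x_def p_def algebra_simps)
  next
    case 2
    have "string_coeff q 2 0 = Theta38 3 q + J 4 q / q * (1 - x) + J 4 q / q * p"
      using V(1) unfolding R T2[symmetric] by (simp add: distrib_left right_diff_distrib)
    then show ?thesis unfolding L using 2 quintuple_4[OF q] by (simp add: s_def x_def p_def power_int_minus divide_inverse algebra_simps) (simp add: numeral_3_eq_3)
  next
    case 3
    have "q ^ 3 * string_coeff q 3 0 = n3 * q * (T + 1 - x) + n1 * p"
      using V(3) q unfolding E(1) T_def[symmetric] R T3[symmetric] by (simp add: field_simps eval_nat_numeral)
    also have "\<dots> = q ^ 3 * (Theta38 5 q + n3 / q ^ 2 * (1 - x) + n1 / q ^ 3 * p)"
      using q unfolding T3[symmetric] by (simp add: field_simps eval_nat_numeral)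
    finally have "string_coeff q 3 0 = Theta38 5 q + n3 / q ^ 2 * (1 - x) + n1 / q ^ 3 * p"
      using q by simp
    then show ?thesis unfolding L using 3
      by (simp add: s_def n1_def n3_def x_def p_def power_int_minus divide_inverse algebra_simps)
  qed
qed

end
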